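(* Let $d\ge1$, $n=3d-1$, and let $\mathcal P=(p_1,\dots,p_n,l)\in\mathbb R^{2n}\times[0,\infty)$ be a point in $\mathrm{ev}\times j$-general position whose $j$-invariant $l$ is very large (that is, $l>L$ for some bound $L$ depending on $d$ and $p_1,\dots,p_n$). Then every tropical curve $C\in(\mathrm{ev}\times j)^{-1}(\mathcal P)$ with $\mathrm{mult}_{\mathrm{ev}\times j}(C)\ne0$ has a contracted bounded edge.
   Context: **Curves.** Graphs may have bounded edges and unbounded edges (ends, with one vertex each). A flag $F=(V,e)$ is a vertex $V$ with an edge $e$ starting at $V$ (a loop gives two flags). An abstract tropical curve of genus $g$ is a metric graph $\Gamma$ (each bounded edge $e$ has a length $l(e)>0$) with first Betti number $g$ and all vertices of valence $\ge3$. An $n$-marked plane tropical curve $(\Gamma,h,x_1,\dots,x_n)$ is such a $\Gamma$ with distinct ends $x_1,\dots,x_n$ (marked ends) and a continuous map $h:\Gamma\to\mathbb R^2$ such that: on each edge, parametrized by length starting at the vertex of a flag $F$, $h(t)=a+t\,v(F)$ with $v(F)\in\mathbb Z^2$ (the direction of $F$); $\sum_{F\ni V}v(F)=0$ at each vertex $V$; and each $x_i$ is mapped to a point ($v=0$). An edge of direction $0$ is called contracted. Curves are identified up to isometry of $\Gamma$ preserving the $x_i$ and $h$. The curve has degree $d$ if the directions of its non-marked ends are $(-1,0),(0,-1),(1,1)$, each $d$ times. $\mathcal M_{\mathrm{trop},1,n}(d)$ is the set of isomorphism classes of connected $n$-marked plane tropical curves of degree $d$ and genus $\le1$. A genus $1$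 curve has a unique cycle; genus $1$ curves are called elliptic and genus $0$ curves rational. **Strata.** The combinatorial type $\alpha$ of a curve is the homeomorphism type of $\Gamma$ relative to the $x_i$ together with all directions $v(F)$; $\mathcal M^\alpha$ is the set of curves of type $\alpha$. With coordinates the position $h(V)$ of a root vertex and the lengths of the bounded edges, $\mathcal M^\alpha\subset\mathbb R^{2+b}$, where $b$ is the number of bounded edges. The deficiency is $\mathrm{def}(\alpha)=2$ if $g=1$ and the cycle is mapped to a point, $1$ if $g=1$ and the cycle is mapped to a line, $0$ otherwise. Then $\dim\mathcal M^\alpha=3d+n+g-1-\sum_V(\mathrm{val}\,V-3)+\mathrm{def}(\alpha)$. Boundary points of $\mathcal M^\alpha$ (some lengths $0$) are identified with the curves obtained by contracting the edges of length $0$. **The weighted complex $\mathcal M'_{\mathrm{trop},1,n}(d)$.** It is obtained from $\mathcal M_{\mathrm{trop},1,n}(d)$ by removing all strata of dimension $>3d+n$ and all strata of rational curves not contained in the boundary of a genus $1$ stratum; its cells are the remaining strata, and its dimension is $3d+n$. Strata of dimension $3d+n$ carry the following weights. (a) $\mathrm{def}(\alpha)=0$, genus $1$ (all vertices are then $3$-valent): the condition that the image of the cycle closes up is given by two linear forms $a_1,a_2$ in the lengths; the weight is the index of the image of $(a_1,a_2):\mathbb Z^{2+b}\to\mathbb Z^2$. (b) $\mathrm{def}(\alpha)=1$ (exactly one $4$-valent vertex, all others $3$-valent): if the $4$-valent vertex lies on the cycle, so that the flat cycle consists of two parallel strands leaving this vertex with directions $n'u$ and $m'u$ ($n',m'\ge1$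 coprime integers, $u\in\mathbb Z^2$), let $v$ be the direction of another edge at the $4$-valent vertex; the weight is $|\det(u,v)|$ if $n'\ne m'$, or if $n'=m'=1$ and the cycle is formed by three edges due to the presence of a marked end; it is $\frac12|\det(u,v)|$ if $n'=m'=1$ and no marked end is attached to the flat cycle. If the $4$-valent vertex is not on the cycle, the weight is $0$. (c) $\mathrm{def}(\alpha)=2$: if there is a $5$-valent vertex to which the contracted loop is adjacent, its three other edges being non-marked, the weight is $\frac12(|\det(u,v)|-1)$, with $u,v$ the directions of two of these three edges. In all other cases (two $4$-valent vertices; the $5$-valent vertex not on the cycle; a marked end at the $5$-valent vertex carrying the loop) the weight is $0$. **The map.** $\mathrm{ev}(C)=(h(x_1),\dots,h(x_n))\in\mathbb R^{2n}$. For $C$ of genus $1$, $j(C)>0$ is the length of the cycle (the sum of the lengths $l(e)$ of its edges); for $C$ rational, $j(C)=0$. This gives $\mathrm{ev}\times j:\mathcal M'_{\mathrm{trop},1,n}(d)\to\mathbb R^{2n}\times[0,\infty)$, linear on each cell. For $n=3d-1$ source and target both have dimension $6d-1$. For $C$ in a cell $\mathcal M^\alpha$ of dimension $6d-1$, $\mathrm{mult}_{\mathrm{ev}\times j}(C)$ is the absolute value of the determinant of $\mathrm{ev}\times j$ on $\mathcal M^\alpha$, computed in a basis of the lattice of integer points of $\mathbb Z^{2+b}$ in the linear subspace of $\mathbb R^{2+b}$ spanned by $\mathcal M^\alpha$, times the weight of the cell. A point $\mathcal P$ is in $\mathrm{ev}\times j$-general position if all points of its fibre lie in cells of dimension $6d-1$.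 *)

theory Defs
  imports "HOL-Analysis.Analysis" "HOL-Analysis.Finite_Function_Topology" "Jordan_Normal_Form.Determinant"
begin

text \<open>
  A graph with ends is given by its vertices and its flags. The map \<open>opp\<close> is an involution on the
  flags: a two-element orbit \<open>{F, opp F}\<close> is a bounded edge (a loop if both flags start at the same
  vertex), and a fixed point is an end. A map from the graph to the plane that is affine on all
  edges, with integral directions, is given by the directions of the flags and the images of
  the vertices. A \<open>ctype\<close> is a combinatorial type; \<open>mark i\<close>, for \<open>i < n\<close>, is the \<open>(i+1)\<close>-st marked
  end. All vertices and flags are natural numbers, which is no restriction for finite graphs.
\<close>

record ctype =
  verts :: "nat set"
  flags :: "nat set"
  vert  :: "nat \<Rightarrow> nat"
  opp   :: "nat \<Rightarrow> nat"
  dir   :: "nat \<Rightarrow> int \<times> int"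
  mark  :: "nat \<Rightarrow> nat"

record curve = ctype +
  len  :: "nat set \<Rightarrow> real"
  hpos :: "nat \<Rightarrow> real \<times> real"

definition end_flags :: "'a ctype_scheme \<Rightarrow> nat set" where
  "end_flags T = {F \<in> flags T. opp T F = F}"

definition bounded_flags :: "'a ctype_scheme \<Rightarrow> nat set" where
  "bounded_flags T = {F \<in> flags T. opp T F \<noteq> F}"

definition edge :: "'a ctype_scheme \<Rightarrow> nat \<Rightarrow> nat set" where
  "edge T F = {F, opp T F}"

definition bounded_edges :: "'a ctype_scheme \<Rightarrow> nat set set" where
  "bounded_edges T = edge T ` bounded_flags T"

definition flags_at :: "'a ctype_scheme \<Rightarrow> nat \<Rightarrow> nat set" where
  "flags_at T V = {F \<in> flags T. vert T F = V}"

definition valence :: "'a ctype_scheme \<Rightarrow> nat \<Rightarrow> nat" where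
  "valence T V = card (flags_at T V)"

definition is_graph :: "'a ctype_scheme \<Rightarrow> bool" where
  "is_graph T \<longleftrightarrow>
     finite (verts T) \<and> verts T \<noteq> {} \<and> finite (flags T) \<and>
     (\<forall>F\<in>flags T. vert T F \<in> verts T \<and> opp T F \<in> flags T \<and> opp T (opp T F) = F)"

definition connected_graph :: "'a ctype_scheme \<Rightarrow> bool" where
  "connected_graph T \<longleftrightarrow>
     (\<forall>V\<in>verts T. \<forall>W\<in>verts T.
        (V, W) \<in> {(vert T F, vert T (opp T F)) | F. F \<in> bounded_flags T}\<^sup>*)"

text \<open>The first Betti number of a connected graph; the subtraction does not truncate then.\<close>

definition genus :: "'a ctype_scheme \<Rightarrow> nat" where
  "genus T = card (bounded_edges T) + 1 - card (verts T)"

definition real_dir :: "'a ctype_scheme \<Rightarrow> nat \<Rightarrow> real \<times> real" where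
  "real_dir T F = (real_of_int (fst (dir T F)), real_of_int (snd (dir T F)))"

definition marked_flags :: "nat \<Rightarrow> 'a ctype_scheme \<Rightarrow> nat set" where
  "marked_flags n T = mark T ` {..<n}"

definition plane_type :: "nat \<Rightarrow> nat \<Rightarrow> 'a ctype_scheme \<Rightarrow> bool" where
  "plane_type n d T \<longleftrightarrow>
     is_graph T \<and> connected_graph T \<and>
     (\<forall>V\<in>verts T. valence T V \<ge> 3) \<and>
     (\<forall>F\<in>bounded_flags T. dir T (opp T F) = - dir T F) \<and>
     (\<forall>V\<in>verts T. (\<Sum>F\<in>flags_at T V. dir T F) = 0) \<and>
     inj_on (mark T) {..<n} \<and> marked_flags n T \<subseteq> end_flags T \<and>
     (\<forall>F\<in>marked_flags n T. dir T F = 0) \<and>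
     (\<forall>F\<in>end_flags T - marked_flags n T. dir T F \<in> {(-1, 0), (0, -1), (1, 1)}) \<and>
     (\<forall>u\<in>{(-1, 0), (0, -1), (1, 1)}. card {F \<in> end_flags T - marked_flags n T. dir T F = u} = d)"

text \<open>
  The conditions for edge lengths \<open>l\<close> and vertex images \<open>h\<close> to fit together. They imply that the
  image of every cycle closes up. No sign condition on \<open>l\<close> is included.
\<close>

definition compatible ::
    "'a ctype_scheme \<Rightarrow> (nat set \<Rightarrow> real) \<Rightarrow> (nat \<Rightarrow> real \<times> real) \<Rightarrow> bool" where
  "compatible T l h \<longleftrightarrow>
     (\<forall>F\<in>bounded_flags T. h (vert T (opp T F)) = h (vert T F) + l (edge T F) *\<^sub>R real_dir T F)"

definition plane_curve :: "nat \<Rightarrow> nat \<Rightarrow> curve \<Rightarrow> bool" where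
  "plane_curve n d C \<longleftrightarrow>
     plane_type n d C \<and> (\<forall>e\<in>bounded_edges C. len C e > 0) \<and> compatible C (len C) (hpos C)"

text \<open>
  The elements are representatives of isomorphism classes; everything below is invariant under
  isomorphism.
\<close>

definition M_trop :: "nat \<Rightarrow> nat \<Rightarrow> curve set" where
  "M_trop n d = {C. plane_curve n d C \<and> genus C \<le> 1}"

definition has_contracted_bounded_edge :: "'a ctype_scheme \<Rightarrow> bool" where
  "has_contracted_bounded_edge T \<longleftrightarrow> (\<exists>F\<in>bounded_flags T. dir T F = 0)"


subsection \<open>The cycle\<close>

definition simple_cycle :: "'a ctype_scheme \<Rightarrow> nat list \<Rightarrow> bool" where
  "simple_cycle T Fs \<longleftrightarrow>
     Fs \<noteq> [] \<and> set Fs \<subseteq> bounded_flags T \<and>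
     distinct (map (vert T) Fs) \<and> distinct (map (edge T) Fs) \<and>
     (\<forall>i<length Fs. vert T (opp T (Fs ! i)) = vert T (Fs ! (Suc i mod length Fs)))"

definition cycle_edges :: "'a ctype_scheme \<Rightarrow> nat set set" where
  "cycle_edges T = {edge T F | F Fs. simple_cycle T Fs \<and> F \<in> set Fs}"

definition cycle_flags :: "'a ctype_scheme \<Rightarrow> nat set" where
  "cycle_flags T = \<Union> (cycle_edges T)"

definition edge_image :: "curve \<Rightarrow> nat \<Rightarrow> (real \<times> real) set" where
  "edge_image C F =
     {hpos C (vert C F) + t *\<^sub>R real_dir C F | t. 0 \<le> t \<and> t \<le> len C (edge C F)}"

definition cycle_image :: "curve \<Rightarrow> (real \<times> real) set" where
  "cycle_image C = (\<Union>F\<in>cycle_flags C. edge_image C F)"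

definition deficiency :: "curve \<Rightarrow> nat" where
  "deficiency C =
     (if genus C \<noteq> 1 then 0
      else if \<exists>q. cycle_image C = {q} then 2
      else if collinear (cycle_image C) then 1
      else 0)"


subsection \<open>Strata\<close>

text \<open>
  The coordinate space \<open>\<real>\<^bsup>2+b\<^esup>\<close> consists of the finitely supported functions on \<open>coord\<close> that
  vanish outside \<open>Root_x\<close>, \<open>Root_y\<close> and the lengths of the bounded edges.
\<close>

datatype coord = Root_x | Root_y | Length "nat set"

type_synonym coord_space = "(coord, real) poly_mapping"

definition root_vertex :: "'a ctype_scheme \<Rightarrow> nat" where
  "root_vertex T = (SOME V. V \<in> verts T)"

definition coords ::
    "'a ctype_scheme \<Rightarrow> (nat set \<Rightarrow> real) \<Rightarrow> (nat \<Rightarrow> real \<times> real) \<Rightarrow> coord_space" where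
  "coords T l h =
     Poly_Mapping.single Root_x (fst (h (root_vertex T))) +
     Poly_Mapping.single Root_y (snd (h (root_vertex T))) +
     (\<Sum>e\<in>bounded_edges T. Poly_Mapping.single (Length e) (l e))"

definition stratum :: "'a ctype_scheme \<Rightarrow> coord_space set" where
  "stratum T = {coords T l h | l h. compatible T l h \<and> (\<forall>e\<in>bounded_edges T. l e > 0)}"

text \<open>
  A stratum is a relatively open polyhedral cone, so its dimension is that of its linear span.
\<close>

definition stratum_dim :: "'a ctype_scheme \<Rightarrow> nat" where
  "stratum_dim T = dim (span (stratum T))"

text \<open>
  \<open>C\<close> arises from the type \<open>T\<close> with non-negative edge lengths \<open>l\<close> and vertex images \<open>h\<close> by
  contracting all edges of length \<open>0\<close>. The map \<open>\<phi>\<close> sends a vertex to the vertex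
  of \<open>C\<close> it is merged into, and \<open>\<psi>\<close> identifies the remaining flags.
\<close>

definition surviving_flags :: "'a ctype_scheme \<Rightarrow> (nat set \<Rightarrow> real) \<Rightarrow> nat set" where
  "surviving_flags T l = end_flags T \<union> {F \<in> bounded_flags T. l (edge T F) \<noteq> 0}"

definition contraction ::
    "nat \<Rightarrow> 'a ctype_scheme \<Rightarrow> (nat set \<Rightarrow> real) \<Rightarrow> (nat \<Rightarrow> real \<times> real) \<Rightarrow> curve \<Rightarrow> bool" where
  "contraction n T l h C \<longleftrightarrow>
     (\<exists>\<phi> \<psi>.
        \<phi> ` verts T = verts C \<and>
        (\<forall>V\<in>verts T. \<forall>W\<in>verts T. \<phi> V = \<phi> W \<longleftrightarrow>
           (V, W) \<in> {(vert T F, vert T (opp T F)) | F. F \<in> bounded_flags T \<and> l (edge T F) = 0}\<^sup>*) \<and>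
        (\<forall>V\<in>verts T. hpos C (\<phi> V) = h V) \<and>
        bij_betw \<psi> (surviving_flags T l) (flags C) \<and>
        (\<forall>F\<in>surviving_flags T l.
           vert C (\<psi> F) = \<phi> (vert T F) \<and> opp C (\<psi> F) = \<psi> (opp T F) \<and> dir C (\<psi> F) = dir T F) \<and>
        (\<forall>F\<in>surviving_flags T l \<inter> bounded_flags T. len C (edge C (\<psi> F)) = l (edge T F)) \<and>
        (\<forall>i<n. mark C i = \<psi> (mark T i)))"

definition in_boundary :: "nat \<Rightarrow> 'a ctype_scheme \<Rightarrow> curve \<Rightarrow> bool" where
  "in_boundary n T C \<longleftrightarrow>
     (\<exists>l h. compatible T l h \<and> (\<forall>e\<in>bounded_edges T. l e \<ge> 0) \<and> (\<exists>e\<in>bounded_edges T. l e = 0) \<and>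
            contraction n T l h C)"

text \<open>The stratum of \<open>C\<close> is contained in the boundary of the stratum of a genus \<open>1\<close> curve \<open>D\<close>.\<close>

definition bounds_elliptic_stratum :: "nat \<Rightarrow> nat \<Rightarrow> curve \<Rightarrow> bool" where
  "bounds_elliptic_stratum n d C \<longleftrightarrow>
     (\<exists>D\<in>M_trop n d. genus D = 1 \<and>
        (\<forall>C'. plane_curve n d C' \<and> ctype.truncate C' = ctype.truncate C \<longrightarrow> in_boundary n D C'))"

definition M'_trop :: "nat \<Rightarrow> nat \<Rightarrow> curve set" where
  "M'_trop n d =
     {C \<in> M_trop n d. stratum_dim C \<le> 3 * d + n \<and> (genus C = 0 \<longrightarrow> bounds_elliptic_stratum n d C)}"


subsection \<open>Weights\<close>

definition det2 :: "int \<times> int \<Rightarrow> int \<times> int \<Rightarrow> int" where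
  "det2 u v = fst u * snd v - snd u * fst v"

definition zscale :: "int \<Rightarrow> int \<times> int \<Rightarrow> int \<times> int" where
  "zscale k u = (k * fst u, k * snd u)"

text \<open>
  The two linear forms \<open>(a\<^sub>1, a\<^sub>2)\<close> on \<open>\<int>\<^bsup>2+b\<^esup>\<close> that express that the image of the cycle closes up.
  They do not involve the position of the root vertex.
\<close>

definition closing_form :: "'a ctype_scheme \<Rightarrow> (coord \<Rightarrow> int) \<Rightarrow> int \<times> int" where
  "closing_form T z =
     (\<Sum>F\<leftarrow>(SOME Fs. simple_cycle T Fs). zscale (z (Length (edge T F))) (dir T F))"

text \<open>The index of a subgroup of \<open>\<int>\<^sup>2\<close> (\<open>0\<close> if it is infinite).\<close>

definition index_Z2 :: "(int \<times> int) set \<Rightarrow> nat" where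
  "index_Z2 H = card ((UNIV :: (int \<times> int) set) // {(x, y). x - y \<in> H})"

definition weight0 :: "'a ctype_scheme \<Rightarrow> real" where
  "weight0 T = real (index_Z2 (range (closing_form T)))"

text \<open>
  For deficiency \<open>1\<close>: the \<open>4\<close>-valent vertex \<open>V\<close> lies on the flat cycle, whose two strands leave \<open>V\<close>
  along \<open>F\<close> and \<open>F'\<close> with directions \<open>n'u\<close> and \<open>m'u\<close>, and \<open>G\<close> is another flag at \<open>V\<close>. As \<open>n'\<close> and
  \<open>m'\<close> are positive and coprime, \<open>n' = m'\<close> means \<open>n' = m' = 1\<close>. The weight depends neither on the
  choice of \<open>G\<close> (by the balancing condition) nor on the order of the strands. If there are no such data (the
  \<open>4\<close>-valent vertex is not on the cycle, or its two flags on the cycle do not point in the same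
  direction), the weight is \<open>0\<close>.
\<close>

definition flat_cycle_data ::
    "'a ctype_scheme \<Rightarrow> nat \<Rightarrow> nat \<Rightarrow> nat \<Rightarrow> nat \<Rightarrow> nat \<Rightarrow> nat \<Rightarrow> int \<times> int \<Rightarrow> bool" where
  "flat_cycle_data T V F F' G n' m' u \<longleftrightarrow>
     V \<in> verts T \<and> valence T V = 4 \<and>
     F \<in> flags_at T V \<inter> cycle_flags T \<and> F' \<in> flags_at T V \<inter> cycle_flags T \<and> F \<noteq> F' \<and>
     G \<in> flags_at T V - cycle_flags T \<and>
     n' \<ge> 1 \<and> m' \<ge> 1 \<and> coprime n' m' \<and>
     dir T F = zscale (int n') u \<and> dir T F' = zscale (int m') u"

definition marked_end_on_cycle :: "nat \<Rightarrow> 'a ctype_scheme \<Rightarrow> bool" where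
  "marked_end_on_cycle n T \<longleftrightarrow> (\<exists>F\<in>marked_flags n T. vert T F \<in> vert T ` cycle_flags T)"

definition weight1 :: "nat \<Rightarrow> 'a ctype_scheme \<Rightarrow> real" where
  "weight1 n T =
     (if \<exists>V F F' G n' m' u. flat_cycle_data T V F F' G n' m' u
      then SOME w. \<exists>V F F' G n' m' u. flat_cycle_data T V F F' G n' m' u \<and>
             w = (if n' \<noteq> m' \<or> marked_end_on_cycle n T
                  then real_of_int \<bar>det2 u (dir T G)\<bar>
                  else real_of_int \<bar>det2 u (dir T G)\<bar> / 2)
      else 0)"

text \<open>
  For deficiency \<open>2\<close>: the contracted loop \<open>{F, opp F}\<close> is adjacent to the \<open>5\<close>-valent vertex \<open>V\<close>,
  whose other three edges are non-marked; \<open>G\<close> and \<open>G'\<close> are two of them. By the balancing condition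
  the weight does not depend on their choice.
\<close>

definition contracted_loop_data :: "nat \<Rightarrow> 'a ctype_scheme \<Rightarrow> nat \<Rightarrow> nat \<Rightarrow> nat \<Rightarrow> nat \<Rightarrow> bool" where
  "contracted_loop_data n T V F G G' \<longleftrightarrow>
     V \<in> verts T \<and> valence T V = 5 \<and>
     F \<in> bounded_flags T \<and> vert T F = V \<and> vert T (opp T F) = V \<and>
     (flags_at T V - edge T F) \<inter> marked_flags n T = {} \<and>
     G \<in> flags_at T V - edge T F \<and> G' \<in> flags_at T V - edge T F \<and> G \<noteq> G'"

definition weight2 :: "nat \<Rightarrow> 'a ctype_scheme \<Rightarrow> real" where
  "weight2 n T =
     (if \<exists>V F G G'. contracted_loop_data n T V F G G'
      then SOME w. \<exists>V F G G'. contracted_loop_data n T V F G G' \<and>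
             w = (real_of_int \<bar>det2 (dir T G) (dir T G')\<bar> - 1) / 2
      else 0)"

text \<open>Only meaningful for curves in strata of dimension \<open>3 d + n\<close>, which all have genus \<open>1\<close>.\<close>

definition weight :: "nat \<Rightarrow> curve \<Rightarrow> real" where
  "weight n C =
     (if genus C \<noteq> 1 then 0
      else if deficiency C = 0 then weight0 C
      else if deficiency C = 1 then weight1 n C
      else weight2 n C)"


subsection \<open>The map ev x j and its multiplicity\<close>

definition ev_map :: "'a ctype_scheme \<Rightarrow> (nat \<Rightarrow> real \<times> real) \<Rightarrow> nat \<Rightarrow> real \<times> real" where
  "ev_map T h i = h (vert T (mark T i))"

definition j_map :: "'a ctype_scheme \<Rightarrow> (nat set \<Rightarrow> real) \<Rightarrow> real" where
  "j_map T l = (if genus T = 1 then \<Sum>e\<in>cycle_edges T. l e else 0)"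

definition ev :: "curve \<Rightarrow> nat \<Rightarrow> real \<times> real" where
  "ev C = ev_map C (hpos C)"

definition j_inv :: "curve \<Rightarrow> real" where
  "j_inv C = j_map C (len C)"

text \<open>
  The linear extension of \<open>ev \<times> j\<close> to the span of the stratum: for \<open>w\<close> in the span the vertex images
  are still determined by \<open>w\<close>, the lengths now being arbitrary real numbers.
\<close>

definition lengths_of :: "coord_space \<Rightarrow> nat set \<Rightarrow> real" where
  "lengths_of w e = Poly_Mapping.lookup w (Length e)"

definition positions_of :: "'a ctype_scheme \<Rightarrow> coord_space \<Rightarrow> nat \<Rightarrow> real \<times> real" where
  "positions_of T w V =
     (THE q. \<exists>h. compatible T (lengths_of w) h \<and>
        h (root_vertex T) = (Poly_Mapping.lookup w Root_x, Poly_Mapping.lookup w Root_y) \<and> q = h V)"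

text \<open>
  On the stratum itself, \<open>positions_of\<close> gives back the vertex images of the curve.
\<close>

lemma lookup_coords:
  assumes "is_graph T"
  shows "Poly_Mapping.lookup (coords T l h) Root_x = fst (h (root_vertex T))"
    and "Poly_Mapping.lookup (coords T l h) Root_y = snd (h (root_vertex T))"
    and "e \<in> bounded_edges T \<Longrightarrow> Poly_Mapping.lookup (coords T l h) (Length e) = l e"
proof -
  have fin: "finite (bounded_edges T)"
    using assms by (auto simp: is_graph_def bounded_edges_def bounded_flags_def)
  have sum: "Poly_Mapping.lookup (\<Sum>e\<in>bounded_edges T. Poly_Mapping.single (Length e) (l e)) c =
        (\<Sum>e\<in>bounded_edges T. if Length e = c then l e else 0)" for c
    by (simp add: lookup_sum lookup_single when_def)
  show "Poly_Mapping.lookup (coords T l h) Root_x = fst (h (root_vertex T))"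
    and "Poly_Mapping.lookup (coords T l h) Root_y = snd (h (root_vertex T))"
    by (simp_all add: coords_def lookup_add lookup_single sum)
  show "Poly_Mapping.lookup (coords T l h) (Length e) = l e" if "e \<in> bounded_edges T"
    using fin that by (simp add: coords_def lookup_add lookup_single sum)
qed

lemma compatible_cong:
  assumes "\<And>e. e \<in> bounded_edges T \<Longrightarrow> l e = l' e"
  shows "compatible T l h \<longleftrightarrow> compatible T l' h"
  using assms by (auto simp: compatible_def bounded_edges_def)

lemma compatible_unique:
  assumes "is_graph T" "connected_graph T" "compatible T l h" "compatible T l h'"
    and "h (root_vertex T) = h' (root_vertex T)" "V \<in> verts T"
  shows "h V = h' V"
proof -
  have r: "root_vertex T \<in> verts T"
    using assms(1) unfolding root_vertex_def is_graph_def by (metis ex_in_conv someI)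
  have "(root_vertex T, V) \<in> {(vert T F, vert T (opp T F)) | F. F \<in> bounded_flags T}\<^sup>*"
    using assms(2,6) r by (auto simp: connected_graph_def)
  then show ?thesis
    by induction (use assms(3,4,5) in \<open>auto simp: compatible_def\<close>)
qed

lemma positions_of_coords:
  assumes "is_graph T" "connected_graph T" "compatible T l h" "V \<in> verts T"
  shows "positions_of T (coords T l h) V = h V"
proof -
  have *: "compatible T (lengths_of (coords T l h)) g \<longleftrightarrow> compatible T l g" for g
    by (rule compatible_cong) (simp add: lengths_of_def lookup_coords(3)[OF assms(1)])
  show ?thesis
    unfolding positions_of_def * lookup_coords(1,2)[OF assms(1)]
    by (rule the_equality) (use assms compatible_unique in \<open>auto\<close>)
qed

text \<open>The \<open>2 n + 1\<close> components of \<open>ev \<times> j\<close>, the last one being \<open>j\<close>.\<close>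

definition evj_component :: "nat \<Rightarrow> 'a ctype_scheme \<Rightarrow> coord_space \<Rightarrow> nat \<Rightarrow> real" where
  "evj_component n T w k =
     (if k < 2 * n
      then (if even k then fst else snd) (ev_map T (positions_of T w) (k div 2))
      else j_map T (lengths_of w))"

definition stratum_lattice :: "'a ctype_scheme \<Rightarrow> coord_space set" where
  "stratum_lattice T = {w \<in> span (stratum T). \<forall>c. Poly_Mapping.lookup w c \<in> \<int>}"

definition lattice_basis :: "coord_space set \<Rightarrow> coord_space list \<Rightarrow> bool" where
  "lattice_basis \<Lambda> bs \<longleftrightarrow>
     distinct bs \<and> independent (set bs) \<and>
     \<Lambda> = {\<Sum>k<length bs. real_of_int (z k) *\<^sub>R bs ! k | z. True}"

definition evj_matrix :: "nat \<Rightarrow> 'a ctype_scheme \<Rightarrow> coord_space list \<Rightarrow> real Matrix.mat" where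
  "evj_matrix n T bs = Matrix.mat (2 * n + 1) (2 * n + 1) (\<lambda>(i, k). evj_component n T (bs ! k) i)"

text \<open>Meaningful for strata of dimension \<open>2 n + 1\<close>, and then independent of the chosen basis.\<close>

definition mult_evj :: "nat \<Rightarrow> curve \<Rightarrow> real" where
  "mult_evj n C =
     \<bar>Determinant.det (evj_matrix n C (SOME bs. lattice_basis (stratum_lattice C) bs))\<bar> * weight n C"

definition fibre :: "nat \<Rightarrow> nat \<Rightarrow> (nat \<Rightarrow> real \<times> real) \<Rightarrow> real \<Rightarrow> curve set" where
  "fibre n d p l = {C \<in> M'_trop n d. (\<forall>i<n. ev C i = p i) \<and> j_inv C = l}"

text \<open>For \<open>n = 3 d - 1\<close>.\<close>

definition evj_general :: "nat \<Rightarrow> nat \<Rightarrow> (nat \<Rightarrow> real \<times> real) \<Rightarrow> real \<Rightarrow> bool" where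
  "evj_general n d p l \<longleftrightarrow> (\<forall>C\<in>fibre n d p l. stratum_dim C = 6 * d - 1)"

end

theory Submission
  imports Defs
begin

(*
  The proof is by contradiction. A non-zero multiplicity makes ev x j bijective on the span V of the
  stratum of C. There are finitely many combinatorial types, so if j were unbounded it would be
  unbounded on the curves of one type through p_1, ..., p_n, and there would be a recession
  direction: a datum (l0, h0) in V with non-negative lengths, all marked points at the origin, and a
  cycle of positive length. It spans the kernel of ev.

  Let S be the set of vertices that h0 does not map to the origin. Since the kernel is a line, S is
  connected, and counting unknowns and equations bounds the number of ends at S by two. The edges
  from S to the other vertices are radial. A maximum principle for linear forms on S confines the
  image of S to the cone spanned by the directions of its ends. If two directions occur, they form
  a lattice basis, so only one radial edge fits into the interior of the cone, whereas the cycle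
  needs two. If only one direction occurs, S has to be a single vertex of valence at least 4 with
  all its edges parallel. Then the cycle is flat, and the determinant in its weight vanishes.
*)

section \<open>Linear algebra over the reals and the rationals\<close>

text \<open>Without contracted bounded edges the vertex images determine the lengths: compatibility
  then only says that each displacement is parallel to the direction of its edge, one scalar
  equation per edge. This is what allows counting equations against unknowns, and setting the
  recession direction to zero on a part of \<open>S\<close>. Flatness of the cycle enters the count
  twice: the dimension of the stratum then leaves room for one extra flag, and one equation around
  the cycle becomes redundant. The two corrections cancel, so the bound on the ends is the same in
  both cases. The multiplicity refers to an arbitrarily chosen lattice basis. A non-zero determinant
  says something about real data only if such a basis exists and spans the whole real space; this
  rests on the compatibility conditions having rational coefficients. Vertices and flags carry
  arbitrary names, so literally there are infinitely many types. Finiteness is proved for codes that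
  forget the names, and the bound is carried from one representative of each code to the other
  curves.\<close>

lemma underdetermined_system:
  fixes a :: "'j \<Rightarrow> 'i \<Rightarrow> 'a::field"
  assumes "finite J" "finite I" "card J < card I"
  shows "\<exists>c. (\<exists>i\<in>I. c i \<noteq> 0) \<and> (\<forall>j\<in>J. (\<Sum>i\<in>I. a j i * c i) = 0)"
  using assms
proof (induction J arbitrary: I a rule: finite_induct)
  case empty
  then obtain i where "i \<in> I" by (metis card.empty ex_in_conv less_irrefl)
  then show ?case by (intro exI[of _ "\<lambda>_. 1"]) auto
next
  case (insert k J)
  show ?case
  proof (cases "\<forall>i\<in>I. a k i = 0")
    case True
    have "card J < card I" using insert.prems insert.hyps by simp
    from insert.IH[OF insert.prems(1) this, of a] obtain c where "\<exists>i\<in>I. c i \<noteq> 0" "\<forall>j\<in>J. (\<Sum>i\<in>I. a j i * c i) = 0"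
      by blast
    with True show ?thesis by (intro exI[of _ c]) auto
  next
    case False
    then obtain p where p: "p \<in> I" "a k p \<noteq> 0" by auto
    define I' where "I' = I - {p}"
    have I': "finite I'" "card J < card I'"
      using insert.prems insert.hyps p by (auto simp: I'_def)
    \<comment> \<open>Gaussian elimination: equation \<open>k\<close> is solved for the pivot
      unknown \<open>p\<close>, and \<open>b\<close> is the system that remains.\<close>
    define b where "b j i = a j i - a j p * a k i / a k p" for j i
    from insert.IH[OF I', of b] obtain c where c: "\<exists>i\<in>I'. c i \<noteq> 0" "\<forall>j\<in>J. (\<Sum>i\<in>I'. b j i * c i) = 0"
      by blast
    define s where "s = (\<Sum>i\<in>I'. a k i * c i)"
    define c' where "c' = c(p := - s / a k p)"
    have sum: "(\<Sum>i\<in>I. a j i * c' i) = - a j p * s / a k p + (\<Sum>i\<in>I'. a j i * c i)" for j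
    proof -
      have "(\<Sum>i\<in>I. a j i * c' i) = a j p * c' p + (\<Sum>i\<in>I'. a j i * c' i)"
        unfolding I'_def using insert.prems p by (simp add: sum.remove)
      also have "(\<Sum>i\<in>I'. a j i * c' i) = (\<Sum>i\<in>I'. a j i * c i)"
        by (rule sum.cong) (auto simp: I'_def c'_def)
      finally show ?thesis by (simp add: c'_def)
    qed
    have "(\<Sum>i\<in>I. a k i * c' i) = 0"
      using p by (simp add: sum s_def)
    moreover have "(\<Sum>i\<in>I. a j i * c' i) = 0" if "j \<in> J" for j
    proof -
      have "(\<Sum>i\<in>I'. b j i * c i) = (\<Sum>i\<in>I'. a j i * c i - (a j p / a k p) * (a k i * c i))"
        by (rule sum.cong) (auto simp: b_def algebra_simps)
      also have "\<dots> = (\<Sum>i\<in>I'. a j i * c i) - a j p / a k p * s"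
        by (simp add: sum_subtractf sum_distrib_left s_def)
      finally show ?thesis using c that by (simp add: sum)
    qed
    moreover have "\<exists>i\<in>I. c' i \<noteq> 0"
      using c(1) by (auto simp: I'_def c'_def)
    ultimately show ?thesis by (intro exI[of _ c']) auto
  qed
qed

text \<open>A new element either lies in the rational span of the old basis or extends it. Spans and
  independence are written as explicit sums, so that the reals need not be set up as a vector space
  over the rationals.\<close>

lemma rational_basis_of_reals:
  fixes X :: "real set"
  assumes "finite X"
  shows "\<exists>(B :: real set) (q :: real \<Rightarrow> real \<Rightarrow> rat). finite B \<and>
           (\<forall>x\<in>X. x = (\<Sum>b\<in>B. of_rat (q x b) * b)) \<and>
           (\<forall>c :: real \<Rightarrow> rat. (\<Sum>b\<in>B. of_rat (c b) * b) = 0 \<longrightarrow> (\<forall>b\<in>B. c b = 0))"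
  using assms
proof induction
  case empty
  show ?case by (intro exI[of _ "{}"]) auto
next
  case (insert y X)
  from insert.IH obtain B :: "real set" and q :: "real \<Rightarrow> real \<Rightarrow> rat" where Bq: "finite B \<and>
      (\<forall>x\<in>X. x = (\<Sum>b\<in>B. of_rat (q x b) * b)) \<and>
      (\<forall>c :: real \<Rightarrow> rat. (\<Sum>b\<in>B. of_rat (c b) * b) = 0 \<longrightarrow> (\<forall>b\<in>B. c b = 0))"
    by (elim exE)
  then have B: "finite B" by (rule conjunct1)
  have q: "x = (\<Sum>b\<in>B. of_rat (q x b) * b)" if "x \<in> X" for x
    using Bq[THEN conjunct2, THEN conjunct1] that by (rule bspec)
  have ind: "\<forall>b\<in>B. c b = 0" if "(\<Sum>b\<in>B. of_rat (c b) * b) = 0" for c :: "real \<Rightarrow> rat"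
    using Bq[THEN conjunct2, THEN conjunct2, THEN spec, THEN mp, OF that] .
  show ?case
  proof (cases "\<exists>c :: real \<Rightarrow> rat. y = (\<Sum>b\<in>B. of_rat (c b) * b)")
    case True
    then obtain c :: "real \<Rightarrow> rat" where c: "y = (\<Sum>b\<in>B. of_rat (c b) * b)" by auto
    have "\<forall>x\<in>insert y X. x = (\<Sum>b\<in>B. of_rat ((q(y := c)) x b) * b)"
    proof
      fix x assume x: "x \<in> insert y X"
      show "x = (\<Sum>b\<in>B. of_rat ((q(y := c)) x b) * b)"
      proof (cases "x = y")
        case True
        with c show ?thesis by simp
      next
        case False
        with q[of x] x show ?thesis by simp
      qed
    qed
    then show ?thesis using B ind by (intro exI[of _ B] exI[of _ "q(y := c)"] conjI allI impI)
  next
    case False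
    have yB: "y \<notin> B"
    proof
      assume "y \<in> B"
      have "(\<Sum>b\<in>B. of_rat (if b = y then 1 else 0) * b) = (\<Sum>b\<in>B. if b = y then b else 0)"
        by (rule sum.cong) auto
      also have "\<dots> = y" using \<open>y \<in> B\<close> B by simp
      finally have "y = (\<Sum>b\<in>B. of_rat (if b = y then 1 else 0) * b)" by simp
      with False show False by (auto dest: spec[of _ "\<lambda>b. if b = y then 1 else 0"])
    qed
    define q' where "q' x b = (if x = y then (if b = y then 1 else 0) else if b = y then 0 else q x b)" for x b
    have 1: "x = (\<Sum>b\<in>insert y B. of_rat (q' x b) * b)" if "x \<in> insert y X" for x
    proof (cases "x = y")
      case True
      have "(\<Sum>b\<in>B. of_rat (q' y b) * b) = 0"
        using yB by (intro sum.neutral) (auto simp: q'_def)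
      then show ?thesis using True B yB by (simp add: q'_def[of y y])
    next
      case False
      then have "x = (\<Sum>b\<in>B. of_rat (q x b) * b)" using that q by blast
      also have "\<dots> = (\<Sum>b\<in>B. of_rat (q' x b) * b)"
        using False yB by (intro sum.cong) (auto simp: q'_def)
      finally show ?thesis using False B yB by (simp add: q'_def[of x y])
    qed
    have 2: "\<forall>b\<in>insert y B. c b = 0"
      if c: "(\<Sum>b\<in>insert y B. of_rat (c b) * b) = 0" for c :: "real \<Rightarrow> rat"
    proof -
      have eq: "of_rat (c y) * y + (\<Sum>b\<in>B. of_rat (c b) * b) = 0"
        using c B yB by simp
      have "c y = 0"
      proof (rule ccontr)
        assume "c y \<noteq> 0"
        then have "y = - (\<Sum>b\<in>B. of_rat (c b) * b) / of_rat (c y)"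
          using eq by (simp add: field_simps)
        also have "\<dots> = (\<Sum>b\<in>B. of_rat (- c b / c y) * b)"
          by (simp add: sum_divide_distrib of_rat_divide of_rat_minus sum_negf)
        finally show False using False by (auto dest: spec[of _ "\<lambda>b. - c b / c y"])
      qed
      moreover from this eq have "\<forall>b\<in>B. c b = 0" by (intro ind) simp
      ultimately show ?thesis by blast
    qed
    show ?thesis
      by (intro exI[of _ "insert y B"] exI[of _ q'] conjI allI impI ballI) (use B 1 2 in blast)+
  qed
qed

lemma common_denominator:
  fixes X :: "rat set"
  assumes "finite X"
  shows "\<exists>D :: nat. D > 0 \<and> (\<forall>x\<in>X. of_nat D * x \<in> \<int>)"
  using assms
proof induction
  case empty
  show ?case by (intro exI[of _ 1]) auto
next
  case (insert x X)
  then obtain D :: nat where D: "D > 0" "\<forall>y\<in>X. of_nat D * y \<in> \<int>" by blast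
  obtain a b :: int where x: "x = of_int a / of_int b" "b > 0"
    by (metis Fract_of_int_quotient Rat_cases)
  have "of_nat (nat b * D) * x \<in> \<int>"
  proof -
    have "of_nat (nat b * D) * x = of_int (int D * a)" using x by simp
    then show ?thesis by (metis Ints_of_int)
  qed
  moreover have "of_nat (nat b * D) * y \<in> \<int>" if "y \<in> X" for y
  proof -
    have "of_nat (nat b * D) * y = of_int b * (of_nat D * y)" using x(2) of_nat_nat[of b] by (metis less_imp_le mult.assoc of_nat_mult)
    moreover have "of_int b * (of_nat D * y) \<in> \<int>" using D(2) that by (intro Ints_mult[OF Ints_of_int]) blast
    ultimately show ?thesis by metis
  qed
  ultimately show ?case using D x by (intro exI[of _ "nat b * D"]) auto
qed

section \<open>Bases of lattices of integral vectors\<close>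

lemma lookup_scaleR: "Poly_Mapping.lookup (r *\<^sub>R (w :: coord_space)) c = r * Poly_Mapping.lookup w c"
proof -
  have "finite {i. r *\<^sub>R Poly_Mapping.lookup w i \<noteq> 0}"
    by (rule finite_subset[OF _ finite_keys[of w]]) (auto simp: in_keys_iff)
  then show ?thesis by (simp add: scaleR_poly_mapping_def lookup_Abs_poly_mapping)
qed

text \<open>Induction on the coordinates. The elements whose coordinate \<open>c\<close> is zero
  form a lattice with fewer coordinates, and the values of coordinate \<open>c\<close> form a
  subgroup of the integers, generated by its least positive element. A basis of the former together
  with a preimage \<open>w0\<close> of this generator is a basis of
  \<open>\<Lambda>\<close>.\<close>

lemma lattice_basis_exists:
  fixes \<Lambda> :: "coord_space set"
  assumes "finite A" "0 \<in> \<Lambda>"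
    and diff: "\<And>v w. v \<in> \<Lambda> \<Longrightarrow> w \<in> \<Lambda> \<Longrightarrow> v - w \<in> \<Lambda>"
    and int: "\<And>w c. w \<in> \<Lambda> \<Longrightarrow> Poly_Mapping.lookup w c \<in> \<int>"
    and supp: "\<And>w c. w \<in> \<Lambda> \<Longrightarrow> c \<notin> A \<Longrightarrow> Poly_Mapping.lookup w c = 0"
  shows "\<exists>bs. lattice_basis \<Lambda> bs"
  using assms
proof (induction A arbitrary: \<Lambda> rule: finite_induct)
  case empty
  have "w = 0" if "w \<in> \<Lambda>" for w
    by (rule poly_mapping_eqI) (use empty(4)[OF that] in simp)
  then have "\<Lambda> = {0}" using empty(1) by auto
  then show ?case by (intro exI[of _ "[]"]) (simp add: lattice_basis_def independent_empty)
next
  case (insert c A)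
  let ?l = "Poly_Mapping.lookup"
  have add: "v + w \<in> \<Lambda>" if "v \<in> \<Lambda>" "w \<in> \<Lambda>" for v w
    using insert.prems(2)[OF \<open>v \<in> \<Lambda>\<close> insert.prems(2)[OF insert.prems(1) \<open>w \<in> \<Lambda>\<close>]] by simp
  have nsmul: "real k *\<^sub>R v \<in> \<Lambda>" if "v \<in> \<Lambda>" for v k
    by (induction k) (use insert.prems(1) that add in \<open>auto simp: scaleR_left_distrib\<close>)
  have smul: "real_of_int k *\<^sub>R v \<in> \<Lambda>" if "v \<in> \<Lambda>" for v k
  proof (cases "k \<ge> 0")
    case True
    then show ?thesis using nsmul[OF that, of "nat k"] by simp
  next
    case False
    then show ?thesis using insert.prems(2)[OF insert.prems(1) nsmul[OF that, of "nat (- k)"]] by simp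
  qed
  define \<Lambda>' where "\<Lambda>' = {w \<in> \<Lambda>. ?l w c = 0}"
  have "\<exists>bs. lattice_basis \<Lambda>' bs"
  proof (rule insert.IH)
    show "?l w x = 0" if "w \<in> \<Lambda>'" "x \<notin> A" for w x
      using insert.prems(4)[of w x] that by (cases "x = c") (auto simp: \<Lambda>'_def)
  qed (use insert.prems in \<open>auto simp: \<Lambda>'_def lookup_minus\<close>)
  then obtain bs where bs: "lattice_basis \<Lambda>' bs" by blast
  show ?case
  proof (cases "\<Lambda>' = \<Lambda>")
    case True
    with bs show ?thesis by auto
  next
    case False
    then obtain w1 where w1: "w1 \<in> \<Lambda>" "?l w1 c \<noteq> 0" by (auto simp: \<Lambda>'_def)
    define P where "P m \<longleftrightarrow> m > 0 \<and> (\<exists>w\<in>\<Lambda>. ?l w c = real m)" for m :: nat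
    have "\<exists>m. P m"
    proof -
      obtain k where k: "?l w1 c = of_int k" using insert.prems(3)[OF w1(1)] by (metis Ints_cases)
      have "P (nat \<bar>k\<bar>)"
        using w1 k smul[OF w1(1), of "sgn k"]
        unfolding P_def by (auto intro!: bexI[of _ "real_of_int (sgn k) *\<^sub>R w1"] simp: sgn_if)
      then show ?thesis ..
    qed
    then have "P (LEAST m. P m)" by (rule LeastI_ex)
    define m where "m = (LEAST m. P m)"
    have m: "P m" using \<open>P (LEAST m. P m)\<close> by (simp add: m_def)
    have min: "\<not> P k" if "k < m" for k using that not_less_Least by (auto simp: m_def)
    from m obtain w0 where w0: "w0 \<in> \<Lambda>" "?l w0 c = real m" "m > 0" by (auto simp: P_def)
    \<comment> \<open>Division with remainder by \<open>m\<close>: a non-zero remainder would be a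
      smaller positive value of the coordinate.\<close>
    have red: "\<exists>k. w - real_of_int k *\<^sub>R w0 \<in> \<Lambda>'" if w: "w \<in> \<Lambda>" for w
    proof -
      obtain k where k: "?l w c = of_int k" using insert.prems(3)[OF w] by (metis Ints_cases)
      define r where "r = k mod int m"
      let ?v = "w - real_of_int (k div int m) *\<^sub>R w0"
      have v: "?v \<in> \<Lambda>" by (intro insert.prems(2) w smul w0)
      have "k = (k div int m) * int m + r" by (simp add: r_def)
      then have "real_of_int k = of_int (k div int m) * of_nat m + of_int r"
        by (metis of_int_add of_int_mult of_int_of_nat_eq)
      then have l: "?l ?v c = of_int r" by (simp add: lookup_minus lookup_scaleR k w0)
      have r: "0 \<le> r" "r < int m" using w0 by (auto simp: r_def)
      have "r = 0"
      proof (rule ccontr)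
        assume "r \<noteq> 0"
        then have "P (nat r)" using v l r by (auto simp: P_def intro!: bexI[of _ ?v])
        then show False using min[of "nat r"] r w0 by auto
      qed
      then show ?thesis using v l by (auto simp: \<Lambda>'_def)
    qed
    \<comment> \<open>Real combinations of \<open>bs\<close> vanish at \<open>c\<close> as well, so
      \<open>w0\<close> is independent of them over the reals and not only over the
      integers.\<close>
    have zero: "?l w c = 0" if "w \<in> span (set bs)" for w
      using that
    proof (induction rule: span_induct_alt)
      case (step r x y)
      have "x \<in> \<Lambda>'"
      proof -
        obtain k where k: "k < length bs" "x = bs ! k" using step(1) by (auto simp: in_set_conv_nth)
        have "x = (\<Sum>i<length bs. real_of_int (if i = k then 1 else 0) *\<^sub>R bs ! i)"
          using k by (simp add: if_distrib[of "\<lambda>t. of_int t *\<^sub>R _"] cong: if_cong)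
        then show ?thesis using bs by (auto simp: lattice_basis_def)
      qed
      then show ?case using step by (simp add: \<Lambda>'_def lookup_add lookup_scaleR)
    qed simp
    have w0n: "w0 \<notin> span (set bs)" using zero w0 by fastforce
    have "lattice_basis \<Lambda> (w0 # bs)"
      unfolding lattice_basis_def
    proof (intro conjI)
      show "distinct (w0 # bs)" using bs w0n span_base by (auto simp: lattice_basis_def)
      show "independent (set (w0 # bs))"
        using bs w0n by (auto simp: lattice_basis_def independent_insert)
      have split: "(\<Sum>k<length (w0 # bs). real_of_int (z k) *\<^sub>R (w0 # bs) ! k) =
         real_of_int (z 0) *\<^sub>R w0 + (\<Sum>k<length bs. real_of_int (z (Suc k)) *\<^sub>R bs ! k)" for z
        by (simp add: sum.lessThan_Suc_shift del: sum.lessThan_Suc)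
      have sub: "(\<Sum>k<length bs. real_of_int (z k) *\<^sub>R bs ! k) \<in> \<Lambda>" for z
        using bs by (auto simp: lattice_basis_def \<Lambda>'_def)
      show "\<Lambda> = {\<Sum>k<length (w0 # bs). real_of_int (z k) *\<^sub>R (w0 # bs) ! k |z. True}"
      proof (intro equalityI subsetI)
        fix w assume "w \<in> \<Lambda>"
        then obtain k where "w - real_of_int k *\<^sub>R w0 \<in> \<Lambda>'" using red by blast
        then obtain z where z: "w - real_of_int k *\<^sub>R w0 = (\<Sum>i<length bs. real_of_int (z i) *\<^sub>R bs ! i)"
          using bs by (auto simp: lattice_basis_def)
        have "w = (\<Sum>i<length (w0 # bs). real_of_int (case i of 0 \<Rightarrow> k | Suc j \<Rightarrow> z j) *\<^sub>R (w0 # bs) ! i)"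
          unfolding split using z by (simp add: algebra_simps)
        then show "w \<in> {\<Sum>k<length (w0 # bs). real_of_int (z k) *\<^sub>R (w0 # bs) ! k |z. True}" by blast
      next
        fix w assume "w \<in> {\<Sum>k<length (w0 # bs). real_of_int (z k) *\<^sub>R (w0 # bs) ! k |z. True}"
        then show "w \<in> \<Lambda>" unfolding split by (auto intro!: add smul w0 sub)
      qed
    qed
    then show ?thesis by blast
  qed
qed

text \<open>Giving the equations as functionals, and the solution as a function extended by zero
  outside \<open>I\<close>, allows unknown functions on the vertices of a graph to be inserted
  directly.\<close>

lemma underdetermined_functionals:
  fixes \<psi> :: "'j \<Rightarrow> ('i \<Rightarrow> real) \<Rightarrow> real"
  assumes fin: "finite J" "finite I" and less: "card J < card I"
    and add: "\<And>j x y. j \<in> J \<Longrightarrow> \<psi> j (\<lambda>i. x i + y i) = \<psi> j x + \<psi> j y"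
    and scale: "\<And>j c x. j \<in> J \<Longrightarrow> \<psi> j (\<lambda>i. c * x i) = c * \<psi> j x"
  shows "\<exists>x. (\<exists>i\<in>I. x i \<noteq> 0) \<and> (\<forall>i. i \<notin> I \<longrightarrow> x i = 0) \<and> (\<forall>j\<in>J. \<psi> j x = 0)"
proof -
  define u where "u i k = (if k = i then 1 else 0 :: real)" for i k :: 'i
  obtain c where c: "\<exists>i\<in>I. c i \<noteq> 0" "\<And>j. j \<in> J \<Longrightarrow> (\<Sum>i\<in>I. \<psi> j (u i) * c i) = 0"
    using underdetermined_system[OF fin less, of "\<lambda>j i. \<psi> j (u i)"] by auto
  have lin: "\<psi> j (\<lambda>k. \<Sum>i\<in>A. c i * u i k) = (\<Sum>i\<in>A. \<psi> j (u i) * c i)" if j: "j \<in> J" and "finite A" for j A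
    using \<open>finite A\<close>
  proof induction
    case empty
    show ?case using scale[OF j, of 0 "\<lambda>_. 0"] by simp
  next
    case (insert i A)
    then show ?case
      using add[OF j, of "\<lambda>k. c i * u i k" "\<lambda>k. \<Sum>i\<in>A. c i * u i k"] scale[OF j, of "c i" "u i"]
      by (simp add: mult.commute)
  qed
  let ?x = "\<lambda>k. \<Sum>i\<in>I. c i * u i k"
  have x: "?x k = (if k \<in> I then c k else 0)" for k
  proof -
    have "?x k = (\<Sum>i\<in>I. if k = i then c i else 0)"
      by (rule sum.cong) (auto simp: u_def)
    then show ?thesis using fin by simp
  qed
  show ?thesis
    by (rule exI[of _ ?x]) (use c lin[OF _ fin(2)] in \<open>auto simp: x\<close>)
qed

section \<open>The determinant of two vectors in the plane\<close>

definition cross :: "real \<times> real \<Rightarrow> real \<times> real \<Rightarrow> real" where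
  "cross u v = fst u * snd v - snd u * fst v"

lemma cross_simps [simp]:
  "cross u (v + w) = cross u v + cross u w" "cross (v + w) u = cross v u + cross w u"
  "cross u (v - w) = cross u v - cross u w" "cross (v - w) u = cross v u - cross w u"
  "cross u (- w) = - cross u w" "cross (- w) u = - cross w u"
  "cross u (r *\<^sub>R w) = r * cross u w" "cross (r *\<^sub>R w) u = r * cross w u"
  "cross u 0 = 0" "cross 0 u = 0" "cross u u = 0"
  by (simp_all add: cross_def algebra_simps)

lemma cross_eq_0:
  assumes "cross u v = 0" "u \<noteq> 0"
  shows "\<exists>t. v = t *\<^sub>R u"
proof (cases "fst u = 0")
  case True
  then have "snd u \<noteq> 0" using assms(2) by (auto simp: prod_eq_iff)
  then have "v = (snd v / snd u) *\<^sub>R u" using assms True by (auto simp: prod_eq_iff cross_def)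
  then show ?thesis ..
next
  case False
  then have "v = (fst v / fst u) *\<^sub>R u" using assms by (auto simp: prod_eq_iff cross_def field_simps)
  then show ?thesis ..
qed

lemma real_dir_eq_0 [simp]: "real_dir T F = 0 \<longleftrightarrow> dir T F = 0"
  by (simp add: real_dir_def prod_eq_iff)

section \<open>The span of a stratum\<close>

lemma lookup_coords_Length:
  assumes "is_graph T"
  shows "Poly_Mapping.lookup (coords T l h) (Length e) = (if e \<in> bounded_edges T then l e else 0)"
proof -
  have "finite (bounded_edges T)"
    using assms by (auto simp: is_graph_def bounded_edges_def bounded_flags_def)
  then show ?thesis
    by (simp add: coords_def lookup_add lookup_single lookup_sum when_def)
qed

lemma compatible_sum:
  assumes "finite B" "\<And>b. b \<in> B \<Longrightarrow> compatible T (l b) (h b)"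
  shows "compatible T (\<lambda>e. \<Sum>b\<in>B. c b * l b e) (\<lambda>V. \<Sum>b\<in>B. c b *\<^sub>R h b V)"
  using assms unfolding compatible_def
  by (simp add: scaleR_add_right sum.distrib scaleR_sum_left)

lemma coords_sum:
  assumes "is_graph T" "finite B"
  shows "coords T (\<lambda>e. \<Sum>b\<in>B. c b * l b e) (\<lambda>V. \<Sum>b\<in>B. c b *\<^sub>R h b V)
    = (\<Sum>b\<in>B. c b *\<^sub>R coords T (l b) (h b))"
proof (rule poly_mapping_eqI)
  fix x
  show "Poly_Mapping.lookup (coords T (\<lambda>e. \<Sum>b\<in>B. c b * l b e) (\<lambda>V. \<Sum>b\<in>B. c b *\<^sub>R h b V)) x =
    Poly_Mapping.lookup (\<Sum>b\<in>B. c b *\<^sub>R coords T (l b) (h b)) x"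
    by (cases x) (auto simp: lookup_sum lookup_scaleR lookup_coords[OF assms(1)]
        lookup_coords_Length[OF assms(1)] fst_sum snd_sum)
qed

lemma compatible_lin:
  assumes "compatible T l h" "compatible T l' h'"
  shows "compatible T (\<lambda>e. a * l e + b * l' e) (\<lambda>V. a *\<^sub>R h V + b *\<^sub>R h' V)"
  using assms unfolding compatible_def
  by (simp add: scaleR_add_right scaleR_add_left add_ac)

lemma coords_lin:
  assumes "is_graph T"
  shows "coords T (\<lambda>e. a * l e + b * l' e) (\<lambda>V. a *\<^sub>R h V + b *\<^sub>R h' V)
    = a *\<^sub>R coords T l h + b *\<^sub>R coords T l' h'"
proof (rule poly_mapping_eqI)
  fix x
  show "Poly_Mapping.lookup (coords T (\<lambda>e. a * l e + b * l' e) (\<lambda>V. a *\<^sub>R h V + b *\<^sub>R h' V)) x =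
    Poly_Mapping.lookup (a *\<^sub>R coords T l h + b *\<^sub>R coords T l' h') x"
    by (cases x) (auto simp: lookup_add lookup_scaleR lookup_coords[OF assms(1)]
        lookup_coords_Length[OF assms(1)])
qed

lemma subspace_compatible_coords:
  assumes "is_graph T"
  shows "subspace {coords T l h | l h. compatible T l h}"
proof (rule subspaceI)
  have "compatible T (\<lambda>_. 0) (\<lambda>_. 0)" by (simp add: compatible_def)
  moreover have "coords T (\<lambda>_. 0) (\<lambda>_. 0) = 0" by (simp add: coords_def)
  ultimately show "0 \<in> {coords T l h | l h. compatible T l h}" by force
next
  fix x y assume "x \<in> {coords T l h | l h. compatible T l h}" "y \<in> {coords T l h | l h. compatible T l h}"
  then obtain l h l' h' where *: "x = coords T l h" "compatible T l h" "y = coords T l' h'" "compatible T l' h'"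
    by blast
  then show "x + y \<in> {coords T l h | l h. compatible T l h}"
    using coords_lin[OF assms, of 1 l 1 l' h h'] compatible_lin[OF *(2,4), of 1 1]
    unfolding mem_Collect_eq scaleR_one by metis
next
  fix a x assume "x \<in> {coords T l h | l h. compatible T l h}"
  then obtain l h where *: "x = coords T l h" "compatible T l h" by blast
  then show "a *\<^sub>R x \<in> {coords T l h | l h. compatible T l h}"
    using coords_lin[OF assms, of a l 0 l h h] compatible_lin[OF *(2,2), of a 0]
    unfolding mem_Collect_eq scaleR_zero_left add_0_right by metis
qed

text \<open>The stratum is open in the space of all compatible data, hence spans it.\<close>

lemma span_stratum:
  assumes T: "is_graph T" and C: "compatible T l0 h0" "\<And>e. e \<in> bounded_edges T \<Longrightarrow> l0 e > 0"
  shows "span (stratum T) = {coords T l h | l h. compatible T l h}" (is "_ = ?V")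
proof
  show "span (stratum T) \<subseteq> ?V"
    by (rule span_minimal[OF _ subspace_compatible_coords[OF T]]) (auto simp: stratum_def)
next
  show "?V \<subseteq> span (stratum T)"
  proof
    fix w assume "w \<in> ?V"
    then obtain l h where w: "w = coords T l h" and lh: "compatible T l h" by blast
    \<comment> \<open>\<open>M\<close> bounds all ratios of \<open>l e\<close> to
      \<open>l0 e\<close> in absolute value, so adding \<open>M + 1\<close> times the given curve
      makes every length positive.\<close>
    define M where "M = (\<Sum>e\<in>bounded_edges T. \<bar>l e\<bar> / l0 e)"
    have fin: "finite (bounded_edges T)"
      using T by (auto simp: is_graph_def bounded_edges_def bounded_flags_def)
    have pos: "1 * l e + (M + 1) * l0 e > 0" if e: "e \<in> bounded_edges T" for e
    proof -
      have "\<bar>l e\<bar> / l0 e \<le> M"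
        unfolding M_def by (rule member_le_sum[OF e]) (use C fin in \<open>auto simp: less_imp_le\<close>)
      then have "\<bar>l e\<bar> \<le> M * l0 e" using C(2)[OF e] by (simp add: field_simps)
      then show ?thesis using C(2)[OF e] by (simp add: algebra_simps)
    qed
    have "coords T (\<lambda>e. 1 * l e + (M + 1) * l0 e) (\<lambda>V. 1 *\<^sub>R h V + (M + 1) *\<^sub>R h0 V) \<in> stratum T"
      unfolding stratum_def using pos compatible_lin[OF lh C(1)] by blast
    moreover have "coords T l0 h0 \<in> stratum T" unfolding stratum_def using C by blast
    ultimately have "(w + (M + 1) *\<^sub>R coords T l0 h0) - (M + 1) *\<^sub>R coords T l0 h0 \<in> span (stratum T)"
      unfolding coords_lin[OF T] w by (intro span_diff span_scale) (auto intro: span_base)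
    then show "w \<in> span (stratum T)" by simp
  qed
qed

lemma coords_eq_imp:
  assumes T: "is_graph T" "connected_graph T" and "compatible T l h" "compatible T l' h'"
    and eq: "coords T l h = coords T l' h'"
  shows "e \<in> bounded_edges T \<Longrightarrow> l e = l' e" and "V \<in> verts T \<Longrightarrow> h V = h' V"
proof -
  show l: "l e = l' e" if "e \<in> bounded_edges T" for e
    using eq lookup_coords(3)[OF T(1) that] by metis
  assume V: "V \<in> verts T"
  have "compatible T l h'" using assms(4) compatible_cong[of T l l' h'] l by blast
  moreover have "h (root_vertex T) = h' (root_vertex T)"
    by (rule prod_eqI) (use eq lookup_coords(1,2)[OF T(1)] in metis)+
  ultimately show "h V = h' V" using compatible_unique T assms(3) V by blast
qed

section \<open>The lattice of integer points of a stratum\<close>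

lemma rational_compatible_coords_in_lattice_span:
  fixes l :: "nat set \<Rightarrow> rat" and h1 h2 :: "nat \<Rightarrow> rat"
  assumes T: "is_graph T"
    and V: "span (stratum T) = {coords T l h | l h. compatible T l h}"
    and comp: "compatible T (\<lambda>e. of_rat (l e)) (\<lambda>V. (of_rat (h1 V), of_rat (h2 V)))"
  shows "coords T (\<lambda>e. of_rat (l e)) (\<lambda>V. (of_rat (h1 V), of_rat (h2 V))) \<in> span (stratum_lattice T)"
    (is "?w \<in> _")
proof -
  let ?X = "insert (h1 (root_vertex T)) (insert (h2 (root_vertex T)) (l ` bounded_edges T))"
  have "finite (bounded_edges T)"
    using T by (auto simp: is_graph_def bounded_edges_def bounded_flags_def)
  then obtain D :: nat where D: "D > 0" "\<And>x. x \<in> ?X \<Longrightarrow> of_nat D * x \<in> \<int>"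
    using common_denominator[of ?X] by blast
  have int: "real D * of_rat x \<in> \<int>" if x: "x \<in> ?X" for x
  proof -
    obtain k where "of_nat D * x = of_int k" using D(2)[OF x] by (rule Ints_cases)
    then have "real_of_rat (of_nat D * x) = of_int k" by simp
    then show ?thesis by (simp add: of_rat_mult)
  qed
  have "real D *\<^sub>R ?w \<in> stratum_lattice T"
    unfolding stratum_lattice_def
  proof (intro CollectI conjI allI)
    have "?w \<in> span (stratum T)" unfolding V using comp by blast
    then show "real D *\<^sub>R ?w \<in> span (stratum T)" by (rule span_scale)
    fix c show "Poly_Mapping.lookup (real D *\<^sub>R ?w) c \<in> \<int>"
      by (cases c) (auto simp: lookup_scaleR lookup_coords[OF T] lookup_coords_Length[OF T] intro!: int)
  qed
  then have "(1 / real D) *\<^sub>R (real D *\<^sub>R ?w) \<in> span (stratum_lattice T)"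
    by (intro span_scale span_base)
  then show ?thesis using D(1) by simp
qed

text \<open>
  Expanding the coordinates of a real solution in a \<open>\<rat>\<close>-basis of their \<open>\<rat>\<close>-span writes it as a
  real combination of rational solutions, as the compatibility conditions have rational
  coefficients.
\<close>

lemma span_stratum_lattice:
  assumes T: "is_graph T"
    and V: "span (stratum T) = {coords T l h | l h. compatible T l h}"
  shows "span (stratum_lattice T) = span (stratum T)"
proof
  show "span (stratum_lattice T) \<subseteq> span (stratum T)"
    by (rule span_minimal) (auto simp: stratum_lattice_def)
next
  show "span (stratum T) \<subseteq> span (stratum_lattice T)"
  proof
    fix w assume "w \<in> span (stratum T)"
    then obtain l h where w: "w = coords T l h" and lh: "compatible T l h" using V by blast
    \<comment> \<open>\<open>X\<close> contains the images of all vertices, not only of the root, so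
      that the equation of every edge is a relation between elements of \<open>X\<close>.\<close>
    define X where "X = l ` bounded_edges T \<union> (fst \<circ> h) ` verts T \<union> (snd \<circ> h) ` verts T"
    have "finite X"
      using T by (auto simp: X_def is_graph_def bounded_edges_def bounded_flags_def)
    then obtain B :: "real set" and q :: "real \<Rightarrow> real \<Rightarrow> rat" where B: "finite B"
      and q: "\<And>x. x \<in> X \<Longrightarrow> x = (\<Sum>b\<in>B. of_rat (q x b) * b)"
      and ind: "\<And>c :: real \<Rightarrow> rat. (\<Sum>b\<in>B. of_rat (c b) * b) = 0 \<Longrightarrow> \<forall>b\<in>B. c b = 0"
      using rational_basis_of_reals[of X] by metis
    define lb where "lb b e = real_of_rat (q (l e) b)" for b e
    define hb where "hb b V = (real_of_rat (q (fst (h V)) b), real_of_rat (q (snd (h V)) b))" for b V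
    have comp: "compatible T (lb b) (hb b)" if b: "b \<in> B" for b
      unfolding compatible_def
    proof
      fix F assume F: "F \<in> bounded_flags T"
      let ?V = "vert T F" and ?W = "vert T (opp T F)" and ?e = "edge T F"
      have VW: "?V \<in> verts T" "?W \<in> verts T"
        using F T by (auto simp: bounded_flags_def is_graph_def)
      have e: "?e \<in> bounded_edges T" using F by (auto simp: bounded_edges_def)
      have mem: "fst (h ?V) \<in> X" "fst (h ?W) \<in> X" "snd (h ?V) \<in> X" "snd (h ?W) \<in> X" "l ?e \<in> X"
        using VW e by (auto simp: X_def)
      have eq: "h ?W = h ?V + l ?e *\<^sub>R real_dir T F" using lh F by (auto simp: compatible_def)
      then have eq1: "fst (h ?W) = fst (h ?V) + l ?e * of_int (fst (dir T F))"
        and eq2: "snd (h ?W) = snd (h ?V) + l ?e * of_int (snd (dir T F))"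
        by (simp_all add: real_dir_def)
      \<comment> \<open>As \<open>B\<close> is independent over the rationals, comparing
        coefficients turns one real equation into a rational equation for each
        \<open>b\<close>.\<close>
      have gen: "\<forall>b\<in>B. q y b - q x b - q (l ?e) b * of_int k = 0"
        if "y = x + l ?e * of_int k" "x \<in> X" "y \<in> X" for x y k
      proof (rule ind)
        have "(\<Sum>b\<in>B. of_rat (q y b - q x b - q (l ?e) b * of_int k) * b) =
          (\<Sum>b\<in>B. of_rat (q y b) * b) - (\<Sum>b\<in>B. of_rat (q x b) * b) - (\<Sum>b\<in>B. of_rat (q (l ?e) b) * b) * of_int k"
          by (simp add: of_rat_diff of_rat_mult left_diff_distrib right_diff_distrib sum_subtractf sum_distrib_left sum_distrib_right mult_ac)
        also have "\<dots> = y - x - l ?e * of_int k"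
          using q[OF that(2)] q[OF that(3)] q[OF mem(5)] by simp
        finally show "(\<Sum>b\<in>B. of_rat (q y b - q x b - q (l ?e) b * of_int k) * b) = 0"
          using that(1) by simp
      qed
      have "q (fst (h ?W)) b = q (fst (h ?V)) b + q (l ?e) b * of_int (fst (dir T F))"
        using gen[OF eq1] mem b by (simp add: algebra_simps)
      moreover have "q (snd (h ?W)) b = q (snd (h ?V)) b + q (l ?e) b * of_int (snd (dir T F))"
        using gen[OF eq2] mem b by (simp add: algebra_simps)
      ultimately show "hb b ?W = hb b ?V + lb b ?e *\<^sub>R real_dir T F"
        by (simp add: hb_def lb_def real_dir_def of_rat_add of_rat_mult)
    qed
    have root: "root_vertex T \<in> verts T"
      using T unfolding root_vertex_def is_graph_def by (metis ex_in_conv someI)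
    have "w = (\<Sum>b\<in>B. b *\<^sub>R coords T (lb b) (hb b))"
    proof (rule poly_mapping_eqI)
      fix c
      have "Poly_Mapping.lookup (\<Sum>b\<in>B. b *\<^sub>R coords T (lb b) (hb b)) c
         = (\<Sum>b\<in>B. b * Poly_Mapping.lookup (coords T (lb b) (hb b)) c)"
        by (simp add: lookup_sum lookup_scaleR)
      also have "\<dots> = Poly_Mapping.lookup w c"
      proof (cases c)
        case Root_x
        with root show ?thesis using q[of "fst (h (root_vertex T))"]
          by (simp add: w lookup_coords[OF T] hb_def X_def mult.commute)
      next
        case Root_y
        with root show ?thesis using q[of "snd (h (root_vertex T))"]
          by (simp add: w lookup_coords[OF T] hb_def X_def mult.commute)
      next
        case (Length e)
        then show ?thesis using q[of "l e"]
          by (simp add: w lookup_coords_Length[OF T] lb_def X_def mult.commute)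
      qed
      finally show "Poly_Mapping.lookup w c = Poly_Mapping.lookup (\<Sum>b\<in>B. b *\<^sub>R coords T (lb b) (hb b)) c" ..
    qed
    also have "\<dots> \<in> span (stratum_lattice T)"
    proof (intro span_sum span_scale)
      fix b assume "b \<in> B"
      show "coords T (lb b) (hb b) \<in> span (stratum_lattice T)"
        using rational_compatible_coords_in_lattice_span[OF T V, of "\<lambda>e. q (l e) b"
            "\<lambda>V. q (fst (h V)) b" "\<lambda>V. q (snd (h V)) b"] comp[OF \<open>b \<in> B\<close>]
        by (simp add: lb_def[abs_def] hb_def[abs_def])
    qed
    finally show "w \<in> span (stratum_lattice T)" .
  qed
qed

lemma stratum_lattice_basis:
  assumes T: "is_graph T"
    and V: "span (stratum T) = {coords T l h | l h. compatible T l h}"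
  defines "bs \<equiv> SOME bs. lattice_basis (stratum_lattice T) bs"
  shows "distinct bs" "independent (set bs)" "span (set bs) = span (stratum T)"
proof -
  let ?A = "{Root_x, Root_y} \<union> Length ` bounded_edges T"
  have "\<exists>bs. lattice_basis (stratum_lattice T) bs"
  proof (rule lattice_basis_exists)
    show "finite ?A"
      using T by (auto simp: is_graph_def bounded_edges_def bounded_flags_def)
    show "0 \<in> stratum_lattice T" by (simp add: stratum_lattice_def span_zero)
    show "v - w \<in> stratum_lattice T" if "v \<in> stratum_lattice T" "w \<in> stratum_lattice T" for v w
      using that by (auto simp: stratum_lattice_def lookup_minus intro: span_diff)
    show "Poly_Mapping.lookup w c \<in> \<int>" if "w \<in> stratum_lattice T" for w c
      using that by (auto simp: stratum_lattice_def)
    show "Poly_Mapping.lookup w c = 0" if w: "w \<in> stratum_lattice T" and c: "c \<notin> ?A" for w c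
    proof -
      from c obtain e where "c = Length e" "e \<notin> bounded_edges T" by (cases c) auto
      moreover obtain l h where "w = coords T l h" using w V by (auto simp: stratum_lattice_def)
      ultimately show ?thesis by (simp add: lookup_coords_Length[OF T])
    qed
  qed
  then have bs: "lattice_basis (stratum_lattice T) bs" unfolding bs_def by (rule someI_ex)
  then show "distinct bs" "independent (set bs)" by (auto simp: lattice_basis_def)
  show "span (set bs) = span (stratum T)"
  proof
    have "b \<in> stratum_lattice T" if b: "b \<in> set bs" for b
    proof -
      obtain k where k: "k < length bs" "b = bs ! k" using b by (auto simp: in_set_conv_nth)
      have "b = (\<Sum>i<length bs. real_of_int (if i = k then 1 else 0) *\<^sub>R bs ! i)"
        using k by (simp add: if_distrib[of "\<lambda>t. of_int t *\<^sub>R _"] cong: if_cong)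
      then show ?thesis using bs by (auto simp: lattice_basis_def)
    qed
    then show "span (set bs) \<subseteq> span (stratum T)"
      by (intro span_minimal) (auto simp: stratum_lattice_def)
  next
    have "stratum_lattice T \<subseteq> span (set bs)"
      using bs by (auto simp: lattice_basis_def intro!: span_sum span_scale intro: span_base)
    then have "span (stratum_lattice T) \<subseteq> span (set bs)" by (intro span_minimal) auto
    then show "span (stratum T) \<subseteq> span (set bs)" by (simp add: span_stratum_lattice[OF T V])
  qed
qed

section \<open>The matrix of ev x j and its kernel\<close>

lemma cycle_edges_bounded: "cycle_edges T \<subseteq> bounded_edges T"
  by (auto simp: cycle_edges_def simple_cycle_def bounded_edges_def)

lemma evj_component_coords:
  assumes T: "is_graph T" "connected_graph T" "compatible T l h"
    and marks: "\<And>i. i < n \<Longrightarrow> vert T (mark T i) \<in> verts T"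
  shows "evj_component n T (coords T l h) k =
    (if k < 2 * n then (if even k then fst else snd) (h (vert T (mark T (k div 2)))) else j_map T l)"
proof -
  have "j_map T (lengths_of (coords T l h)) = j_map T l"
    using cycle_edges_bounded[of T]
    by (auto simp: j_map_def lengths_of_def lookup_coords_Length[OF T(1)] intro!: sum.cong)
  moreover have "k < 2 * n \<Longrightarrow> vert T (mark T (k div 2)) \<in> verts T" by (rule marks) simp
  ultimately show ?thesis
    by (simp add: evj_component_def ev_map_def positions_of_coords[OF T])
qed

lemma j_map_sum:
  "j_map T (\<lambda>e. \<Sum>b\<in>B. c b * l b e) = (\<Sum>b\<in>B. c b * j_map T (l b))"
  unfolding j_map_def by (simp add: sum_distrib_left sum.swap[of _ _ B])

text \<open>The matrix maps the coordinates of a datum in the lattice basis to its values under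
  \<open>ev\<close> and \<open>j\<close>, so an invertible matrix leaves only the zero datum in the
  kernel. By the dimension hypothesis the basis has exactly as many elements as the matrix has
  columns.\<close>

lemma ev_j_injective:
  assumes T: "is_graph T" "connected_graph T"
    and V: "span (stratum T) = {coords T l h | l h. compatible T l h}"
    and marks: "\<And>i. i < n \<Longrightarrow> vert T (mark T i) \<in> verts T"
    and dim: "stratum_dim T = 2 * n + 1"
    and det: "Determinant.det (evj_matrix n T (SOME bs. lattice_basis (stratum_lattice T) bs)) \<noteq> 0"
    and lh: "compatible T l h" "\<And>i. i < n \<Longrightarrow> h (vert T (mark T i)) = 0" "j_map T l = 0"
  shows "V \<in> verts T \<Longrightarrow> h V = 0" and "e \<in> bounded_edges T \<Longrightarrow> l e = 0"
proof -
  define bs where "bs = (SOME bs. lattice_basis (stratum_lattice T) bs)"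
  note bs = stratum_lattice_basis[OF T(1) V, folded bs_def]
  let ?N = "2 * n + 1"
  have len: "length bs = ?N"
  proof -
    have "dim (span (stratum T)) = card (set bs)"
      using bs(2) bs(3)[symmetric] by (simp add: dim_span dim_eq_card_independent)
    then show ?thesis using dim distinct_card[OF bs(1)] by (simp add: stratum_dim_def)
  qed
  have "\<exists>L H. \<forall>k<?N. bs ! k = coords T (L k) (H k) \<and> compatible T (L k) (H k)"
  proof -
    have "\<exists>l h. bs ! k = coords T l h \<and> compatible T l h" if "k < ?N" for k
    proof -
      have "bs ! k \<in> span (set bs)" using that len by (intro span_base nth_mem) simp
      then show ?thesis using bs(3) V by auto
    qed
    then show ?thesis by metis
  qed
  then obtain L H where LH: "\<And>k. k < ?N \<Longrightarrow> bs ! k = coords T (L k) (H k)"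
    "\<And>k. k < ?N \<Longrightarrow> compatible T (L k) (H k)" by blast
  have "coords T l h \<in> span (set bs)" using bs(3) V lh(1) by auto
  then obtain u where u: "coords T l h = (\<Sum>v\<in>set bs. u v *\<^sub>R v)"
    using span_finite[of "set bs"] by auto
  define c where "c k = u (bs ! k)" for k
  have "coords T l h = (\<Sum>k<?N. c k *\<^sub>R bs ! k)"
  proof -
    have "bij_betw ((!) bs) {..<?N} (set bs)" by (rule bij_betw_nth[OF bs(1)]) (simp_all add: len)
    from sum.reindex_bij_betw[OF this, of "\<lambda>v. u v *\<^sub>R v"] show ?thesis unfolding u c_def by (rule sym)
  qed
  also have "\<dots> = (\<Sum>k<?N. c k *\<^sub>R coords T (L k) (H k))"
    by (rule sum.cong) (auto simp: LH(1))
  also have "\<dots> = coords T (\<lambda>e. \<Sum>k<?N. c k * L k e) (\<lambda>V. \<Sum>k<?N. c k *\<^sub>R H k V)"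
    by (rule coords_sum[OF T(1), symmetric]) simp
  finally have co: "coords T l h = coords T (\<lambda>e. \<Sum>k<?N. c k * L k e) (\<lambda>V. \<Sum>k<?N. c k *\<^sub>R H k V)" .
  have comp: "compatible T (\<lambda>e. \<Sum>k<?N. c k * L k e) (\<lambda>V. \<Sum>k<?N. c k *\<^sub>R H k V)"
    by (rule compatible_sum) (auto simp: LH)
  note eq = coords_eq_imp[OF T lh(1) comp co]
  have j: "(\<Sum>k<?N. c k * j_map T (L k)) = 0"
  proof -
    have "j_map T l = j_map T (\<lambda>e. \<Sum>k<?N. c k * L k e)"
      using eq(1) cycle_edges_bounded[of T] unfolding j_map_def by (auto intro!: sum.cong)
    then show ?thesis using lh(3) by (simp only: j_map_sum)
  qed
  define A where "A = evj_matrix n T bs"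
  have A: "A \<in> carrier_mat ?N ?N" by (simp add: A_def evj_matrix_def)
  have "A *\<^sub>v vec ?N c = 0\<^sub>v ?N"
  proof (rule eq_vecI)
    fix i assume "i < dim_vec (0\<^sub>v ?N :: real Matrix.vec)"
    then have i: "i < ?N" by simp
    have "(A *\<^sub>v vec ?N c) $ i = (\<Sum>k<?N. evj_component n T (bs ! k) i * c k)"
      using i by (simp add: A_def evj_matrix_def scalar_prod_def atLeast0LessThan)
    also have "\<dots> = (\<Sum>k<?N. c k * (if i < 2 * n then (if even i then fst else snd) (H k (vert T (mark T (i div 2)))) else j_map T (L k)))"
      by (rule sum.cong) (auto simp: LH evj_component_coords[OF T _ marks])
    also have "\<dots> = 0"
    proof (cases "i < 2 * n")
      case True
      then have "i div 2 < n" by simp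
      then have z: "(\<Sum>k<?N. c k *\<^sub>R H k (vert T (mark T (i div 2)))) = 0"
        using eq(2)[of "vert T (mark T (i div 2))"] lh(2) marks by simp
      then have "fst (\<Sum>k<?N. c k *\<^sub>R H k (vert T (mark T (i div 2)))) = 0"
        "snd (\<Sum>k<?N. c k *\<^sub>R H k (vert T (mark T (i div 2)))) = 0" by simp_all
      then show ?thesis using True by (simp add: fst_sum snd_sum del: sum.lessThan_Suc)
    next
      case False
      with j show ?thesis by simp
    qed
    finally show "(A *\<^sub>v vec ?N c) $ i = (0\<^sub>v ?N) $ i" using i by simp
  qed (simp add: A_def evj_matrix_def)
  then have "vec ?N c = 0\<^sub>v ?N"
    using det det_0_iff_vec_prod_zero[OF A] vec_carrier[of ?N c] unfolding A_def bs_def[symmetric] by blast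
  then have vec0: "vec ?N c = 0\<^sub>v ?N" .
  have c: "c k = 0" if "k < ?N" for k
    using index_vec[OF that, of c] index_zero_vec(1)[OF that, where 'a = real] unfolding vec0 by simp
  show "h V = 0" if "V \<in> verts T" using eq(2)[OF that] c by simp
  show "l e = 0" if "e \<in> bounded_edges T" using eq(1)[OF that] c by simp
qed

section \<open>Graphs and their cycles\<close>

locale graph_type =
  fixes T :: "'a ctype_scheme"
  assumes graph: "is_graph T"
begin

lemma finite_verts: "finite (verts T)" and finite_flags: "finite (flags T)"
  using graph by (auto simp: is_graph_def)

lemma bounded_subset: "bounded_flags T \<subseteq> flags T"
  by (auto simp: bounded_flags_def)

lemma finite_bounded_flags: "finite (bounded_flags T)"
  using finite_flags bounded_subset finite_subset by blast

lemma finite_bounded_edges: "finite (bounded_edges T)"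
  using finite_bounded_flags by (simp add: bounded_edges_def)

lemma vert_in: "F \<in> flags T \<Longrightarrow> vert T F \<in> verts T"
  using graph by (auto simp: is_graph_def)

lemma opp_in: "F \<in> flags T \<Longrightarrow> opp T F \<in> flags T"
  using graph by (auto simp: is_graph_def)

lemma opp_opp: "F \<in> flags T \<Longrightarrow> opp T (opp T F) = F"
  using graph by (auto simp: is_graph_def)

lemma bounded_opp: "F \<in> bounded_flags T \<Longrightarrow> opp T F \<in> bounded_flags T"
  using opp_in opp_opp by (fastforce simp: bounded_flags_def)

lemma bounded_vert_in:
  "F \<in> bounded_flags T \<Longrightarrow> vert T F \<in> verts T"
  "F \<in> bounded_flags T \<Longrightarrow> vert T (opp T F) \<in> verts T"
  using vert_in bounded_opp bounded_subset by blast+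

lemma bounded_opp_opp: "F \<in> bounded_flags T \<Longrightarrow> opp T (opp T F) = F"
  using opp_opp bounded_subset by blast

lemma edge_opp: "F \<in> bounded_flags T \<Longrightarrow> edge T (opp T F) = edge T F"
  using bounded_opp_opp by (auto simp: edge_def)

lemma edge_in: "F \<in> bounded_flags T \<Longrightarrow> edge T F \<in> bounded_edges T"
  by (simp add: bounded_edges_def)

lemma edge_eq_iff: "F \<in> bounded_flags T \<Longrightarrow> edge T G = edge T F \<longleftrightarrow> G = F \<or> G = opp T F"
  using bounded_opp_opp[of F] by (auto simp: edge_def doubleton_eq_iff)

lemma card_opp_closed:
  assumes "X \<subseteq> bounded_flags T" "\<And>F. F \<in> X \<Longrightarrow> opp T F \<in> X"
  shows "card X = 2 * card (edge T ` X)"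
proof -
  have fin: "finite X" using assms finite_bounded_flags finite_subset by blast
  have "card X = (\<Sum>e\<in>edge T ` X. card {F \<in> X. edge T F = e})"
    using sum.image_gen[OF fin, of "\<lambda>_. 1 :: nat" "edge T"] by simp
  also have "\<dots> = (\<Sum>e\<in>edge T ` X. 2)"
  proof (rule sum.cong)
    fix e assume "e \<in> edge T ` X"
    then obtain F where F: "F \<in> X" "e = edge T F" by auto
    then have "{G \<in> X. edge T G = e} = {F, opp T F}"
      using assms edge_eq_iff[of F] by auto
    moreover have "opp T F \<noteq> F" using F assms(1) by (auto simp: bounded_flags_def)
    ultimately show "card {G \<in> X. edge T G = e} = 2" by simp
  qed simp
  finally show ?thesis by simp
qed

lemma card_bounded_flags: "card (bounded_flags T) = 2 * card (bounded_edges T)"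
  unfolding bounded_edges_def by (rule card_opp_closed) (auto simp: bounded_opp)

lemma sum_valence:
  assumes "S \<subseteq> verts T"
  shows "(\<Sum>V\<in>S. valence T V) = card {F \<in> flags T. vert T F \<in> S}"
proof -
  have "finite S" using assms finite_verts finite_subset by blast
  then have "card (\<Union>V\<in>S. flags_at T V) = (\<Sum>V\<in>S. card (flags_at T V))"
    using finite_flags by (intro card_UN_disjoint) (auto simp: flags_at_def)
  moreover have "(\<Union>V\<in>S. flags_at T V) = {F \<in> flags T. vert T F \<in> S}" by (auto simp: flags_at_def)
  ultimately show ?thesis by (simp add: valence_def)
qed

lemma flags_split: "flags T = bounded_flags T \<union> end_flags T" "bounded_flags T \<inter> end_flags T = {}"
  by (auto simp: bounded_flags_def end_flags_def)

section \<open>Functions on vertices: cycles and connectedness by linear algebra\<close>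

lemma cycle_telescope:
  fixes f :: "nat \<Rightarrow> 'b::ab_group_add"
  assumes Fs: "simple_cycle T Fs"
  shows "(\<Sum>F\<in>set Fs. f (vert T (opp T F)) - f (vert T F)) = 0"
proof -
  obtain m where m: "length Fs = Suc m" using Fs by (cases Fs) (auto simp: simple_cycle_def)
  have dist: "distinct Fs" using Fs by (auto simp: simple_cycle_def distinct_map)
  have bij: "bij_betw ((!) Fs) {..<length Fs} (set Fs)" by (rule bij_betw_nth[OF dist]) auto
  define g where "g i = f (vert T (Fs ! i))" for i
  have "(\<Sum>F\<in>set Fs. f (vert T (opp T F))) = (\<Sum>i<length Fs. f (vert T (opp T (Fs ! i))))"
    by (rule sum.reindex_bij_betw[OF bij, symmetric])
  also have "\<dots> = (\<Sum>i<Suc m. g (Suc i mod Suc m))"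
    using Fs m by (intro sum.cong) (auto simp: simple_cycle_def g_def)
  also have "\<dots> = (\<Sum>i<m. g (Suc i)) + g 0" by simp
  also have "\<dots> = (\<Sum>i<Suc m. g i)" by (subst sum.lessThan_Suc_shift) (simp add: add.commute)
  also have "\<dots> = (\<Sum>F\<in>set Fs. f (vert T F))"
    using sum.reindex_bij_betw[OF bij, of "\<lambda>F. f (vert T F)"] m by (simp add: g_def)
  finally show ?thesis by (simp add: sum_subtractf)
qed

text \<open>The differences around a cycle sum to zero, so the condition at one edge follows from
  the conditions at the others. This is how a cycle makes an edge redundant in the counts
  below.\<close>

lemma cycle_last_edge:
  fixes f :: "nat \<Rightarrow> 'b::ab_group_add"
  assumes Fs: "simple_cycle T Fs" and F: "F \<in> set Fs"
    and eq: "\<And>G. G \<in> set Fs \<Longrightarrow> G \<noteq> F \<Longrightarrow> f (vert T (opp T G)) = f (vert T G)"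
  shows "f (vert T (opp T F)) = f (vert T F)"
proof -
  have "(\<Sum>G\<in>set Fs. f (vert T (opp T G)) - f (vert T G)) = f (vert T (opp T F)) - f (vert T F)"
    using F eq by (subst sum.remove[of _ F]) auto
  then show ?thesis using cycle_telescope[OF Fs, of f] by simp
qed

lemma cycle_bounded: "simple_cycle T Fs \<Longrightarrow> F \<in> set Fs \<Longrightarrow> F \<in> bounded_flags T"
  by (auto simp: simple_cycle_def)

lemma cycle_edge_inj: "simple_cycle T Fs \<Longrightarrow> inj_on (edge T) (set Fs)"
  by (auto simp: simple_cycle_def distinct_map)

text \<open>Linear algebra in place of spanning trees: with too few conditions, a non-zero function
  on \<open>S\<close> would satisfy all of them. Connectedness is encoded in \<open>rigid\<close>,
  so an edge made redundant by a cycle can simply be left out of \<open>E\<close>.\<close>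

lemma potential_bound:
  assumes S: "finite S" "r \<in> S" and E: "E \<subseteq> bounded_edges T"
    and rigid: "\<And>f :: nat \<Rightarrow> real. f r = 0 \<Longrightarrow> (\<And>V. V \<notin> S \<Longrightarrow> f V = 0) \<Longrightarrow>
      (\<And>F. F \<in> bounded_flags T \<Longrightarrow> edge T F \<in> E \<Longrightarrow> f (vert T (opp T F)) = f (vert T F)) \<Longrightarrow>
      (\<And>V. V \<in> S \<Longrightarrow> f V = 0)"
  shows "card S \<le> 1 + card E"
proof (rule ccontr)
  assume less: "\<not> card S \<le> 1 + card E"
  have finE: "finite E" using E finite_bounded_edges finite_subset by blast
  define \<phi> where "\<phi> e = (SOME F. F \<in> bounded_flags T \<and> edge T F = e)" for e
  have \<phi>: "\<phi> e \<in> bounded_flags T \<and> edge T (\<phi> e) = e" if "e \<in> bounded_edges T" for e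
    unfolding \<phi>_def by (rule someI_ex) (use that in \<open>auto simp: bounded_edges_def\<close>)
  \<comment> \<open>The index \<open>None\<close> stands for the condition at the root, and
    \<open>Some e\<close> for the condition at the edge \<open>e\<close>.\<close>
  define \<psi> where "\<psi> j f = (case j of None \<Rightarrow> f r | Some e \<Rightarrow> f (vert T (opp T (\<phi> e))) - f (vert T (\<phi> e)))"
    for j and f :: "nat \<Rightarrow> real"
  have "card (insert None (Some ` E)) = Suc (card E)"
    using finE by (subst card_insert_disjoint) (auto simp: card_image)
  then have "\<exists>f. (\<exists>i\<in>S. f i \<noteq> 0) \<and> (\<forall>i. i \<notin> S \<longrightarrow> f i = 0) \<and> (\<forall>j\<in>insert None (Some ` E). \<psi> j f = 0)"
    using S less finE
    by (intro underdetermined_functionals) (auto simp: \<psi>_def algebra_simps split: option.splits)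
  then obtain f where f: "\<exists>i\<in>S. f i \<noteq> 0" "\<forall>i. i \<notin> S \<longrightarrow> f i = 0" "\<psi> None f = 0" "\<forall>e\<in>E. \<psi> (Some e) f = 0"
    by blast
  have "f V = 0" if "V \<in> S" for V
  proof (rule rigid)
    fix F assume F: "F \<in> bounded_flags T" "edge T F \<in> E"
    then have e: "\<phi> (edge T F) \<in> bounded_flags T \<and> edge T (\<phi> (edge T F)) = edge T F" using E by (intro \<phi>) auto
    then have "\<phi> (edge T F) = F \<or> \<phi> (edge T F) = opp T F" using edge_eq_iff[OF F(1)] by auto
    then show "f (vert T (opp T F)) = f (vert T F)"
      using f(4) F bounded_opp_opp[OF F(1)] by (auto simp: \<psi>_def)
  qed (use f that in \<open>auto simp: \<psi>_def\<close>)
  with f(1) show False by blast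
qed

end

locale connected_type = graph_type +
  assumes conn: "connected_graph T"
begin

lemma connected_closed:
  assumes V: "V \<in> verts T" "V \<in> A"
    and closed: "\<And>F. F \<in> bounded_flags T \<Longrightarrow> vert T F \<in> A \<Longrightarrow> vert T (opp T F) \<in> A"
  shows "W \<in> verts T \<Longrightarrow> W \<in> A"
proof -
  assume "W \<in> verts T"
  then have "(V, W) \<in> {(vert T F, vert T (opp T F)) | F. F \<in> bounded_flags T}\<^sup>*"
    using conn V by (auto simp: connected_graph_def)
  then show "W \<in> A" by induction (use V closed in auto)
qed

lemma connected_constant:
  assumes "V \<in> verts T" "W \<in> verts T"
    and "\<And>F. F \<in> bounded_flags T \<Longrightarrow> f (vert T (opp T F)) = f (vert T F)"
  shows "f W = f V"
  using connected_closed[of V "{W. f W = f V}" W] assms by auto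

text \<open>If \<open>e\<close> lay on the first cycle only, then \<open>e\<close> and an edge of
  the second cycle could both be dropped while potentials remain rigid.
  \<open>potential_bound\<close> would then make the number of vertices smaller than the number of
  edges.\<close>

lemma cycle_unique_subset:
  assumes g: "card (bounded_edges T) \<le> card (verts T)"
    and Fs: "simple_cycle T Fs" and Gs: "simple_cycle T Gs"
  shows "edge T ` set Fs \<subseteq> edge T ` set Gs"
proof
  fix e assume "e \<in> edge T ` set Fs"
  then obtain F where F: "F \<in> set Fs" "e = edge T F" by auto
  show "e \<in> edge T ` set Gs"
  proof (rule ccontr)
    assume e: "e \<notin> edge T ` set Gs"
    obtain G where G: "G \<in> set Gs" using Gs by (cases Gs) (auto simp: simple_cycle_def)
    let ?E = "bounded_edges T - {e, edge T G}"
    obtain r where r: "r \<in> verts T" using graph by (auto simp: is_graph_def)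
    have "card (verts T) \<le> 1 + card ?E"
    proof (rule potential_bound[OF finite_verts r])
      fix f :: "nat \<Rightarrow> real" and V
      assume fr: "f r = 0" and V: "V \<in> verts T"
        and f: "\<And>F. F \<in> bounded_flags T \<Longrightarrow> edge T F \<in> ?E \<Longrightarrow> f (vert T (opp T F)) = f (vert T F)"
      \<comment> \<open>The order matters: the second cycle avoids \<open>e\<close> and is closed up
        first, whereas the first cycle may contain the edge of \<open>G\<close>.\<close>
      have fG: "f (vert T (opp T G)) = f (vert T G)"
      proof (rule cycle_last_edge[OF Gs G])
        fix H assume H: "H \<in> set Gs" "H \<noteq> G"
        then have "edge T H \<noteq> edge T G" using cycle_edge_inj[OF Gs] G by (auto dest: inj_onD)
        then show "f (vert T (opp T H)) = f (vert T H)"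
          using H e cycle_bounded[OF Gs] edge_in by (intro f) auto
      qed
      have f': "f (vert T (opp T H)) = f (vert T H)" if H: "H \<in> bounded_flags T" "edge T H \<noteq> e" for H
      proof (cases "edge T H = edge T G")
        case True
        then have "H = G \<or> H = opp T G" using edge_eq_iff cycle_bounded[OF Gs G] by blast
        then show ?thesis using fG bounded_opp_opp[OF cycle_bounded[OF Gs G]] by auto
      next
        case False
        then show ?thesis using H edge_in by (intro f) auto
      qed
      have fF: "f (vert T (opp T F)) = f (vert T F)"
      proof (rule cycle_last_edge[OF Fs F(1)])
        fix H assume H: "H \<in> set Fs" "H \<noteq> F"
        then have "edge T H \<noteq> e" using cycle_edge_inj[OF Fs] F by (auto dest: inj_onD)
        then show "f (vert T (opp T H)) = f (vert T H)" using H cycle_bounded[OF Fs] by (intro f') auto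
      qed
      have "f V = f r"
      proof (rule connected_constant[OF r V])
        fix H assume H: "H \<in> bounded_flags T"
        show "f (vert T (opp T H)) = f (vert T H)"
        proof (cases "edge T H = e")
          case True
          then have "H = F \<or> H = opp T F" using edge_eq_iff cycle_bounded[OF Fs F(1)] F(2) by blast
          then show ?thesis using fF bounded_opp_opp[OF cycle_bounded[OF Fs F(1)]] by auto
        qed (use H f' in auto)
      qed
      with fr show "f V = 0" by simp
    qed auto
    moreover have "card ?E = card (bounded_edges T) - 2"
      using e F G cycle_bounded[OF Fs F(1)] cycle_bounded[OF Gs G] edge_in finite_bounded_edges
      by (subst card_Diff_subset) (auto simp: card_insert_if)
    moreover have "card {e, edge T G} \<le> card (bounded_edges T)"
      using F cycle_bounded[OF Fs F(1)] cycle_bounded[OF Gs G] edge_in finite_bounded_edges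
      by (intro card_mono) auto
    moreover have "card {e, edge T G} = 2" using e G by (auto simp: card_insert_if)
    ultimately show False using g by linarith
  qed
qed

lemma cycle_edges_eq:
  assumes "card (bounded_edges T) \<le> card (verts T)" "simple_cycle T Fs"
  shows "cycle_edges T = edge T ` set Fs"
proof
  show "cycle_edges T \<subseteq> edge T ` set Fs"
  proof
    fix e assume "e \<in> cycle_edges T"
    then obtain F Gs where "simple_cycle T Gs" "F \<in> set Gs" "e = edge T F"
      by (auto simp: cycle_edges_def)
    then show "e \<in> edge T ` set Fs" using cycle_unique_subset[OF assms(1) _ assms(2)] by blast
  qed
  show "edge T ` set Fs \<subseteq> cycle_edges T" using assms(2) by (auto simp: cycle_edges_def)
qed

text \<open>The position of the root and the lengths in \<open>R\<close> are coordinates on the span of the stratum.\<close>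

lemma stratum_dim_le:
  assumes V: "span (stratum T) = {coords T l h | l h. compatible T l h}"
    and R: "R \<subseteq> bounded_edges T"
    and rigid: "\<And>l h e. compatible T l h \<Longrightarrow> (\<And>e. e \<in> R \<Longrightarrow> l e = 0) \<Longrightarrow> e \<in> bounded_edges T \<Longrightarrow> l e = 0"
  shows "stratum_dim T \<le> 2 + card R"
proof (rule ccontr)
  assume less: "\<not> stratum_dim T \<le> 2 + card R"
  obtain B where B: "B \<subseteq> span (stratum T)" "independent B" "span (stratum T) \<subseteq> span B"
    "card B = dim (span (stratum T))"
    by (rule basis_exists)
  have finR: "finite R" using R finite_bounded_edges finite_subset by blast
  have cB: "card B > 2 + card R" using less B(4) by (simp add: stratum_dim_def)
  then have finB: "finite B" by (intro card_ge_0_finite) linarith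
  let ?J = "insert Root_x (insert Root_y (Length ` R))"
  have "card ?J = 2 + card R"
    using finR by (auto simp: card_insert_if card_image inj_on_def image_iff)
  then obtain c where c: "\<exists>b\<in>B. c b \<noteq> 0"
    and z: "\<And>j. j \<in> ?J \<Longrightarrow> (\<Sum>b\<in>B. Poly_Mapping.lookup b j * c b) = 0"
    using underdetermined_system[of ?J B "\<lambda>j b. Poly_Mapping.lookup b j"] finR finB cB by auto
  define w where "w = (\<Sum>b\<in>B. c b *\<^sub>R b)"
  have lw: "Poly_Mapping.lookup w j = (\<Sum>b\<in>B. Poly_Mapping.lookup b j * c b)" for j
    by (simp add: w_def lookup_sum lookup_scaleR mult.commute)
  have "w \<in> span (stratum T)" unfolding w_def using B(1) by (intro span_sum span_scale) auto
  then obtain l h where lh: "w = coords T l h" "compatible T l h" using V by auto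
  have R0: "l e = 0" if "e \<in> R" for e
    using z[of "Length e"] lw[of "Length e"] that R lh(1) lookup_coords(3)[OF graph, of e] by auto
  have "w = 0"
  proof (rule poly_mapping_eqI)
    fix j show "Poly_Mapping.lookup w j = Poly_Mapping.lookup 0 j"
    proof (cases j)
      case (Length e)
      then show ?thesis using rigid[OF lh(2) R0] by (simp add: lh(1) lookup_coords_Length[OF graph])
    qed (use z lw in auto)
  qed
  moreover have "w \<noteq> 0"
    using c B(2) finB independentD[of B B c] unfolding w_def by auto
  ultimately show False by simp
qed

end

section \<open>Plane curves of genus one\<close>

context graph_type begin

lemma cycle_constant:
  assumes Fs: "simple_cycle T Fs"
    and f: "\<And>F. F \<in> set Fs \<Longrightarrow> f (vert T (opp T F)) = f (vert T F)"
    and FG: "F \<in> set Fs" "G \<in> set Fs"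
  shows "f (vert T F) = f (vert T G)"
proof -
  have "f (vert T (Fs ! i)) = f (vert T (Fs ! 0))" if "i < length Fs" for i
    using that
  proof (induction i)
    case (Suc i)
    then have "f (vert T (opp T (Fs ! i))) = f (vert T (Fs ! i))" by (intro f) auto
    moreover have "vert T (opp T (Fs ! i)) = vert T (Fs ! (Suc i mod length Fs))"
      using Fs Suc.prems unfolding simple_cycle_def by (meson Suc_lessD)
    ultimately show ?case using Suc by simp
  qed simp
  then show ?thesis using FG by (metis in_set_conv_nth)
qed

lemma cycle_edge_eq_iff:
  "simple_cycle T Fs \<Longrightarrow> F \<in> set Fs \<Longrightarrow> G \<in> set Fs \<Longrightarrow> edge T F = edge T G \<longleftrightarrow> F = G"
  using cycle_edge_inj inj_on_eq_iff by metis

lemma cycle_edge_in: "simple_cycle T Fs \<Longrightarrow> F \<in> set Fs \<Longrightarrow> edge T F \<in> bounded_edges T"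
  using cycle_bounded edge_in by blast

lemma cycle_next:
  assumes "simple_cycle T Fs" "F \<in> set Fs"
  shows "\<exists>G\<in>set Fs. vert T (opp T F) = vert T G"
proof -
  obtain i where i: "i < length Fs" "F = Fs ! i" using assms(2) by (auto simp: in_set_conv_nth)
  then have "vert T (opp T F) = vert T (Fs ! (Suc i mod length Fs))"
    using assms(1) by (auto simp: simple_cycle_def)
  moreover have "Fs ! (Suc i mod length Fs) \<in> set Fs" using i by (intro nth_mem mod_less_divisor) auto
  ultimately show ?thesis by blast
qed

end

lemma cross_transfer:
  assumes "cross a b = 0" "cross a v = 0" "a \<noteq> 0"
  shows "cross b v = 0" "cross v b = 0"
  using cross_eq_0[OF assms(1,3)] cross_eq_0[OF assms(2,3)] by auto

lemma cross_commute: "cross u v = - cross v u"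
  by (simp add: cross_def)

lemma cross_real_dir: "cross (real_dir T F) (real_dir T G) = of_int (det2 (dir T F) (dir T G))"
  by (simp add: cross_def real_dir_def det2_def)

section \<open>Balancing, flux and compatibility in the plane\<close>

locale plane_graph = connected_type T for T :: "'a ctype_scheme" +
  fixes n d :: nat
  assumes plane: "plane_type n d T"
begin

lemma dir_opp: "F \<in> bounded_flags T \<Longrightarrow> real_dir T (opp T F) = - real_dir T F"
  using plane by (auto simp: plane_type_def real_dir_def)

lemma valence_ge_3: "V \<in> verts T \<Longrightarrow> valence T V \<ge> 3"
  using plane by (auto simp: plane_type_def)

lemma balancing: "V \<in> verts T \<Longrightarrow> (\<Sum>F\<in>flags_at T V. real_dir T F) = 0"
proof -
  assume "V \<in> verts T"
  then have "(\<Sum>F\<in>flags_at T V. dir T F) = 0" using plane by (auto simp: plane_type_def)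
  then have "fst (\<Sum>F\<in>flags_at T V. dir T F) = 0" "snd (\<Sum>F\<in>flags_at T V. dir T F) = 0" by simp_all
  then have "(\<Sum>F\<in>flags_at T V. fst (dir T F)) = 0" "(\<Sum>F\<in>flags_at T V. snd (dir T F)) = 0"
    by (simp_all add: fst_sum snd_sum)
  then have "(\<Sum>F\<in>flags_at T V. real_of_int (fst (dir T F))) = 0" "(\<Sum>F\<in>flags_at T V. real_of_int (snd (dir T F))) = 0"
    by (metis of_int_0 of_int_sum)+
  then show ?thesis by (simp add: prod_eq_iff fst_sum snd_sum real_dir_def)
qed

lemma cross_sum: "cross a (\<Sum>x\<in>A. f x) = (\<Sum>x\<in>A. cross a (f x))"
  by (induction A rule: infinite_finite_induct) auto

text \<open>Balancing is summed over the vertices of \<open>A\<close>; the two flags of an edge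
  inside \<open>A\<close> have opposite directions and cancel.\<close>

lemma flux:
  assumes A: "A \<subseteq> verts T"
  shows "(\<Sum>F | F \<in> bounded_flags T \<and> vert T F \<in> A \<and> vert T (opp T F) \<notin> A. cross a (real_dir T F)) +
    (\<Sum>F | F \<in> end_flags T \<and> vert T F \<in> A. cross a (real_dir T F)) = 0"
proof -
  let ?g = "\<lambda>F. cross a (real_dir T F)"
  define I where "I = {F \<in> bounded_flags T. vert T F \<in> A \<and> vert T (opp T F) \<in> A}"
  define B where "B = {F \<in> bounded_flags T. vert T F \<in> A \<and> vert T (opp T F) \<notin> A}"
  define E where "E = {F \<in> end_flags T. vert T F \<in> A}"
  have finA: "finite A" using A finite_verts finite_subset by blast
  have fin: "finite I" "finite B" "finite E"
    using finite_flags flags_split finite_bounded_flags by (auto simp: I_def B_def E_def)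
  have "(\<Sum>V\<in>A. \<Sum>F\<in>flags_at T V. ?g F) = 0"
    using A balancing by (intro sum.neutral) (auto simp: cross_sum[symmetric])
  also have "(\<Sum>V\<in>A. \<Sum>F\<in>flags_at T V. ?g F) = (\<Sum>F\<in>(\<Union>V\<in>A. flags_at T V). ?g F)"
    using finA finite_flags by (subst sum.UNION_disjoint) (auto simp: flags_at_def)
  also have "(\<Union>V\<in>A. flags_at T V) = I \<union> (B \<union> E)"
    using flags_split by (auto simp: flags_at_def I_def B_def E_def)
  also have "sum ?g (I \<union> (B \<union> E)) = sum ?g I + sum ?g (B \<union> E)"
    using fin flags_split by (intro sum.union_disjoint) (auto simp: I_def B_def E_def)
  also have "sum ?g (B \<union> E) = sum ?g B + sum ?g E"
    using fin flags_split by (intro sum.union_disjoint) (auto simp: B_def E_def)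
  also have "sum ?g I = 0"
  proof -
    have "bij_betw (opp T) I I"
      by (rule bij_betwI[where g = "opp T"]) (use bounded_opp bounded_opp_opp in \<open>auto simp: I_def\<close>)
    then have "sum ?g I = (\<Sum>F\<in>I. ?g (opp T F))" by (rule sum.reindex_bij_betw[symmetric])
    also have "\<dots> = - sum ?g I"
      unfolding sum_negf[symmetric] by (rule sum.cong) (auto simp: dir_opp I_def)
    finally show ?thesis by simp
  qed
  finally show ?thesis by (simp add: B_def E_def)
qed

lemma marked_end: "i < n \<Longrightarrow> mark T i \<in> end_flags T"
  using plane by (auto simp: plane_type_def marked_flags_def)

lemma mark_vert_in: "i < n \<Longrightarrow> vert T (mark T i) \<in> verts T"
  using marked_end vert_in by (auto simp: end_flags_def)

lemma end_dir:
  assumes "F \<in> end_flags T" "\<And>i. i < n \<Longrightarrow> F \<noteq> mark T i"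
  shows "dir T F \<in> {(-1, 0), (0, -1), (1, 1)}"
proof -
  have "F \<in> end_flags T - marked_flags n T" using assms by (auto simp: marked_flags_def)
  then show ?thesis using plane unfolding plane_type_def by blast
qed

lemma card_end_flags: "card (end_flags T) = 3 * d + n"
proof -
  let ?E = "\<lambda>u. {F \<in> end_flags T - marked_flags n T. dir T F = u}"
  have fin: "finite (end_flags T)" using finite_flags by (simp add: end_flags_def)
  have c: "card (?E (-1, 0)) = d" "card (?E (0, -1)) = d" "card (?E (1, 1)) = d"
    using plane unfolding plane_type_def by blast+
  have split: "end_flags T = marked_flags n T \<union> (?E (-1, 0) \<union> (?E (0, -1) \<union> ?E (1, 1)))"
    using marked_end end_dir by (auto simp: marked_flags_def)
  have "card (marked_flags n T) = n"
    using plane by (simp add: plane_type_def marked_flags_def card_image)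
  moreover have "card (end_flags T) =
      card (marked_flags n T) + card (?E (-1, 0) \<union> (?E (0, -1) \<union> ?E (1, 1)))"
    by (subst split, rule card_Un_disjoint) (use fin in \<open>auto simp: marked_flags_def\<close>)
  moreover have "card (?E (-1, 0) \<union> (?E (0, -1) \<union> ?E (1, 1))) = d + (d + d)"
    unfolding c(1)[symmetric] c(2)[symmetric]
    by (subst card_Un_disjoint; (subst card_Un_disjoint)?) (use fin c in auto)
  ultimately show ?thesis by simp
qed

lemma card_flags: "card (flags T) = 2 * card (bounded_edges T) + 3 * d + n"
proof -
  have "card (flags T) = card (bounded_flags T) + card (end_flags T)"
    unfolding flags_split(1) using finite_flags flags_split finite_bounded_flags
    by (intro card_Un_disjoint) auto
  then show ?thesis by (simp add: card_bounded_flags card_end_flags)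
qed

text \<open>Each displacement is a multiple of a non-zero direction, and the factor, of whatever
  sign, serves as the length.\<close>

lemma compatible_from_cross:
  assumes nz: "\<And>F. F \<in> bounded_flags T \<Longrightarrow> dir T F \<noteq> 0"
    and cr: "\<And>F. F \<in> bounded_flags T \<Longrightarrow> cross (real_dir T F) (h (vert T (opp T F)) - h (vert T F)) = 0"
  shows "\<exists>l. compatible T l h"
proof -
  \<comment> \<open>A length belongs to an edge and not to a flag, so one flag is chosen per edge;
    for the opposite flag both direction and displacement change sign.\<close>
  define \<phi> where "\<phi> e = (SOME F. F \<in> bounded_flags T \<and> edge T F = e)" for e
  define l where "l e = (SOME t. h (vert T (opp T (\<phi> e))) - h (vert T (\<phi> e)) = t *\<^sub>R real_dir T (\<phi> e))" for e
  have "compatible T l h"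
    unfolding compatible_def
  proof
    fix F assume F: "F \<in> bounded_flags T"
    let ?G = "\<phi> (edge T F)"
    have G: "?G \<in> bounded_flags T \<and> edge T ?G = edge T F"
      unfolding \<phi>_def by (rule someI_ex) (use F in auto)
    then have "\<exists>t. h (vert T (opp T ?G)) - h (vert T ?G) = t *\<^sub>R real_dir T ?G"
      using cr[of ?G] nz[of ?G] by (intro cross_eq_0) auto
    then have l: "h (vert T (opp T ?G)) - h (vert T ?G) = l (edge T F) *\<^sub>R real_dir T ?G"
      unfolding l_def by (rule someI_ex)
    have "?G = F \<or> ?G = opp T F" using edge_eq_iff[OF F] G by auto
    then show "h (vert T (opp T F)) = h (vert T F) + l (edge T F) *\<^sub>R real_dir T F"
    proof
      assume "?G = opp T F"
      then show ?thesis using l bounded_opp_opp[OF F] dir_opp[OF F] by (simp add: algebra_simps)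
    qed (use l in \<open>simp add: algebra_simps\<close>)
  qed
  then show ?thesis by blast
qed

end

section \<open>Elliptic curves without contracted bounded edges: dimension and valence\<close>

locale elliptic_curve =
  fixes C :: curve and n d :: nat
  assumes curve: "plane_curve n d C"
    and genus1: "genus C = 1"
    and uncontracted: "\<not> has_contracted_bounded_edge C"
    and dim: "stratum_dim C = 2 * n + 1"
    and degree: "3 * d = n + 1"
begin

sublocale plane_graph C n d
  using curve by unfold_locales (auto simp: plane_curve_def plane_type_def)

lemma dir_nonzero: "F \<in> bounded_flags C \<Longrightarrow> dir C F \<noteq> 0"
  using uncontracted by (auto simp: has_contracted_bounded_edge_def)

lemma compatible_self: "compatible C (len C) (hpos C)"
  and len_pos: "e \<in> bounded_edges C \<Longrightarrow> len C e > 0"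
  using curve by (auto simp: plane_curve_def)

lemma no_loop: "F \<in> bounded_flags C \<Longrightarrow> vert C (opp C F) \<noteq> vert C F"
  using compatible_self len_pos[OF edge_in, of F] dir_nonzero[of F] by (auto simp: compatible_def)

lemma span_stratum_eq: "span (stratum C) = {coords C l h | l h. compatible C l h}"
  by (rule span_stratum[OF graph compatible_self len_pos])

lemma card_edges: "card (bounded_edges C) = card (verts C)"
  using genus1 by (simp add: genus_def)

text \<open>Deficiency \<open>1\<close> in terms of directions: as no bounded edge is contracted, a
  cycle with parallel edges is mapped to a line and not to a point.\<close>

definition flat :: "nat list \<Rightarrow> bool" where
  "flat Fs \<longleftrightarrow> (\<forall>F\<in>set Fs. \<forall>G\<in>set Fs. cross (real_dir C F) (real_dir C G) = 0)"

lemma cycle_closing: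
  assumes "simple_cycle C Fs" "compatible C l h"
  shows "(\<Sum>F\<in>set Fs. l (edge C F) *\<^sub>R real_dir C F) = 0"
proof -
  have "(\<Sum>F\<in>set Fs. l (edge C F) *\<^sub>R real_dir C F) = (\<Sum>F\<in>set Fs. h (vert C (opp C F)) - h (vert C F))"
    using assms by (intro sum.cong) (auto simp: compatible_def simple_cycle_def)
  then show ?thesis using cycle_telescope[OF assms(1), of h] by simp
qed

text \<open>The closing condition recovers one cycle length from the others, and two of them if the
  cycle has two independent directions. The remaining lengths and the two root coordinates determine
  the datum, and there are as many edges as vertices.\<close>

lemma dim_le:
  assumes Fs: "simple_cycle C Fs"
  shows "2 * n + 1 \<le> card (verts C) + of_bool (flat Fs)"
proof (cases "flat Fs")
  case True
  obtain F where F: "F \<in> set Fs" using Fs by (cases Fs) (auto simp: simple_cycle_def)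
  then have e: "edge C F \<in> bounded_edges C" using Fs cycle_bounded edge_in by blast
  have "stratum_dim C \<le> 2 + card (bounded_edges C - {edge C F})"
  proof (rule stratum_dim_le[OF span_stratum_eq])
    fix l h e assume lh: "compatible C l h" "\<And>e. e \<in> bounded_edges C - {edge C F} \<Longrightarrow> l e = 0"
      and e: "e \<in> bounded_edges C"
    have "l (edge C G) = 0" if "G \<in> set Fs - {F}" for G
      using that F cycle_edge_in[OF Fs] by (intro lh(2)) (simp add: cycle_edge_eq_iff[OF Fs])
    then have "(\<Sum>G\<in>set Fs. l (edge C G) *\<^sub>R real_dir C G) = l (edge C F) *\<^sub>R real_dir C F"
      using F by (simp add: sum.remove)
    then have "l (edge C F) = 0"
      using cycle_closing[OF Fs lh(1)] dir_nonzero[OF cycle_bounded[OF Fs F]] by simp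
    then show "l e = 0" using lh(2) e by (cases "e = edge C F") auto
  qed auto
  moreover have "card (bounded_edges C) > 0" using e finite_bounded_edges by (auto simp: card_gt_0_iff)
  ultimately show ?thesis using dim True e card_edges finite_bounded_edges by (simp add: card_Diff_singleton)
next
  case False
  then obtain F G where FG: "F \<in> set Fs" "G \<in> set Fs" "cross (real_dir C F) (real_dir C G) \<noteq> 0"
    by (auto simp: flat_def)
  then have ne: "F \<noteq> G" "edge C F \<noteq> edge C G" using cycle_edge_eq_iff[OF Fs] by auto
  have e: "edge C F \<in> bounded_edges C" "edge C G \<in> bounded_edges C"
    using FG cycle_edge_in[OF Fs] by auto
  have "stratum_dim C \<le> 2 + card (bounded_edges C - {edge C F, edge C G})"
  proof (rule stratum_dim_le[OF span_stratum_eq])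
    fix l h e assume lh: "compatible C l h" "\<And>e. e \<in> bounded_edges C - {edge C F, edge C G} \<Longrightarrow> l e = 0"
      and e: "e \<in> bounded_edges C"
    have "l (edge C H) = 0" if "H \<in> set Fs - {F} - {G}" for H
      using that FG cycle_edge_in[OF Fs] by (intro lh(2)) (simp add: cycle_edge_eq_iff[OF Fs])
    then have "(\<Sum>H\<in>set Fs. l (edge C H) *\<^sub>R real_dir C H)
        = l (edge C F) *\<^sub>R real_dir C F + l (edge C G) *\<^sub>R real_dir C G"
      using FG ne by (simp add: sum.remove[of _ F] sum.remove[of _ G])
    then have z: "l (edge C F) *\<^sub>R real_dir C F + l (edge C G) *\<^sub>R real_dir C G = 0"
      using cycle_closing[OF Fs lh(1)] by simp
    have "l (edge C G) = 0"
      using arg_cong[OF z, of "cross (real_dir C F)"] FG(3) by simp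
    moreover from this have "l (edge C F) = 0"
      using z dir_nonzero[OF cycle_bounded[OF Fs FG(1)]] by simp
    ultimately show "l e = 0" using lh(2) e by (cases "e \<in> {edge C F, edge C G}") auto
  qed auto
  moreover have "card (bounded_edges C - {edge C F, edge C G}) = card (bounded_edges C) - 2"
    using e ne finite_bounded_edges by (subst card_Diff_subset) auto
  moreover have "card {edge C F, edge C G} \<le> card (bounded_edges C)"
    using e finite_bounded_edges by (intro card_mono) auto
  ultimately show ?thesis using dim card_edges ne by simp
qed

text \<open>There are \<open>2 * card (verts C) + 2 * n + 1\<close> flags, hence by
  \<open>dim_le\<close> at most three per vertex on average, plus one if the cycle is flat. Every
  vertex outside \<open>S\<close> uses up at least three. So a flat cycle leaves room for a single
  extra flag in the whole graph, and any other cycle for none.\<close>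

lemma sum_valence_le:
  assumes Fs: "simple_cycle C Fs" and S: "S \<subseteq> verts C"
  shows "(\<Sum>V\<in>S. valence C V) \<le> 3 * card S + of_bool (flat Fs)"
proof -
  have finS: "finite S" using S finite_verts finite_subset by blast
  have "(\<Sum>V\<in>verts C. valence C V) = card (flags C)"
    using sum_valence[of "verts C"] vert_in by (simp add: Collect_conj_eq Int_absorb2 subset_iff)
  also have "(\<Sum>V\<in>verts C. valence C V) = (\<Sum>V\<in>verts C - S. valence C V) + (\<Sum>V\<in>S. valence C V)"
    using S finite_verts by (rule sum.subset_diff)
  finally have "(\<Sum>V\<in>verts C - S. valence C V) + (\<Sum>V\<in>S. valence C V) = 2 * card (verts C) + 3 * d + n"
    using card_flags card_edges by simp
  moreover have "(\<Sum>V\<in>verts C - S. valence C V) \<ge> (\<Sum>V\<in>verts C - S. 3)"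
    by (rule sum_mono) (use valence_ge_3 in auto)
  moreover have "card (verts C - S) = card (verts C) - card S" "card S \<le> card (verts C)"
    using S finite_verts finS by (auto simp: card_Diff_subset intro: card_mono)
  ultimately show ?thesis using dim_le[OF Fs] degree by simp
qed

end

section \<open>Recession directions\<close>

lemma sum_zero_nonneg_nonpos:
  fixes f :: "'b \<Rightarrow> int"
  assumes "finite A" "sum f A = 0" "x \<in> A" "f x \<noteq> 0"
  shows "\<exists>y\<in>A. f y > 0" and "\<exists>y\<in>A. f y < 0"
proof -
  show "\<exists>y\<in>A. f y > 0"
  proof (rule ccontr)
    assume "\<not> (\<exists>y\<in>A. f y > 0)"
    then have "\<And>y. y \<in> A \<Longrightarrow> - f y \<ge> 0" by (simp add: not_less)
    then show False using sum_nonneg_eq_0_iff[of A "\<lambda>y. - f y"] assms by (auto simp: sum_negf)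
  qed
  show "\<exists>y\<in>A. f y < 0"
  proof (rule ccontr)
    assume "\<not> (\<exists>y\<in>A. f y < 0)"
    then have "\<And>y. y \<in> A \<Longrightarrow> f y \<ge> 0" by (simp add: not_less)
    then show False using sum_nonneg_eq_0_iff[of A f] assms by auto
  qed
qed

text \<open>
  A recession direction of the family of curves of the type of \<open>C\<close> through the same points, along
  which the length of the cycle grows.
\<close>

locale recession = elliptic_curve +
  fixes l0 :: "nat set \<Rightarrow> real" and h0 :: "nat \<Rightarrow> real \<times> real" and Fs :: "nat list" and F0 :: nat
  assumes comp0: "compatible C l0 h0"
    and marks0: "i < n \<Longrightarrow> h0 (vert C (mark C i)) = 0"
    and nonneg: "e \<in> bounded_edges C \<Longrightarrow> l0 e \<ge> 0"
    and cyc: "simple_cycle C Fs"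
    and F0: "F0 \<in> set Fs" "l0 (edge C F0) > 0"
    and kernel: "compatible C l h \<Longrightarrow> (\<And>i. i < n \<Longrightarrow> h (vert C (mark C i)) = 0) \<Longrightarrow>
      \<exists>c. \<forall>V\<in>verts C. h V = c *\<^sub>R h0 V"
    and npos: "n \<ge> 1"
begin

definition S :: "nat set" where "S = {V \<in> verts C. h0 V \<noteq> 0}"
text \<open>The flags of the radial edges: their other endpoint is mapped to the origin by
  \<open>h0\<close>.\<close>

definition bnd :: "nat set" where
  "bnd = {F \<in> bounded_flags C. vert C F \<in> S \<and> vert C (opp C F) \<notin> S}"
definition inn :: "nat set" where
  "inn = {F \<in> bounded_flags C. vert C F \<in> S \<and> vert C (opp C F) \<in> S}"
definition ends :: "nat set" where "ends = {F \<in> end_flags C. vert C F \<in> S}"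

lemma S_sub: "S \<subseteq> verts C" by (auto simp: S_def)
lemma finite_parts: "finite S" "finite bnd" "finite inn" "finite ends"
  using S_sub finite_verts finite_subset finite_bounded_flags finite_flags flags_split
  by (auto simp: bnd_def inn_def ends_def)

lemma h0_diff: "F \<in> bounded_flags C \<Longrightarrow> h0 (vert C (opp C F)) - h0 (vert C F) = l0 (edge C F) *\<^sub>R real_dir C F"
  using comp0 by (simp add: compatible_def)

lemma l0_pos: "F \<in> bounded_flags C \<Longrightarrow> h0 (vert C (opp C F)) \<noteq> h0 (vert C F) \<Longrightarrow> l0 (edge C F) > 0"
  using h0_diff[of F] nonneg[OF edge_in, of F] by (auto simp: less_le)

lemma h0_outside: "V \<in> verts C \<Longrightarrow> V \<notin> S \<Longrightarrow> h0 V = 0"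
  by (auto simp: S_def)

lemma F0_bounded: "F0 \<in> bounded_flags C"
  using cyc F0 cycle_bounded by blast

lemma F0_moves: "h0 (vert C (opp C F0)) \<noteq> h0 (vert C F0)"
  using h0_diff[OF F0_bounded] F0 dir_nonzero[OF F0_bounded] by auto

lemma F0_touches: "vert C F0 \<in> S \<or> vert C (opp C F0) \<in> S"
  using F0_moves h0_outside bounded_vert_in[OF F0_bounded] by metis

lemma S_ne: "S \<noteq> {}"
  using F0_touches by auto

lemma mark_not_S: "i < n \<Longrightarrow> vert C (mark C i) \<notin> S"
  using marks0 by (simp add: S_def)

lemma ends_dir: "F \<in> ends \<Longrightarrow> dir C F \<in> {(-1, 0), (0, -1), (1, 1)}"
  using mark_not_S by (intro end_dir) (auto simp: ends_def)

lemma split_flags: "{F \<in> flags C. vert C F \<in> S} = inn \<union> (bnd \<union> ends)"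
  using flags_split by (auto simp: inn_def bnd_def ends_def)

text \<open>
  Restricting the recession direction to a part of \<open>S\<close> that is attached to the rest of \<open>S\<close> by
  radial edges only gives another element of the kernel.
\<close>

lemma indecomposable:
  assumes A: "A \<subseteq> S"
    and radial: "\<And>F. F \<in> bounded_flags C \<Longrightarrow> vert C F \<in> A \<Longrightarrow> vert C (opp C F) \<in> S - A \<Longrightarrow>
      cross (real_dir C F) (h0 (vert C F)) = 0"
  shows "A = {} \<or> A = S"
proof -
  define h where "h V = (if V \<in> A then h0 V else 0)" for V
  \<comment> \<open>Edges from \<open>A\<close> to vertices outside \<open>S\<close> are radial in
    any case, since they end at the origin.\<close>
  have rad: "cross (real_dir C F) (h0 (vert C F)) = 0"
    if F: "F \<in> bounded_flags C" "vert C F \<in> A" "vert C (opp C F) \<notin> A" for F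
  proof (cases "vert C (opp C F) \<in> S")
    case True
    then show ?thesis using F radial by auto
  next
    case False
    then have "h0 (vert C (opp C F)) = 0" using h0_outside bounded_vert_in F by blast
    then have "h0 (vert C F) = - (l0 (edge C F) *\<^sub>R real_dir C F)" using h0_diff[OF F(1)] by (metis diff_0 minus_minus)
    then show ?thesis by simp
  qed
  have "\<exists>l. compatible C l h"
  proof (rule compatible_from_cross)
    fix F assume F: "F \<in> bounded_flags C"
    have d: "cross (real_dir C F) (h0 (vert C (opp C F)) - h0 (vert C F)) = 0"
      unfolding h0_diff[OF F] by simp
    show "cross (real_dir C F) (h (vert C (opp C F)) - h (vert C F)) = 0"
    proof (cases "vert C F \<in> A"; cases "vert C (opp C F) \<in> A")
      assume "vert C F \<in> A" "vert C (opp C F) \<in> A"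
      then show ?thesis using d by (simp add: h_def)
    next
      assume "vert C F \<in> A" "vert C (opp C F) \<notin> A"
      then show ?thesis using rad[OF F] by (simp add: h_def)
    next
      assume "vert C F \<notin> A" "vert C (opp C F) \<in> A"
      then show ?thesis
        using rad[OF bounded_opp[OF F]] bounded_opp_opp[OF F] dir_opp[OF F] by (simp add: h_def)
    qed (simp add: h_def)
  qed (rule dir_nonzero)
  then obtain l where l: "compatible C l h" by blast
  have "h (vert C (mark C i)) = 0" if "i < n" for i
    using mark_not_S[OF that] A by (auto simp: h_def)
  then obtain c where c: "\<And>V. V \<in> verts C \<Longrightarrow> h V = c *\<^sub>R h0 V"
    using kernel[OF l] by blast
  show ?thesis
  proof (cases "A = {}")
    case False
    then obtain V where V: "V \<in> A" by auto
    then have "h0 V \<noteq> 0" "h0 V = c *\<^sub>R h0 V" using c[of V] A by (auto simp: h_def S_def)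
    then have "c = 1" by (metis scaleR_cancel_right scaleR_one)
    then have "W \<in> A" if "W \<in> S" for W
      using c[of W] that by (auto simp: h_def S_def split: if_splits)
    then show ?thesis using A by auto
  qed simp
qed

text \<open>A union of connected components of \<open>S\<close> has no edges to the rest of
  \<open>S\<close>, so the radiality condition of \<open>indecomposable\<close> is vacuous.\<close>

lemma S_connected:
  assumes "A \<subseteq> S" and "\<And>F. F \<in> inn \<Longrightarrow> vert C F \<in> A \<Longrightarrow> vert C (opp C F) \<in> A"
  shows "A = {} \<or> A = S"
  by (rule indecomposable[OF assms(1)]) (use assms in \<open>auto simp: inn_def\<close>)

text \<open>Let \<open>A\<close> be the set where the form attains its minimum on \<open>S\<close>,
  and let this minimum be at most zero. No edge leaving \<open>A\<close> decreases the form, because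
  vertices outside \<open>S\<close> have value zero. As the flux out of \<open>A\<close> vanishes,
  these edges and the ends at \<open>A\<close> are all neutral, and connectedness gives
  \<open>A = S\<close>.\<close>

lemma max_principle:
  assumes ends: "\<And>F. F \<in> ends \<Longrightarrow> cross a (real_dir C F) \<ge> 0"
  shows "(\<forall>V\<in>S. cross a (h0 V) > 0) \<or>
    ((\<forall>V\<in>S. cross a (h0 V) = 0) \<and> (\<forall>F\<in>ends. cross a (real_dir C F) = 0))"
proof -
  let ?p = "\<lambda>V. cross a (h0 V)"
  define m where "m = Min (?p ` S)"
  have m: "m \<le> ?p V" if "V \<in> S" for V unfolding m_def using that finite_parts by auto
  have "m \<in> ?p ` S" unfolding m_def using finite_parts S_ne by (intro Min_in) auto
  define A where "A = {V \<in> S. ?p V = m}"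
  have A: "A \<noteq> {}" "A \<subseteq> S" using \<open>m \<in> ?p ` S\<close> by (auto simp: A_def)
  show ?thesis
  proof (cases "m > 0")
    case True
    then show ?thesis using m by fastforce
  next
    case False
    define B where "B = {F. F \<in> bounded_flags C \<and> vert C F \<in> A \<and> vert C (opp C F) \<notin> A}"
    define E where "E = {F. F \<in> end_flags C \<and> vert C F \<in> A}"
    have finBE: "finite B" "finite E"
      using finite_bounded_flags finite_flags flags_split by (auto simp: B_def E_def)
    have sum: "(\<Sum>F\<in>B. cross a (real_dir C F)) + (\<Sum>F\<in>E. cross a (real_dir C F)) = 0"
      using flux[of A a] A(2) S_sub by (auto simp: B_def E_def)
    have E0: "cross a (real_dir C F) \<ge> 0" if "F \<in> E" for F
      using that A(2) by (intro ends) (auto simp: E_def ends_def)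
    have step: "?p (vert C (opp C F)) - m = l0 (edge C F) * cross a (real_dir C F)" if "F \<in> B" for F
    proof -
      have "cross a (h0 (vert C (opp C F)) - h0 (vert C F)) = l0 (edge C F) * cross a (real_dir C F)"
        using that by (subst h0_diff) (auto simp: B_def)
      then show ?thesis using that by (simp add: B_def A_def)
    qed
    \<comment> \<open>An edge leaving \<open>A\<close> is not collapsed by \<open>h0\<close>: at its
      target the form has another value, or the target is at the origin.\<close>
    have lpos: "l0 (edge C F) > 0" if "F \<in> B" for F
    proof (rule l0_pos)
      show "h0 (vert C (opp C F)) \<noteq> h0 (vert C F)"
        using that bounded_vert_in[of F] by (auto simp: B_def A_def S_def)
    qed (use that in \<open>auto simp: B_def\<close>)
    have low: "?p (vert C (opp C F)) \<ge> m" if "F \<in> B" for F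
    proof (cases "vert C (opp C F) \<in> S")
      case notS: False
      then have "h0 (vert C (opp C F)) = 0" using h0_outside bounded_vert_in that by (auto simp: B_def)
      then show ?thesis using False by simp
    qed (rule m)
    have B0: "cross a (real_dir C F) \<ge> 0" if "F \<in> B" for F
      using step[OF that] lpos[OF that] low[OF that] by (metis diff_ge_0_iff_ge zero_le_mult_iff not_le)
    have sB: "(\<Sum>F\<in>B. cross a (real_dir C F)) = 0" and sE: "(\<Sum>F\<in>E. cross a (real_dir C F)) = 0"
      using sum sum_nonneg[of B "\<lambda>F. cross a (real_dir C F)", OF B0] sum_nonneg[of E "\<lambda>F. cross a (real_dir C F)", OF E0] by linarith+
    have zB: "cross a (real_dir C F) = 0" if "F \<in> B" for F
      using sB sum_nonneg_eq_0_iff[OF finBE(1), of "\<lambda>F. cross a (real_dir C F)"] B0 that by auto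
    have zE: "cross a (real_dir C F) = 0" if "F \<in> E" for F
      using sE sum_nonneg_eq_0_iff[OF finBE(2), of "\<lambda>F. cross a (real_dir C F)"] E0 that by auto
    have eqB: "?p (vert C (opp C F)) = m" if "F \<in> B" for F
      using step[OF that] zB[OF that] by simp
    have AS: "A = S"
    proof -
      have "vert C (opp C F) \<in> A" if "F \<in> inn" "vert C F \<in> A" for F
        using eqB[of F] that by (auto simp: B_def inn_def A_def)
      then show ?thesis using S_connected[OF A(2)] A(1) by blast
    qed
    \<comment> \<open>With a non-zero constant value no edge could lead from \<open>S\<close> to the
      origin, so \<open>S\<close> would be the whole graph, including the vertex of a marked end;
      this uses \<open>n \<ge> 1\<close>.\<close>
    have m0: "m = 0"
    proof (rule ccontr)
      assume "m \<noteq> 0"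
      have closed: "vert C (opp C F) \<in> S" if F: "F \<in> bounded_flags C" "vert C F \<in> S" for F
      proof (rule ccontr)
        assume n: "vert C (opp C F) \<notin> S"
        then have "F \<in> B" using F AS by (auto simp: B_def)
        then have "?p (vert C (opp C F)) = m" by (rule eqB)
        moreover have "h0 (vert C (opp C F)) = 0" using n h0_outside bounded_vert_in F by blast
        ultimately show False using \<open>m \<noteq> 0\<close> by simp
      qed
      obtain V where "V \<in> S" using S_ne by auto
      then have "vert C (mark C 0) \<in> S"
        using connected_closed[of V S "vert C (mark C 0)"] closed S_sub mark_vert_in[of 0] npos by auto
      then show False using mark_not_S[of 0] npos by auto
    qed
    have "\<forall>F\<in>ends. cross a (real_dir C F) = 0"
      using zE AS by (auto simp: E_def ends_def)
    then show ?thesis using AS m0 by (auto simp: A_def)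
  qed
qed

text \<open>The edges leaving \<open>S\<close> point to the origin, so an integral form that is positive on \<open>S\<close> takes values \<open>\<le> -1\<close> on them.\<close>

lemma card_bnd_le:
  assumes int: "a = (of_int x, of_int y)" and pos: "\<And>V. V \<in> S \<Longrightarrow> cross a (h0 V) > 0"
  shows "real (card bnd) \<le> (\<Sum>F\<in>ends. cross a (real_dir C F))"
proof -
  have "(\<Sum>F\<in>bnd. cross a (real_dir C F)) + (\<Sum>F\<in>ends. cross a (real_dir C F)) = 0"
    using flux[OF S_sub, of a] by (simp add: bnd_def ends_def)
  moreover have "(\<Sum>F\<in>bnd. cross a (real_dir C F)) \<le> (\<Sum>F\<in>bnd. - 1)"
  proof (rule sum_mono)
    fix F assume F: "F \<in> bnd"
    then have Fb: "F \<in> bounded_flags C" by (simp add: bnd_def)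
    have "h0 (vert C (opp C F)) = 0" using F h0_outside bounded_vert_in by (auto simp: bnd_def)
    then have "cross a (- h0 (vert C F)) = l0 (edge C F) * cross a (real_dir C F)"
      using h0_diff[OF Fb] by (metis diff_0 cross_simps(7))
    then have "l0 (edge C F) * cross a (real_dir C F) < 0"
      using pos[of "vert C F"] F by (simp add: bnd_def)
    then have "cross a (real_dir C F) < 0"
      using nonneg[OF edge_in[OF Fb]] by (simp add: mult_less_0_iff)
    moreover define k where "k = x * snd (dir C F) - y * fst (dir C F)"
    have k: "cross a (real_dir C F) = of_int k"
      by (simp add: k_def cross_def int real_dir_def)
    ultimately have "k \<le> - 1" by simp
    then show "cross a (real_dir C F) \<le> - 1" unfolding k by linarith
  qed
  ultimately show ?thesis by simp
qed

section \<open>Counting the edges and ends at \<open>S\<close>\<close>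

abbreviation b_inn :: nat where "b_inn \<equiv> card (edge C ` inn)"

lemma card_inn: "card inn = 2 * b_inn"
  by (rule card_opp_closed) (use bounded_opp bounded_opp_opp in \<open>auto simp: inn_def\<close>)

lemma card_S_le: "card S \<le> 1 + b_inn"
proof -
  obtain r where r: "r \<in> S" using S_ne by auto
  show ?thesis
  proof (rule potential_bound[OF finite_parts(1) r])
    show "edge C ` inn \<subseteq> bounded_edges C" using edge_in by (auto simp: inn_def)
  next
    fix f :: "nat \<Rightarrow> real" and V
    assume f: "f r = 0" "\<And>F. F \<in> bounded_flags C \<Longrightarrow> edge C F \<in> edge C ` inn \<Longrightarrow> f (vert C (opp C F)) = f (vert C F)"
      and V: "V \<in> S"
    have "{V \<in> S. f V = 0} = {} \<or> {V \<in> S. f V = 0} = S"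
      by (rule S_connected) (use f in \<open>auto simp: inn_def\<close>)
    then show "f V = 0" using r f(1) V by blast
  qed
qed

text \<open>The edge of \<open>F0\<close> lies on a cycle inside \<open>S\<close>, so potentials on
  \<open>S\<close> stay rigid when it is dropped.\<close>

lemma card_S_le_cycle:
  assumes cS: "\<And>F. F \<in> set Fs \<Longrightarrow> vert C F \<in> S"
  shows "card S \<le> b_inn"
proof -
  obtain r where r: "r \<in> S" using S_ne by auto
  have cinn: "F \<in> inn" if "F \<in> set Fs" for F
    using cycle_next[OF cyc that] cS that cycle_bounded[OF cyc that] by (auto simp: inn_def)
  have "card S \<le> 1 + card (edge C ` inn - {edge C F0})"
  proof (rule potential_bound[OF finite_parts(1) r])
    show "edge C ` inn - {edge C F0} \<subseteq> bounded_edges C" using edge_in by (auto simp: inn_def)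
  next
    fix f :: "nat \<Rightarrow> real" and V
    assume f: "f r = 0" "\<And>F. F \<in> bounded_flags C \<Longrightarrow> edge C F \<in> edge C ` inn - {edge C F0} \<Longrightarrow> f (vert C (opp C F)) = f (vert C F)"
      and V: "V \<in> S"
    have f0: "f (vert C (opp C F0)) = f (vert C F0)"
    proof (rule cycle_last_edge[OF cyc F0(1)])
      fix G assume G: "G \<in> set Fs" "G \<noteq> F0"
      then have "edge C G \<noteq> edge C F0" using cycle_edge_eq_iff[OF cyc G(1) F0(1)] by simp
      then show "f (vert C (opp C G)) = f (vert C G)"
        using cinn[OF G(1)] cycle_bounded[OF cyc G(1)] by (intro f(2)) auto
    qed
    have f': "f (vert C (opp C F)) = f (vert C F)" if F: "F \<in> inn" for F
    proof (cases "edge C F = edge C F0")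
      case True
      then have "F = F0 \<or> F = opp C F0" using edge_eq_iff[OF F0_bounded] by auto
      then show ?thesis using f0 bounded_opp_opp[OF F0_bounded] by auto
    next
      case False
      then show ?thesis using F by (intro f(2)) (auto simp: inn_def)
    qed
    have "{V \<in> S. f V = 0} = {} \<or> {V \<in> S. f V = 0} = S"
      by (rule S_connected) (use f' in \<open>auto simp: inn_def\<close>)
    then show "f V = 0" using r f(1) V by blast
  qed
  moreover have "edge C F0 \<in> edge C ` inn" using cinn F0 by auto
  then have "card (edge C ` inn - {edge C F0}) = b_inn - 1" "b_inn > 0"
    using finite_parts by (auto simp: card_gt_0_iff)
  ultimately show ?thesis by simp
qed

text \<open>The cycle also meets \<open>S\<close>, because \<open>F0\<close> is moved by
  \<open>h0\<close>. The jumps of the indicator function of \<open>S\<close> along the cycle sum to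
  zero, so the cycle both enters and leaves \<open>S\<close>, and it does so through different
  edges.\<close>

lemma card_bnd_ge_2:
  assumes "F \<in> set Fs" "vert C F \<notin> S"
  shows "card bnd \<ge> 2"
proof -
  define f where "f V = (if V \<in> S then 1 else 0 :: int)" for V
  have "\<exists>G\<in>set Fs. f (vert C (opp C G)) - f (vert C G) \<noteq> 0"
  proof (rule ccontr)
    assume "\<not> ?thesis"
    then have c: "f (vert C (opp C G)) = f (vert C G)" if "G \<in> set Fs" for G using that by auto
    then have "f (vert C F) = f (vert C F0)" by (rule cycle_constant[OF cyc _ assms(1) F0(1)])
    then show False using F0_touches assms(2) c[OF F0(1)] by (auto simp: f_def split: if_splits)
  qed
  then obtain G where G: "G \<in> set Fs" "f (vert C (opp C G)) - f (vert C G) \<noteq> 0" by blast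
  note ex = sum_zero_nonneg_nonpos[OF _ cycle_telescope[OF cyc, of f] G]
  obtain X where X: "X \<in> set Fs" "f (vert C (opp C X)) - f (vert C X) > 0" using ex(1) by auto
  obtain Y where Y: "Y \<in> set Fs" "f (vert C (opp C Y)) - f (vert C Y) < 0" using ex(2) by auto
  have Xb: "X \<in> bounded_flags C" using X cyc cycle_bounded by blast
  have "Y \<in> bnd" using Y cycle_bounded[OF cyc Y(1)] by (auto simp: f_def bnd_def split: if_splits)
  moreover have "opp C X \<in> bnd"
    using X bounded_opp[OF Xb] bounded_opp_opp[OF Xb] by (auto simp: f_def bnd_def split: if_splits)
  moreover have "opp C X \<noteq> Y"
  proof
    assume "opp C X = Y"
    then have "edge C X = edge C Y" using edge_opp[OF Xb] by simp
    then have "X = Y" using cycle_edge_eq_iff[OF cyc X(1) Y(1)] by simp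
    then show False using X Y by simp
  qed
  ultimately have "{Y, opp C X} \<subseteq> bnd" "card {Y, opp C X} = 2" by auto
  then show ?thesis using card_mono[OF finite_parts(2)] by metis
qed

text \<open>
  The vectors \<open>h V\<close>, \<open>V \<in> S\<close>, satisfy one equation per edge touching \<open>S\<close>; one of them is redundant if
  the cycle is flat. The bound holds since the solution space is a line.
\<close>

lemma kernel_count: "2 * card S + of_bool (flat Fs) \<le> b_inn + card bnd + 1"
proof (rule ccontr)
  assume big: "\<not> ?thesis"
  define \<phi> where "\<phi> e = (SOME F. F \<in> bounded_flags C \<and> edge C F = e)" for e
  have \<phi>: "\<phi> e \<in> bounded_flags C \<and> edge C (\<phi> e) = e" if "e \<in> bounded_edges C" for e
    unfolding \<phi>_def by (rule someI_ex) (use that in \<open>auto simp: bounded_edges_def\<close>)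
  define h where "h x V = (x (V, True), x (V, False))" for x :: "nat \<times> bool \<Rightarrow> real" and V
  have h_add: "h (\<lambda>i. x i + y i) V = h x V + h y V" for x y V by (simp add: h_def)
  have h_scale: "h (\<lambda>i. c * x i) V = c *\<^sub>R h x V" for c x V by (simp add: h_def)
  obtain V0 where V0: "V0 \<in> S" using S_ne by auto
  \<comment> \<open>A coordinate in which \<open>h0 V0\<close> is non-zero. Requiring it to vanish
    is the one additional equation; it excludes all non-zero multiples of \<open>h0\<close>.\<close>
  obtain k where k: "(if k then fst (h0 V0) else snd (h0 V0)) \<noteq> 0"
  proof (cases "fst (h0 V0) = 0")
    case True
    then have "snd (h0 V0) \<noteq> 0" using V0 by (auto simp: S_def prod_eq_iff)
    then show ?thesis using that[of False] by simp
  next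
    case False
    then show ?thesis using that[of True] by simp
  qed
  define E where "E = edge C ` (inn \<union> bnd) - (if flat Fs then {edge C F0} else {})"
  have Eb: "E \<subseteq> bounded_edges C" using edge_in by (auto simp: E_def inn_def bnd_def)
  have finE: "finite E" using finite_parts by (auto simp: E_def)
  have "edge C F0 \<in> edge C ` (inn \<union> bnd)"
  proof (cases "vert C F0 \<in> S")
    case True
    then have "F0 \<in> inn \<union> bnd" using F0_bounded by (auto simp: inn_def bnd_def)
    then show ?thesis by blast
  next
    case False
    then have "opp C F0 \<in> inn \<union> bnd"
      using F0_touches bounded_opp[OF F0_bounded] by (auto simp: inn_def bnd_def)
    then have "edge C (opp C F0) \<in> edge C ` (inn \<union> bnd)" by blast
    then show ?thesis using edge_opp[OF F0_bounded] by simp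
  qed
  then have "card E + of_bool (flat Fs) = card (edge C ` (inn \<union> bnd))"
    using finite_parts card_gt_0_iff[of "edge C ` (inn \<union> bnd)"]
    by (cases "flat Fs") (auto simp: E_def card_Diff_singleton)
  moreover have "card (edge C ` (inn \<union> bnd)) \<le> b_inn + card bnd"
    unfolding image_Un using card_Un_le[of "edge C ` inn" "edge C ` bnd"] card_image_le[OF finite_parts(2), of "edge C"]
    by linarith
  ultimately have cE: "card E + 1 < 2 * card S" using big by (cases "flat Fs") simp_all
  define \<psi> where "\<psi> j x = (case j of None \<Rightarrow> x (V0, k)
      | Some e \<Rightarrow> cross (real_dir C (\<phi> e)) (h x (vert C (opp C (\<phi> e))) - h x (vert C (\<phi> e))))"
    for j and x :: "nat \<times> bool \<Rightarrow> real"
  have "card (insert None (Some ` E)) = card E + 1"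
    using finE by (subst card_insert_disjoint) (auto simp: card_image)
  moreover have "card (S \<times> (UNIV :: bool set)) = 2 * card S" by (simp add: card_cartesian_product)
  ultimately have "\<exists>x. (\<exists>i\<in>S \<times> UNIV. x i \<noteq> 0) \<and> (\<forall>i. i \<notin> S \<times> UNIV \<longrightarrow> x i = 0) \<and>
      (\<forall>j\<in>insert None (Some ` E). \<psi> j x = 0)"
    using finite_parts finE cE
    by (intro underdetermined_functionals)
      (auto simp: \<psi>_def h_add h_scale algebra_simps split: option.splits)
  then obtain x where x: "\<exists>i\<in>S \<times> UNIV. x i \<noteq> 0" "\<forall>i. i \<notin> S \<times> UNIV \<longrightarrow> x i = 0"
    "\<psi> None x = 0" "\<forall>e\<in>E. \<psi> (Some e) x = 0" by blast
  have h_out: "h x V = 0" if "V \<notin> S" for V using x(2) that by (simp add: h_def zero_prod_def)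
  have crE: "cross (real_dir C F) (h x (vert C (opp C F)) - h x (vert C F)) = 0"
    if F: "F \<in> bounded_flags C" and n: "flat Fs \<longrightarrow> edge C F \<noteq> edge C F0" for F
  proof (cases "vert C F \<in> S \<or> vert C (opp C F) \<in> S")
    case False
    then show ?thesis using h_out by simp
  next
    case True
    have "edge C F \<in> edge C ` (inn \<union> bnd)"
    proof (cases "vert C F \<in> S")
      case True
      then have "F \<in> inn \<union> bnd" using F by (auto simp: inn_def bnd_def)
      then show ?thesis by blast
    next
      case False
      then have "opp C F \<in> inn \<union> bnd"
        using True bounded_opp[OF F] by (auto simp: inn_def bnd_def)
      then have "edge C (opp C F) \<in> edge C ` (inn \<union> bnd)" by blast
      then show ?thesis using edge_opp[OF F] by simp
    qed
    then have "edge C F \<in> E" using n by (auto simp: E_def)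
    then have z: "\<psi> (Some (edge C F)) x = 0" using x(4) by blast
    have "edge C (\<phi> (edge C F)) = edge C F" using \<phi>[OF edge_in[OF F]] by simp
    then have "\<phi> (edge C F) = F \<or> \<phi> (edge C F) = opp C F" using edge_eq_iff[OF F] by blast
    then show ?thesis
      using z bounded_opp_opp[OF F] dir_opp[OF F] by (auto simp: \<psi>_def)
  qed
  have cr: "cross (real_dir C F) (h x (vert C (opp C F)) - h x (vert C F)) = 0" if F: "F \<in> bounded_flags C" for F
  proof (cases "flat Fs \<and> edge C F = edge C F0")
    case False
    then show ?thesis using crE[OF F] by auto
  next
    case True
    \<comment> \<open>On a flat cycle every edge imposes the same condition, namely that the form
      \<open>cross (real_dir C F0)\<close> takes equal values at its two vertices. The condition at
      \<open>F0\<close> therefore follows from the others.\<close>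
    have "cross (real_dir C F0) (h x (vert C (opp C F0))) = cross (real_dir C F0) (h x (vert C F0))"
    proof (rule cycle_last_edge[OF cyc F0(1)])
      fix G assume G: "G \<in> set Fs" "G \<noteq> F0"
      then have "edge C G \<noteq> edge C F0" using cycle_edge_eq_iff[OF cyc G(1) F0(1)] by simp
      then have "cross (real_dir C G) (h x (vert C (opp C G)) - h x (vert C G)) = 0"
        using crE[OF cycle_bounded[OF cyc G(1)]] by simp
      moreover have "cross (real_dir C G) (real_dir C F0) = 0" using True G F0 by (simp add: flat_def)
      moreover have "real_dir C G \<noteq> 0" using dir_nonzero cycle_bounded[OF cyc G(1)] by simp
      ultimately have "cross (real_dir C F0) (h x (vert C (opp C G)) - h x (vert C G)) = 0"
        using cross_transfer(1) by blast
      then show "cross (real_dir C F0) (h x (vert C (opp C G))) = cross (real_dir C F0) (h x (vert C G))" by simp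
    qed
    moreover have "F = F0 \<or> F = opp C F0" using edge_eq_iff[OF F0_bounded] True by auto
    ultimately show ?thesis using bounded_opp_opp[OF F0_bounded] dir_opp[OF F0_bounded] by auto
  qed
  obtain l where l: "compatible C l (h x)"
    using compatible_from_cross[OF dir_nonzero cr] by blast
  obtain c where c: "\<And>V. V \<in> verts C \<Longrightarrow> h x V = c *\<^sub>R h0 V"
    using kernel[OF l] h_out mark_not_S by blast
  have "c = 0"
    using c[of V0] V0 S_sub x(3) k by (cases k) (auto simp: \<psi>_def h_def prod_eq_iff)
  then have "h x V = 0" if "V \<in> S" for V using c that S_sub by auto
  then have "x (V, q) = 0" if "V \<in> S" for V q using that by (cases q) (auto simp: h_def zero_prod_def)
  then show False using x(1) by auto
qed

text \<open>When the valence bound for \<open>S\<close> and \<open>kernel_count\<close> are added,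
  the number of boundary edges and the correction for flat cycles cancel. With
  \<open>card_S_le\<close> this leaves at most two ends, and two only if the edges inside
  \<open>S\<close> form a tree.\<close>

lemma ends_count: "card ends + b_inn \<le> card S + 1"
proof -
  have "card ends + card inn + card bnd = card {F \<in> flags C. vert C F \<in> S}"
  proof -
    have "card (inn \<union> (bnd \<union> ends)) = card inn + card (bnd \<union> ends)"
      using finite_parts flags_split by (intro card_Un_disjoint) (auto simp: inn_def bnd_def ends_def)
    moreover have "card (bnd \<union> ends) = card bnd + card ends"
      using finite_parts flags_split by (intro card_Un_disjoint) (auto simp: bnd_def ends_def)
    ultimately show ?thesis unfolding split_flags by simp
  qed
  also have "\<dots> \<le> 3 * card S + of_bool (flat Fs)"
    using sum_valence_le[OF cyc S_sub] sum_valence[OF S_sub] by simp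
  finally show ?thesis using card_inn kernel_count by simp
qed


section \<open>The directions of the ends and the shape of \<open>S\<close>\<close>

lemma card_bnd_ge_2_if_inn_less:
  assumes "b_inn < card S"
  shows "card bnd \<ge> 2"
  using card_S_le_cycle card_bnd_ge_2 assms by (meson not_le)

text \<open>Two ends of different directions use up the whole bound of \<open>ends_count\<close>, so
  the edges inside \<open>S\<close> form a tree and the cycle crosses the boundary of
  \<open>S\<close>. The contradiction comes from an integral form with values \<open>0\<close> and
  \<open>1\<close> on the two directions: it bounds the number of boundary edges by
  \<open>1\<close>.\<close>

lemma ends_parallel:
  assumes F: "F \<in> ends" and G: "G \<in> ends"
  shows "dir C F = dir C G"
proof (rule ccontr)
  assume ne: "dir C F \<noteq> dir C G"
  then have FG: "F \<noteq> G" by auto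
  then have "{F, G} \<subseteq> ends" "card {F, G} = 2" using F G by auto
  then have e2: "card ends \<ge> 2" using card_mono[OF finite_parts(4)] by metis
  then have "card ends = 2" and b: "card bnd \<ge> 2"
    using ends_count card_S_le card_bnd_ge_2_if_inn_less by linarith+
  then have ends: "ends = {F, G}"
    using \<open>{F, G} \<subseteq> ends\<close> \<open>card {F, G} = 2\<close> finite_parts(4) card_subset_eq by metis
  define s where "s = det2 (dir C F) (dir C G)"
  have s: "s * s = 1" using ends_dir[OF F] ends_dir[OF G] ne by (auto simp: s_def det2_def)
  \<comment> \<open>The sign \<open>s\<close> makes the form take the value \<open>1\<close> on the
    second end. It is a sign because any two of the three possible directions have determinant
    \<open>1\<close> or \<open>-1\<close>.\<close>
  define a where "a = (real_of_int (s * fst (dir C F)), real_of_int (s * snd (dir C F)))"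
  have aF: "cross a (real_dir C F) = 0" by (simp add: a_def cross_def real_dir_def)
  have aG: "cross a (real_dir C G) = 1"
  proof -
    have "cross a (real_dir C G) = of_int (s * s)"
      by (simp add: a_def cross_def real_dir_def s_def det2_def algebra_simps)
    then show ?thesis using s by simp
  qed
  have "cross a (real_dir C H) \<ge> 0" if "H \<in> ends" for H using that aF aG ends by auto
  from max_principle[OF this] have "\<And>V. V \<in> S \<Longrightarrow> cross a (h0 V) > 0"
    using aG ends by auto
  then have "real (card bnd) \<le> (\<Sum>F\<in>ends. cross a (real_dir C F))"
    by (rule card_bnd_le[OF a_def])
  also have "\<dots> = 1" using ends aF aG FG by simp
  finally show False using b by simp
qed

lemma ends_direction:
  obtains u where "u \<in> {(-1, 0), (0, -1), (1, 1)}" "\<And>F. F \<in> ends \<Longrightarrow> dir C F = u"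
proof (cases "ends = {}")
  case True
  \<comment> \<open>Without ends the condition is void, and any admissible direction serves as a
    default.\<close>
  then show ?thesis using that[of "(-1, 0)"] by simp
next
  case False
  then obtain F where F: "F \<in> ends" by auto
  show ?thesis by (rule that[OF ends_dir[OF F]]) (use ends_parallel[OF _ F] in simp)
qed

text \<open>The maximum principle applies to both \<open>cross u\<close> and
  \<open>cross (- u)\<close>, which cannot both be positive, so \<open>S\<close> is mapped to the
  line of \<open>u\<close>. An integral form with value \<open>1\<close> on \<open>u\<close> is then
  positive on \<open>S\<close>; in its flux each end counts \<open>1\<close> and each boundary edge
  at most \<open>-1\<close>.\<close>

lemma radial_picture:
  obtains u where "u \<noteq> 0" "\<And>F. F \<in> ends \<Longrightarrow> real_dir C F = u"
    "\<And>V. V \<in> S \<Longrightarrow> \<exists>t. h0 V = t *\<^sub>R u" "card bnd \<le> card ends"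
proof -
  obtain v where v: "v \<in> {(-1, 0), (0, -1), (1, 1)}" "\<And>F. F \<in> ends \<Longrightarrow> dir C F = v"
    using ends_direction by blast
  define u where "u = (real_of_int (fst v), real_of_int (snd v))"
  have u: "\<And>F. F \<in> ends \<Longrightarrow> real_dir C F = u" using v(2) by (simp add: u_def real_dir_def)
  have u0: "u \<noteq> 0" using v(1) by (auto simp: u_def zero_prod_def)
  have cu: "cross u (h0 V) = 0" if V: "V \<in> S" for V
  proof -
    have "cross u (h0 V) > 0 \<or> cross u (h0 V) = 0" using max_principle[of u] u V by auto
    moreover have "cross (- u) (h0 V) > 0 \<or> cross (- u) (h0 V) = 0" using max_principle[of "- u"] u V by auto
    ultimately show ?thesis by auto
  qed
  then have t: "\<exists>t. h0 V = t *\<^sub>R u" if "V \<in> S" for V using cross_eq_0[OF _ u0] that by blast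
  \<comment> \<open>Such integers exist because each of the three directions is primitive.\<close>
  obtain x y :: int where xy: "cross (of_int x, of_int y) u = 1"
  proof -
    from v(1) consider "v = (-1, 0)" | "v = (0, -1)" | "v = (1, 1)" by auto
    then show ?thesis
    proof cases
      case 1
      then show ?thesis using that[of 0 1] by (simp add: u_def cross_def)
    next
      case 2
      then show ?thesis using that[of "-1" 0] by (simp add: u_def cross_def)
    next
      case 3
      then show ?thesis using that[of 1 0] by (simp add: u_def cross_def)
    qed
  qed
  let ?a = "(of_int x, of_int y) :: real \<times> real"
  have pos: "cross ?a (h0 V) > 0" if V: "V \<in> S" for V
  proof -
    have "cross ?a (h0 V) \<noteq> 0"
      using t[OF V] xy V by (auto simp: S_def)
    then show ?thesis using max_principle[of ?a] u xy V by auto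
  qed
  have "real (card bnd) \<le> (\<Sum>F\<in>ends. cross ?a (real_dir C F))"
    by (rule card_bnd_le[OF refl pos])
  also have "\<dots> = card ends" using u xy by simp
  finally show ?thesis using that u0 u t by simp
qed

text \<open>All of \<open>S\<close> is mapped to one line through the origin, so an edge between
  vertices with different images is radial. The vertices over a single point could then be split
  off, which indecomposability forbids.\<close>

lemma h0_constant:
  assumes V: "V \<in> S" and W: "W \<in> S"
  shows "h0 W = h0 V"
proof -
  obtain u where u: "u \<noteq> 0" "\<And>V. V \<in> S \<Longrightarrow> \<exists>t. h0 V = t *\<^sub>R u" using radial_picture by metis
  have "{W \<in> S. h0 W = h0 V} = {} \<or> {W \<in> S. h0 W = h0 V} = S"
  proof (rule indecomposable)
    fix F assume F: "F \<in> bounded_flags C" "vert C F \<in> {W \<in> S. h0 W = h0 V}"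
      "vert C (opp C F) \<in> S - {W \<in> S. h0 W = h0 V}"
    obtain s t where st: "h0 (vert C F) = s *\<^sub>R u" "h0 (vert C (opp C F)) = t *\<^sub>R u"
      using F u(2) by blast
    have "l0 (edge C F) > 0" using F by (intro l0_pos) auto
    moreover have "l0 (edge C F) *\<^sub>R real_dir C F = (t - s) *\<^sub>R u"
      using h0_diff[OF F(1)] st by (simp add: algebra_simps)
    then have "cross (l0 (edge C F) *\<^sub>R real_dir C F) (h0 (vert C F)) = 0" by (simp add: st)
    ultimately show "cross (real_dir C F) (h0 (vert C F)) = 0" by simp
  qed auto
  then show ?thesis using V W by blast
qed

text \<open>As \<open>h0\<close> is constant on \<open>S\<close> but not along \<open>F0\<close>,
  the cycle does not stay in \<open>S\<close>. Its two boundary edges force two ends, and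
  \<open>ends_count\<close> then leaves fewer inner edges than vertices.\<close>

lemma inn_less: "b_inn < card S" and bnd_ge_2: "card bnd \<ge> 2"
proof -
  have out: "\<exists>F\<in>set Fs. vert C F \<notin> S"
  proof (rule ccontr)
    assume "\<not> ?thesis"
    then have "vert C F0 \<in> S" "vert C (opp C F0) \<in> S"
      using cycle_next[OF cyc F0(1)] F0 by auto
    then show False using h0_constant F0_moves by blast
  qed
  then show 2: "card bnd \<ge> 2" using card_bnd_ge_2 by blast
  obtain u where "card bnd \<le> card ends" using radial_picture by metis
  then show "b_inn < card S" using 2 ends_count by simp
qed

text \<open>Otherwise indecomposability gives every vertex of \<open>S\<close> an inner edge that is
  not radial, and balancing gives it a second one, since boundary edges and ends are parallel to
  \<open>u\<close>. Two inner flags per vertex mean at least as many inner edges as vertices,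
  contrary to \<open>inn_less\<close>.\<close>

lemma card_S_eq_1: "card S = 1"
proof (rule ccontr)
  assume ne1: "card S \<noteq> 1"
  obtain u where u: "u \<noteq> 0" "\<And>F. F \<in> ends \<Longrightarrow> real_dir C F = u"
    "\<And>V. V \<in> S \<Longrightarrow> \<exists>t. h0 V = t *\<^sub>R u"
    using radial_picture by metis
  have two: "card {F \<in> inn. vert C F = V} \<ge> 2" if V: "V \<in> S" for V
  proof -
    obtain t where t: "h0 V = t *\<^sub>R u" "t \<noteq> 0" using u(3)[OF V] V by (auto simp: S_def)
    have "{V} \<noteq> S"
    proof
      assume "{V} = S"
      then have "card S = card {V}" by simp
      then show False using ne1 by simp
    qed
    then have "\<exists>F. F \<in> bounded_flags C \<and> vert C F = V \<and> vert C (opp C F) \<in> S \<and> cross (real_dir C F) (h0 V) \<noteq> 0"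
      using indecomposable[of "{V}"] V by auto
    then obtain F where F: "F \<in> inn" "vert C F = V" "cross (real_dir C F) (h0 V) \<noteq> 0"
      using V by (auto simp: inn_def)
    then have Fu: "cross u (real_dir C F) \<noteq> 0" using t cross_commute[of u] by auto
    have Ffl: "F \<in> flags_at C V" using F bounded_subset by (auto simp: inn_def flags_at_def)
    have fin_at: "finite (flags_at C V)" using finite_flags by (simp add: flags_at_def)
    have "(\<Sum>G\<in>flags_at C V. cross u (real_dir C G)) = 0"
      using balancing[of V] V S_sub by (auto simp: cross_sum[symmetric])
    then have "cross u (real_dir C F) + (\<Sum>G\<in>flags_at C V - {F}. cross u (real_dir C G)) = 0"
      using fin_at Ffl by (simp add: sum.remove)
    then have "(\<Sum>G\<in>flags_at C V - {F}. cross u (real_dir C G)) \<noteq> 0" using Fu by auto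
    then obtain G where "G \<in> flags_at C V - {F}" and G3: "cross u (real_dir C G) \<noteq> 0"
      by (rule sum.not_neutral_contains_not_neutral)
    then have G: "G \<in> flags_at C V" "G \<noteq> F" "cross u (real_dir C G) \<noteq> 0" by auto
    have "G \<in> {F \<in> flags C. vert C F \<in> S}" using G V by (auto simp: flags_at_def)
    then have "G \<in> inn \<union> (bnd \<union> ends)" unfolding split_flags .
    moreover have "G \<notin> ends" using u(2) G by auto
    moreover have "G \<notin> bnd"
    proof
      assume Gb: "G \<in> bnd"
      then have Gbd: "G \<in> bounded_flags C" by (simp add: bnd_def)
      have "h0 (vert C (opp C G)) = 0" using Gb h0_outside bounded_vert_in by (auto simp: bnd_def)
      then have "- (t *\<^sub>R u) = l0 (edge C G) *\<^sub>R real_dir C G"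
        using h0_diff[OF Gbd] G t by (simp add: flags_at_def)
      then have "cross u (- (t *\<^sub>R u)) = l0 (edge C G) * cross u (real_dir C G)" by (metis cross_simps(7))
      moreover have "l0 (edge C G) > 0"
        using \<open>h0 (vert C (opp C G)) = 0\<close> G V Gbd by (intro l0_pos) (auto simp: flags_at_def S_def)
      ultimately show False using G by simp
    qed
    ultimately have "{F, G} \<subseteq> {F \<in> inn. vert C F = V}" using F G by (auto simp: flags_at_def)
    moreover have "card {F, G} = 2" "finite {F \<in> inn. vert C F = V}" using G finite_parts by auto
    ultimately show ?thesis using card_mono by metis
  qed
  have "card inn = (\<Sum>V\<in>S. card {F \<in> inn. vert C F = V})"
  proof -
    have "card (\<Union>V\<in>S. {F \<in> inn. vert C F = V}) = (\<Sum>V\<in>S. card {F \<in> inn. vert C F = V})"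
      using finite_parts by (intro card_UN_disjoint) auto
    moreover have "(\<Union>V\<in>S. {F \<in> inn. vert C F = V}) = inn" by (auto simp: inn_def)
    ultimately show ?thesis by simp
  qed
  also have "\<dots> \<ge> (\<Sum>V\<in>S. 2)" by (rule sum_mono) (rule two)
  finally show False using inn_less card_inn by simp
qed

text \<open>The single vertex of \<open>S\<close> has at least two boundary edges and at least as
  many ends, all parallel to \<open>u\<close>. Valence \<open>4\<close> or more is compatible with
  the valence bound only if the cycle is flat, and only at one vertex of the graph.\<close>

lemma flat_vertex:
  obtains V where "V \<in> verts C" "flat Fs" "\<And>W. W \<in> verts C \<Longrightarrow> valence C W \<ge> 4 \<Longrightarrow> W = V"
    "\<And>F G. F \<in> flags_at C V \<Longrightarrow> G \<in> flags_at C V \<Longrightarrow> cross (real_dir C F) (real_dir C G) = 0"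
proof -
  obtain V where V: "S = {V}" using card_S_eq_1 by (auto simp: card_1_singleton_iff)
  then have Vv: "V \<in> verts C" using S_sub by auto
  obtain u where u: "u \<noteq> 0" "\<And>F. F \<in> ends \<Longrightarrow> real_dir C F = u"
    "\<And>V. V \<in> S \<Longrightarrow> \<exists>t. h0 V = t *\<^sub>R u" "card bnd \<le> card ends"
    using radial_picture by metis
  have inn0: "inn = {}" using no_loop V by (auto simp: inn_def)
  have at: "flags_at C V = bnd \<union> ends"
    using split_flags inn0 V by (auto simp: flags_at_def)
  have "card (bnd \<union> ends) = card bnd + card ends"
    using finite_parts flags_split by (intro card_Un_disjoint) (auto simp: bnd_def ends_def)
  then have val: "valence C V \<ge> 4" using at bnd_ge_2 u(4) by (simp add: valence_def)
  moreover have "valence C V \<le> 3 + of_bool (flat Fs)" using sum_valence_le[OF cyc, of "{V}"] Vv by simp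
  ultimately have flat: "flat Fs" by (cases "flat Fs") auto
  have uniq: "W = V" if W: "W \<in> verts C" "valence C W \<ge> 4" for W
  proof (rule ccontr)
    assume "W \<noteq> V"
    then show False using sum_valence_le[OF cyc, of "{V, W}"] W Vv val flat by simp
  qed
  have VS: "V \<in> S" using V by simp
  obtain t where t: "h0 V = t *\<^sub>R u" "t \<noteq> 0" using u(3)[OF VS] VS by (auto simp: S_def)
  have par: "cross u (real_dir C F) = 0" if F: "F \<in> flags_at C V" for F
  proof (cases "F \<in> ends")
    case False
    then have Fb: "F \<in> bnd" using F at by auto
    then have Fbd: "F \<in> bounded_flags C" by (simp add: bnd_def)
    have z: "h0 (vert C (opp C F)) = 0" using Fb h0_outside bounded_vert_in by (auto simp: bnd_def)
    then have "- (t *\<^sub>R u) = l0 (edge C F) *\<^sub>R real_dir C F"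
      using h0_diff[OF Fbd] F t by (simp add: flags_at_def)
    then have "cross u (- (t *\<^sub>R u)) = l0 (edge C F) * cross u (real_dir C F)" by (metis cross_simps(7))
    moreover have "l0 (edge C F) > 0"
      using z F V Fbd by (intro l0_pos) (auto simp: flags_at_def S_def)
    ultimately show ?thesis by simp
  qed (simp add: u)
  show ?thesis
    using that[OF Vv flat uniq] cross_transfer(1)[OF par par u(1)] by blast
qed

section \<open>Vanishing of the weight\<close>

lemma deficiency_1:
  assumes flat: "flat Fs"
  shows "deficiency C = 1"
proof -
  \<comment> \<open>\<open>cycle_image\<close> is defined through all simple cycles; by uniqueness
    of the cycle it only involves the edges of \<open>Fs\<close>.\<close>
  have ce: "cycle_edges C = edge C ` set Fs"
    by (rule cycle_edges_eq[OF _ cyc]) (simp add: card_edges)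
  let ?u = "real_dir C F0"
  have u0: "?u \<noteq> 0" using dir_nonzero[OF F0_bounded] by simp
  have vc: "cross ?u (hpos C (vert C F)) = cross ?u (hpos C (vert C F0))" if "F \<in> set Fs" for F
  proof (rule cycle_constant[OF cyc _ that F0(1)])
    fix G assume G: "G \<in> set Fs"
    have "cross ?u (hpos C (vert C (opp C G)) - hpos C (vert C G)) = 0"
      using compatible_self cycle_bounded[OF cyc G] flat G F0 by (simp add: compatible_def flat_def)
    then show "cross ?u (hpos C (vert C (opp C G))) = cross ?u (hpos C (vert C G))" by simp
  qed
  have img: "cross ?u x = cross ?u (hpos C (vert C F0))" if x: "x \<in> cycle_image C" for x
  proof -
    obtain F t where F: "F \<in> cycle_flags C" "x = hpos C (vert C F) + t *\<^sub>R real_dir C F"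
      using x by (auto simp: cycle_image_def edge_image_def)
    then obtain G where G: "G \<in> set Fs" "F = G \<or> F = opp C G"
      by (auto simp: cycle_flags_def ce edge_def)
    then have "cross ?u (real_dir C F) = 0"
      using flat F0 dir_opp[OF cycle_bounded[OF cyc G(1)]] by (auto simp: flat_def)
    moreover have "cross ?u (hpos C (vert C F)) = cross ?u (hpos C (vert C F0))"
      using G vc cycle_next[OF cyc G(1)] by auto
    ultimately show ?thesis using F(2) by simp
  qed
  have "collinear (cycle_image C)"
    unfolding collinear_def
  proof (intro exI[of _ ?u] ballI)
    fix x y assume "x \<in> cycle_image C" "y \<in> cycle_image C"
    then have "cross ?u (x - y) = 0" using img by simp
    then show "\<exists>c. x - y = c *\<^sub>R ?u" using cross_eq_0[OF _ u0] by blast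
  qed
  moreover have "\<not> (\<exists>q. cycle_image C = {q})"
  proof
    assume "\<exists>q. cycle_image C = {q}"
    then obtain q where q: "cycle_image C = {q}" by blast
    have "F0 \<in> cycle_flags C" using F0 by (auto simp: cycle_flags_def ce edge_def)
    then have sub: "edge_image C F0 \<subseteq> {q}" using q by (auto simp: cycle_image_def)
    have l: "len C (edge C F0) > 0" using len_pos[OF edge_in[OF F0_bounded]] .
    have "hpos C (vert C F0) + 0 *\<^sub>R ?u \<in> edge_image C F0"
      "hpos C (vert C F0) + len C (edge C F0) *\<^sub>R ?u \<in> edge_image C F0"
      using l unfolding edge_image_def by force+
    then have "hpos C (vert C F0) + 0 *\<^sub>R ?u = hpos C (vert C F0) + len C (edge C F0) *\<^sub>R ?u"
      using sub by blast
    then show False using l u0 by simp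
  qed
  ultimately show ?thesis by (simp add: deficiency_def genus1)
qed

text \<open>Data for a flat cycle at a \<open>4\<close>-valent vertex can only sit at
  \<open>V\<close>, where all directions are parallel. If there are no such data, the weight is zero
  by definition.\<close>

lemma weight_eq_0: "weight n C = 0"
proof -
  obtain V where V: "V \<in> verts C" "flat Fs" "\<And>W. W \<in> verts C \<Longrightarrow> valence C W \<ge> 4 \<Longrightarrow> W = V"
    and par: "\<And>F G. F \<in> flags_at C V \<Longrightarrow> G \<in> flags_at C V \<Longrightarrow> cross (real_dir C F) (real_dir C G) = 0"
    using flat_vertex by blast
  have z: "det2 u (dir C G) = 0" if data: "flat_cycle_data C W F F' G n' m' u" for W F F' G n' m' u
  proof -
    have W: "W = V" using data by (intro V(3)) (auto simp: flat_cycle_data_def)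
    then have "cross (real_dir C F) (real_dir C G) = 0" using data by (intro par) (auto simp: flat_cycle_data_def)
    then have "det2 (dir C F) (dir C G) = 0" unfolding cross_real_dir by simp
    moreover have "dir C F = zscale (int n') u" "n' \<ge> 1" using data by (auto simp: flat_cycle_data_def)
    moreover have "det2 (zscale (int n') u) (dir C G) = int n' * det2 u (dir C G)"
      by (simp add: det2_def zscale_def algebra_simps)
    ultimately show ?thesis by simp
  qed
  have "weight1 n C = 0"
  proof (cases "\<exists>V F F' G n' m' u. flat_cycle_data C V F F' G n' m' u")
    case True
    let ?P = "\<lambda>w. \<exists>V F F' G n' m' u. flat_cycle_data C V F F' G n' m' u \<and>
             w = (if n' \<noteq> m' \<or> marked_end_on_cycle n C
                  then real_of_int \<bar>det2 u (dir C G)\<bar>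
                  else real_of_int \<bar>det2 u (dir C G)\<bar> / 2)"
    \<comment> \<open>The weight is an arbitrarily chosen admissible value, and every admissible
      value is zero.\<close>
    have "?P (SOME w. ?P w)" by (rule someI_ex) (use True in blast)
    then have "(SOME w. ?P w) = 0" using z by fastforce
    then show ?thesis using True by (simp add: weight1_def)
  qed (simp add: weight1_def)
  then show ?thesis using deficiency_1[OF V(2)] genus1 by (simp add: weight_def)
qed

end

section \<open>Finiteness of the number of combinatorial types\<close>

lemma j_map_lin: "j_map T (\<lambda>e. a * l e + b * l' e) = a * j_map T l + b * j_map T l'"
  by (simp add: j_map_def sum.distrib sum_distrib_left)

context elliptic_curve
begin

text \<open>The bound concerns all data \<open>l\<close>, \<open>h\<close> of the type of
  \<open>C\<close>, while the multiplicity is that of \<open>C\<close> itself; thus one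
  representative with non-zero multiplicity controls its whole type.\<close>

lemma fixed_type_bounded:
  assumes n: "n \<ge> 1" and mult: "mult_evj n C \<noteq> 0"
  shows "\<exists>L. \<forall>l h. compatible C l h \<and> (\<forall>e\<in>bounded_edges C. l e > 0) \<and>
    (\<forall>i<n. h (vert C (mark C i)) = p i) \<longrightarrow> j_map C l \<le> L"
proof (rule ccontr)
  have det: "Determinant.det (evj_matrix n C (SOME bs. lattice_basis (stratum_lattice C) bs)) \<noteq> 0"
    and weight: "weight n C \<noteq> 0"
    using mult by (auto simp: mult_evj_def)
  note inject = ev_j_injective[OF graph conn span_stratum_eq mark_vert_in dim det]
  assume "\<not> ?thesis"
  then have ex: "\<exists>l h. compatible C l h \<and> (\<forall>e\<in>bounded_edges C. l e > 0) \<and>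
    (\<forall>i<n. h (vert C (mark C i)) = p i) \<and> j_map C l > L" for L
    by (meson not_le)
  obtain l1 h1 where 1: "compatible C l1 h1" "\<forall>e\<in>bounded_edges C. l1 e > 0"
    "\<forall>i<n. h1 (vert C (mark C i)) = p i" using ex[of 0] by blast
  obtain l2 h2 where 2: "compatible C l2 h2" "\<forall>e\<in>bounded_edges C. l2 e > 0"
    "\<forall>i<n. h2 (vert C (mark C i)) = p i" "j_map C l2 > j_map C l1" using ex[of "j_map C l1"] by blast
  define l0 where "l0 e = 1 * l2 e + (-1) * l1 e" for e
  define h0 where "h0 V = 1 *\<^sub>R h2 V + (-1) *\<^sub>R h1 V" for V
  have comp0: "compatible C l0 h0" unfolding l0_def[abs_def] h0_def[abs_def] by (rule compatible_lin) fact+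
  have marks0: "h0 (vert C (mark C i)) = 0" if "i < n" for i using 1 2 that by (simp add: h0_def)
  have "j_map C l0 = 1 * j_map C l2 + (-1) * j_map C l1" unfolding l0_def[abs_def] by (rule j_map_lin)
  then have j0: "j_map C l0 > 0" using 2 by simp
  \<comment> \<open>Subtracting the multiple of the recession direction with the same value of
    \<open>j\<close> leaves a datum in the kernel of ev x j, which is trivial.\<close>
  have line: "e \<in> bounded_edges C \<Longrightarrow> l e = (j_map C l / j_map C l0) * l0 e"
    "V \<in> verts C \<Longrightarrow> h V = (j_map C l / j_map C l0) *\<^sub>R h0 V"
    if lh: "compatible C l h" "\<And>i. i < n \<Longrightarrow> h (vert C (mark C i)) = 0" for l h e V
  proof -
    let ?c = "j_map C l / j_map C l0"
    have comp: "compatible C (\<lambda>e. 1 * l e + (- ?c) * l0 e) (\<lambda>V. 1 *\<^sub>R h V + (- ?c) *\<^sub>R h0 V)"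
      by (rule compatible_lin[OF lh(1) comp0])
    have m: "1 *\<^sub>R h (vert C (mark C i)) + (- ?c) *\<^sub>R h0 (vert C (mark C i)) = 0" if "i < n" for i
      using lh(2)[OF that] marks0[OF that] by simp
    have j: "j_map C (\<lambda>e. 1 * l e + (- ?c) * l0 e) = 0"
      unfolding j_map_lin using j0 by simp
    show "e \<in> bounded_edges C \<Longrightarrow> l e = ?c * l0 e" using inject(2)[OF _ comp m j] by simp
    show "V \<in> verts C \<Longrightarrow> h V = ?c *\<^sub>R h0 V" using inject(1)[OF _ comp m j] by simp
  qed
  have nonneg: "l0 e \<ge> 0" if e: "e \<in> bounded_edges C" for e
  proof (rule ccontr)
    assume neg: "\<not> l0 e \<ge> 0"
    \<comment> \<open>The constant is the value of \<open>j\<close> at which the edge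
      \<open>e\<close>, shrinking along the line through \<open>l1\<close> in direction
      \<open>l0\<close>, has length zero. A curve on this line beyond that value would have a
      negative length.\<close>
    obtain l3 h3 where 3: "compatible C l3 h3" "\<forall>e\<in>bounded_edges C. l3 e > 0"
      "\<forall>i<n. h3 (vert C (mark C i)) = p i"
      "j_map C l3 > j_map C l1 + j_map C l0 * (l1 e / (- l0 e))"
      using ex[of "j_map C l1 + j_map C l0 * (l1 e / (- l0 e))"] by blast
    have comp: "compatible C (\<lambda>e. 1 * l3 e + (-1) * l1 e) (\<lambda>V. 1 *\<^sub>R h3 V + (-1) *\<^sub>R h1 V)"
      by (rule compatible_lin) fact+
    define c where "c = j_map C (\<lambda>e. 1 * l3 e + (-1) * l1 e) / j_map C l0"
    have "1 * l3 e + (-1) * l1 e = c * l0 e"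
      unfolding c_def by (rule line(1)[OF comp _ e]) (use 1 3 in simp)
    moreover have "c > l1 e / (- l0 e)"
      unfolding c_def j_map_lin using 3(4) j0 by (simp add: less_divide_eq algebra_simps)
    then have "c * l0 e < (l1 e / (- l0 e)) * l0 e" using neg by (intro mult_strict_right_mono_neg) auto
    moreover have "(l1 e / (- l0 e)) * l0 e = - l1 e" using neg by simp
    ultimately show False using 3(2) e by auto
  qed
  have "\<exists>e\<in>cycle_edges C. l0 e > 0"
  proof (rule ccontr)
    assume "\<not> ?thesis"
    then have "(\<Sum>e\<in>cycle_edges C. l0 e) \<le> 0" by (intro sum_nonpos) auto
    then show False using j0 genus1 by (simp add: j_map_def)
  qed
  then obtain F0 Fs where F0: "simple_cycle C Fs" "F0 \<in> set Fs" "l0 (edge C F0) > 0"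
    by (auto simp: cycle_edges_def)
  interpret recession C n d l0 h0 Fs F0
  proof unfold_locales
    fix l h assume "compatible C l h" "\<And>i. i < n \<Longrightarrow> h (vert C (mark C i)) = 0"
    from line(2)[OF this] show "\<exists>c. \<forall>V\<in>verts C. h V = c *\<^sub>R h0 V" by blast
  qed (use comp0 marks0 nonneg F0 n in auto)
  show False using weight weight_eq_0 by simp
qed

section \<open>A priori bounds on the directions and the size of a type\<close>

lemma end_real_dir:
  assumes "F \<in> end_flags C"
  shows "\<bar>fst (real_dir C F)\<bar> \<le> 1" "\<bar>snd (real_dir C F)\<bar> \<le> 1"
proof -
  have "dir C F \<in> {(0, 0), (-1, 0), (0, -1), (1, 1)}"
  proof (cases "F \<in> marked_flags n C")
    case True
    then have "dir C F = 0" using curve by (auto simp: plane_curve_def plane_type_def)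
    then show ?thesis by (simp add: zero_prod_def)
  next
    case False
    then show ?thesis using end_dir[OF assms] by (auto simp: marked_flags_def)
  qed
  then show "\<bar>fst (real_dir C F)\<bar> \<le> 1" "\<bar>snd (real_dir C F)\<bar> \<le> 1" by (auto simp: real_dir_def)
qed

text \<open>The flux through a half plane is bounded by the ends in it, and all edges crossing its boundary contribute with the same sign.\<close>

lemma cross_dir_le:
  assumes ends: "\<And>F. F \<in> end_flags C \<Longrightarrow> cross a (real_dir C F) \<ge> - 1" and F: "F \<in> bounded_flags C"
  shows "cross a (real_dir C F) \<le> real (3 * d + n)"
proof (cases "cross a (real_dir C F) > 0")
  case True
  define A where "A = {V \<in> verts C. cross a (hpos C V) \<le> cross a (hpos C (vert C F))}"
  define B where "B = {G. G \<in> bounded_flags C \<and> vert C G \<in> A \<and> vert C (opp C G) \<notin> A}"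
  define E where "E = {G. G \<in> end_flags C \<and> vert C G \<in> A}"
  have fin_ends: "finite (end_flags C)" using finite_flags by (simp add: end_flags_def)
  have fin: "finite B" using finite_bounded_flags by (simp add: B_def)
  have step: "cross a (hpos C (vert C (opp C G))) = cross a (hpos C (vert C G)) + len C (edge C G) * cross a (real_dir C G)"
    if "G \<in> bounded_flags C" for G
    using compatible_self that by (simp add: compatible_def)
  have pos: "cross a (real_dir C G) \<ge> 0" if "G \<in> B" for G
  proof -
    have G: "G \<in> bounded_flags C" using that by (simp add: B_def)
    have "cross a (hpos C (vert C (opp C G))) > cross a (hpos C (vert C G))"
      using that bounded_vert_in[OF G] by (auto simp: A_def B_def)
    then have "len C (edge C G) * cross a (real_dir C G) > 0" using step[OF G] by simp
    then show ?thesis using len_pos[OF edge_in[OF G]] zero_less_mult_pos less_imp_le by blast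
  qed
  have "len C (edge C F) * cross a (real_dir C F) > 0"
    using len_pos[OF edge_in[OF F]] True by (rule mult_pos_pos)
  then have "F \<in> B" using F step[OF F] bounded_vert_in[OF F] by (simp add: A_def B_def)
  then have "cross a (real_dir C F) \<le> (\<Sum>G\<in>B. cross a (real_dir C G))"
    using fin pos by (intro member_le_sum) auto
  also have "\<dots> = - (\<Sum>G\<in>E. cross a (real_dir C G))"
  proof -
    have "A \<subseteq> verts C" by (auto simp: A_def)
    from flux[OF this, of a] show ?thesis unfolding B_def E_def by linarith
  qed
  also have "\<dots> \<le> (\<Sum>G\<in>E. 1)"
    unfolding sum_negf[symmetric]
  proof (rule sum_mono)
    fix G assume "G \<in> E"
    then show "- cross a (real_dir C G) \<le> 1" using ends[of G] by (simp add: E_def)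
  qed
  also have "\<dots> \<le> real (card (end_flags C))"
  proof -
    have "card E \<le> card (end_flags C)" by (rule card_mono[OF fin_ends]) (auto simp: E_def)
    then show ?thesis by simp
  qed
  finally show ?thesis by (simp only: card_end_flags)
qed simp

lemma dir_bound:
  assumes "F \<in> flags C"
  shows "\<bar>fst (dir C F)\<bar> \<le> int (3 * d + n)" "\<bar>snd (dir C F)\<bar> \<le> int (3 * d + n)"
proof -
  have "\<bar>fst (real_dir C F)\<bar> \<le> real (3 * d + n) \<and> \<bar>snd (real_dir C F)\<bar> \<le> real (3 * d + n)"
  proof (cases "F \<in> bounded_flags C")
    case True
    have "cross a (real_dir C F) \<le> real (3 * d + n)" if "a \<in> {(0, 1), (0, -1), (1, 0), (-1, 0)}" for a
    proof (rule cross_dir_le[OF _ True])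
      fix G assume "G \<in> end_flags C"
      from end_real_dir[OF this] show "cross a (real_dir C G) \<ge> - 1"
        using that by (auto simp: cross_def)
    qed
    from this[of "(0, 1)"] this[of "(0, -1)"] this[of "(1, 0)"] this[of "(-1, 0)"]
    show ?thesis by (auto simp: cross_def)
  next
    case False
    then have "F \<in> end_flags C" using assms flags_split by auto
    from end_real_dir[OF this] show ?thesis using degree by linarith
  qed
  then have "real_of_int \<bar>fst (dir C F)\<bar> \<le> real_of_int (int (3 * d + n))"
    "real_of_int \<bar>snd (dir C F)\<bar> \<le> real_of_int (int (3 * d + n))"
    by (simp_all add: real_dir_def)
  then show "\<bar>fst (dir C F)\<bar> \<le> int (3 * d + n)" "\<bar>snd (dir C F)\<bar> \<le> int (3 * d + n)"
    by (simp_all only: of_int_le_iff)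
qed

text \<open>There are at least three flags per vertex, and exactly
  \<open>2 * card (verts C) + 3 * d + n\<close> flags in total.\<close>

lemma card_bounds: "card (verts C) \<le> 3 * d + n" "card (flags C) \<le> 3 * (3 * d + n)"
proof -
  have "(\<Sum>V\<in>verts C. 3) \<le> (\<Sum>V\<in>verts C. valence C V)" by (rule sum_mono) (rule valence_ge_3)
  also have "\<dots> \<le> card (flags C)"
    unfolding sum_valence[OF subset_refl] by (rule card_mono[OF finite_flags]) auto
  finally show "card (verts C) \<le> 3 * d + n" "card (flags C) \<le> 3 * (3 * d + n)"
    using card_flags card_edges by simp_all
qed

end

section \<open>Isomorphisms of types and the transport of lengths, positions and cycles\<close>

definition type_iso :: "nat \<Rightarrow> 'a ctype_scheme \<Rightarrow> 'b ctype_scheme \<Rightarrow> (nat \<Rightarrow> nat) \<Rightarrow> (nat \<Rightarrow> nat) \<Rightarrow> bool" where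
  "type_iso n T T' a b \<longleftrightarrow> bij_betw a (flags T) (flags T') \<and> bij_betw b (verts T) (verts T') \<and>
     (\<forall>F\<in>flags T. vert T' (a F) = b (vert T F) \<and> opp T' (a F) = a (opp T F) \<and> dir T' (a F) = dir T F) \<and>
     (\<forall>i<n. mark T' i = a (mark T i))"

lemma type_isoD:
  assumes "type_iso n T T' a b"
  shows "bij_betw a (flags T) (flags T')" "bij_betw b (verts T) (verts T')"
    "F \<in> flags T \<Longrightarrow> vert T' (a F) = b (vert T F)" "F \<in> flags T \<Longrightarrow> opp T' (a F) = a (opp T F)"
    "F \<in> flags T \<Longrightarrow> dir T' (a F) = dir T F" "i < n \<Longrightarrow> mark T' i = a (mark T i)"
  using assms by (auto simp: type_iso_def)

context
  fixes T :: "'a ctype_scheme" and T' :: "'b ctype_scheme" and n a b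
  assumes T: "is_graph T" and iso: "type_iso n T T' a b"
begin

interpretation graph_type T using T by unfold_locales

lemma iso_inj: "F \<in> flags T \<Longrightarrow> G \<in> flags T \<Longrightarrow> a F = a G \<longleftrightarrow> F = G"
  using type_isoD(1)[OF iso] by (auto simp: bij_betw_def inj_on_def)

lemma iso_bounded: "F \<in> flags T \<Longrightarrow> a F \<in> bounded_flags T' \<longleftrightarrow> F \<in> bounded_flags T"
  using type_isoD(1)[OF iso] type_isoD(4)[OF iso] iso_inj opp_in
  by (auto simp: bounded_flags_def bij_betw_def)

lemma iso_edge: "F \<in> flags T \<Longrightarrow> edge T' (a F) = a ` edge T F"
  using type_isoD(4)[OF iso] by (simp add: edge_def)

lemma iso_compatible:
  assumes "compatible T' l h"
  shows "compatible T (\<lambda>e. l (a ` e)) (h \<circ> b)"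
  unfolding compatible_def
proof
  fix F assume F: "F \<in> bounded_flags T"
  then have Ff: "F \<in> flags T" "opp T F \<in> flags T" using bounded_subset opp_in by auto
  then have "a F \<in> bounded_flags T'" using iso_bounded F by simp
  then have "h (vert T' (opp T' (a F))) = h (vert T' (a F)) + l (edge T' (a F)) *\<^sub>R real_dir T' (a F)"
    using assms by (simp add: compatible_def)
  then show "(h \<circ> b) (vert T (opp T F)) = (h \<circ> b) (vert T F) + l (a ` edge T F) *\<^sub>R real_dir T F"
    using type_isoD(3-5)[OF iso] Ff by (simp add: iso_edge real_dir_def)
qed

text \<open>The equivalence is stated for arbitrary lists of flags, since cycles have to be carried
  along \<open>a\<close> in both directions.\<close>

lemma iso_simple_cycle:
  assumes sub: "set Fs \<subseteq> flags T"
  shows "simple_cycle T' (map a Fs) \<longleftrightarrow> simple_cycle T Fs"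
proof -
  have set_eq: "set (map a Fs) \<subseteq> bounded_flags T' \<longleftrightarrow> set Fs \<subseteq> bounded_flags T"
    using sub iso_bounded by auto
  have verts_eq: "map (vert T') (map a Fs) = map b (map (vert T) Fs)"
    using sub type_isoD(3)[OF iso] by auto
  have dist_verts: "distinct (map b (map (vert T) Fs)) \<longleftrightarrow> distinct (map (vert T) Fs)"
  proof -
    have "inj_on b (set (map (vert T) Fs))"
      using type_isoD(2)[OF iso] sub vert_in by (auto simp: bij_betw_def intro: inj_on_subset)
    then show ?thesis by (metis distinct_map)
  qed
  have edges_eq: "map (edge T') (map a Fs) = map (image a) (map (edge T) Fs)"
    using sub iso_edge by auto
  have dist_edges: "distinct (map (image a) (map (edge T) Fs)) \<longleftrightarrow> distinct (map (edge T) Fs)"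
  proof -
    have "inj_on (image a) (Pow (flags T))"
      using type_isoD(1)[OF iso] by (simp add: bij_betw_def inj_on_image_Pow)
    then have "inj_on (image a) (set (map (edge T) Fs))"
      by (rule inj_on_subset) (use sub opp_in in \<open>auto simp: edge_def\<close>)
    then show ?thesis by (metis distinct_map)
  qed
  have next_eq: "vert T' (opp T' (map a Fs ! i)) = vert T' (map a Fs ! (Suc i mod length (map a Fs))) \<longleftrightarrow>
    vert T (opp T (Fs ! i)) = vert T (Fs ! (Suc i mod length Fs))" if i: "i < length Fs" for i
  proof -
    have k: "Suc i mod length Fs < length Fs" using i by (intro mod_less_divisor) auto
    have m: "Fs ! i \<in> flags T" "Fs ! (Suc i mod length Fs) \<in> flags T"
      using sub nth_mem[OF i] nth_mem[OF k] by auto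
    have "inj_on b (verts T)" using type_isoD(2)[OF iso] by (simp add: bij_betw_def)
    then have "b (vert T (opp T (Fs ! i))) = b (vert T (Fs ! (Suc i mod length Fs))) \<longleftrightarrow>
      vert T (opp T (Fs ! i)) = vert T (Fs ! (Suc i mod length Fs))"
      using m opp_in vert_in by (auto dest: inj_onD)
    then show ?thesis using i k m opp_in type_isoD(3,4)[OF iso] by simp
  qed
  show ?thesis
    unfolding simple_cycle_def verts_eq dist_verts edges_eq dist_edges using set_eq next_eq by auto
qed

lemma iso_cycle_edges: "cycle_edges T' = image a ` cycle_edges T"
proof
  show "cycle_edges T' \<subseteq> image a ` cycle_edges T"
  proof
    fix e assume "e \<in> cycle_edges T'"
    then obtain G Gs where G: "e = edge T' G" "simple_cycle T' Gs" "G \<in> set Gs"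
      by (auto simp: cycle_edges_def)
    define Fs where "Fs = map (inv_into (flags T) a) Gs"
    have Gsub: "set Gs \<subseteq> a ` flags T"
      using G(2) type_isoD(1)[OF iso] by (auto simp: simple_cycle_def bounded_flags_def bij_betw_def)
    have sub: "set Fs \<subseteq> flags T" using Gsub by (auto simp: Fs_def inv_into_into)
    have "map a Fs = Gs"
      unfolding Fs_def map_map by (rule map_idI) (use Gsub in \<open>auto simp: f_inv_into_f\<close>)
    then have "simple_cycle T Fs" using iso_simple_cycle[OF sub] G(2) by simp
    moreover obtain F where "F \<in> set Fs" "G = a F" using G(3) \<open>map a Fs = Gs\<close> by auto
    ultimately have "edge T F \<in> cycle_edges T" "e = a ` edge T F"
      using G(1) sub iso_edge by (auto simp: cycle_edges_def)
    then show "e \<in> image a ` cycle_edges T" by blast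
  qed
  show "image a ` cycle_edges T \<subseteq> cycle_edges T'"
  proof
    fix e assume "e \<in> image a ` cycle_edges T"
    then obtain F Fs where F: "e = a ` edge T F" "simple_cycle T Fs" "F \<in> set Fs"
      by (auto simp: cycle_edges_def)
    have sub: "set Fs \<subseteq> flags T" using F(2) bounded_subset by (auto simp: simple_cycle_def)
    then have "simple_cycle T' (map a Fs)" using iso_simple_cycle F(2) by simp
    moreover have "e = edge T' (a F)" using F sub iso_edge by auto
    moreover have "a F \<in> set (map a Fs)" using F by simp
    ultimately show "e \<in> cycle_edges T'" unfolding cycle_edges_def by blast
  qed
qed

lemma iso_j_map: "genus T = genus T' \<Longrightarrow> j_map T (\<lambda>e. l (a ` e)) = j_map T' l"
proof -
  have "inj_on (image a) (Pow (flags T))"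
    using type_isoD(1)[OF iso] by (simp add: bij_betw_def inj_on_image_Pow)
  then have "inj_on (image a) (cycle_edges T)"
    by (rule inj_on_subset)
      (use bounded_subset opp_in in \<open>auto simp: cycle_edges_def simple_cycle_def edge_def\<close>)
  then show "genus T = genus T' \<Longrightarrow> j_map T (\<lambda>e. l (a ` e)) = j_map T' l"
    by (simp add: j_map_def iso_cycle_edges sum.reindex)
qed

end

section \<open>Codes of combinatorial types\<close>

definition index_in :: "nat list \<Rightarrow> nat \<Rightarrow> nat" where
  "index_in xs x = (SOME i. i < length xs \<and> xs ! i = x)"

lemma index_in: "x \<in> set xs \<Longrightarrow> index_in xs x < length xs" "x \<in> set xs \<Longrightarrow> xs ! index_in xs x = x"
proof -
  have *: "\<exists>i. i < length xs \<and> xs ! i = x" if "x \<in> set xs" using that by (metis in_set_conv_nth)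
  show "x \<in> set xs \<Longrightarrow> index_in xs x < length xs" "x \<in> set xs \<Longrightarrow> xs ! index_in xs x = x"
    using someI_ex[OF *] by (auto simp: index_in_def)
qed

lemma index_in_nth: "distinct xs \<Longrightarrow> i < length xs \<Longrightarrow> index_in xs (xs ! i) = i"
  using index_in[of "xs ! i" xs] by (simp add: nth_eq_iff_index_eq)

lemma index_in_bij:
  fixes xs ys :: "nat list"
  assumes "distinct xs" "distinct ys" "length xs = length ys"
  shows "bij_betw (\<lambda>x. ys ! index_in xs x) (set xs) (set ys)"
proof (rule bij_betwI[where g = "\<lambda>y. xs ! index_in ys y"])
  show "(\<lambda>x. ys ! index_in xs x) \<in> set xs \<rightarrow> set ys"
    by (intro Pi_I nth_mem) (use index_in(1) assms(3) in metis)
  show "(\<lambda>y. xs ! index_in ys y) \<in> set ys \<rightarrow> set xs"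
    by (intro Pi_I nth_mem) (use index_in(1) assms(3) in metis)
  show "xs ! index_in ys (ys ! index_in xs x) = x" if "x \<in> set xs" for x
    using that index_in[OF that] index_in_nth assms by simp
  show "ys ! index_in xs (xs ! index_in ys y) = y" if "y \<in> set ys" for y
    using that index_in[OF that] index_in_nth assms by simp
qed

text \<open>Vertices and flags are renamed by their ranks in increasing order, which removes the
  arbitrary choice of names. Isomorphic types may still have different codes; what matters is that
  equal codes give isomorphic types.\<close>

definition type_code :: "nat \<Rightarrow> 'a ctype_scheme \<Rightarrow> nat \<times> (nat \<times> nat \<times> int \<times> int) list \<times> nat list" where
  "type_code n T = (let fs = sorted_list_of_set (flags T); vs = sorted_list_of_set (verts T) in
     (length vs,
      map (\<lambda>F. (index_in vs (vert T F), index_in fs (opp T F), dir T F)) fs,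
      map (\<lambda>i. index_in fs (mark T i)) [0..<n]))"

text \<open>The isomorphism matches flags of equal rank and vertices of equal rank.\<close>

lemma code_eq_imp_iso:
  assumes T: "is_graph T" "marked_flags n T \<subseteq> flags T" and T': "is_graph T'" "marked_flags n T' \<subseteq> flags T'"
    and code: "type_code n T = type_code n T'"
  shows "\<exists>a b. type_iso n T T' a b"
proof -
  interpret T: graph_type T by unfold_locales fact
  interpret T': graph_type T' by unfold_locales fact
  define fs where "fs = sorted_list_of_set (flags T)"
  define vs where "vs = sorted_list_of_set (verts T)"
  define fs' where "fs' = sorted_list_of_set (flags T')"
  define vs' where "vs' = sorted_list_of_set (verts T')"
  have set: "set fs = flags T" "set vs = verts T" "set fs' = flags T'" "set vs' = verts T'"
    using T.finite_flags T.finite_verts T'.finite_flags T'.finite_verts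
    by (simp_all add: fs_def vs_def fs'_def vs'_def)
  have dist: "distinct fs" "distinct vs" "distinct fs'" "distinct vs'"
    by (simp_all add: fs_def vs_def fs'_def vs'_def)
  have c1: "length vs = length vs'"
    and c2: "map (\<lambda>F. (index_in vs (vert T F), index_in fs (opp T F), dir T F)) fs
      = map (\<lambda>F. (index_in vs' (vert T' F), index_in fs' (opp T' F), dir T' F)) fs'"
    and c3: "map (\<lambda>i. index_in fs (mark T i)) [0..<n] = map (\<lambda>i. index_in fs' (mark T' i)) [0..<n]"
    using code by (simp_all add: type_code_def Let_def fs_def vs_def fs'_def vs'_def)
  have len: "length fs = length fs'" using arg_cong[OF c2, of length] by simp
  define a where "a F = fs' ! index_in fs F" for F
  define b where "b V = vs' ! index_in vs V" for V
  have "vert T' (a F) = b (vert T F) \<and> opp T' (a F) = a (opp T F) \<and> dir T' (a F) = dir T F"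
    if F: "F \<in> flags T" for F
  proof -
    let ?i = "index_in fs F"
    have i: "?i < length fs" "fs ! ?i = F" using index_in[of F fs] F set by auto
    have aF: "a F \<in> flags T'" using i len set(3) nth_mem[of ?i fs'] by (simp add: a_def)
    have "map (\<lambda>F. (index_in vs (vert T F), index_in fs (opp T F), dir T F)) fs ! ?i
      = map (\<lambda>F. (index_in vs' (vert T' F), index_in fs' (opp T' F), dir T' F)) fs' ! ?i"
      using c2 by simp
    then have eq: "index_in vs (vert T F) = index_in vs' (vert T' (a F))" "index_in fs (opp T F) = index_in fs' (opp T' (a F))"
      "dir T F = dir T' (a F)"
      using i len by (simp_all add: a_def prod_eq_iff)
    have "vert T' (a F) = vs' ! index_in vs' (vert T' (a F))" using index_in(2) set T'.vert_in[OF aF] by simp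
    moreover have "opp T' (a F) = fs' ! index_in fs' (opp T' (a F))" using index_in(2) set T'.opp_in[OF aF] by simp
    ultimately show ?thesis using eq by (simp add: a_def b_def)
  qed
  moreover have "mark T' i = a (mark T i)" if i: "i < n" for i
  proof -
    have "map (\<lambda>i. index_in fs (mark T i)) [0..<n] ! i = map (\<lambda>i. index_in fs' (mark T' i)) [0..<n] ! i" by (simp only: c3)
    then have "index_in fs (mark T i) = index_in fs' (mark T' i)" using i by simp
    moreover have "mark T' i \<in> flags T'" using T'(2) i by (auto simp: marked_flags_def)
    then have "mark T' i = fs' ! index_in fs' (mark T' i)" using index_in(2) set by simp
    ultimately show ?thesis by (simp add: a_def)
  qed
  moreover have "bij_betw a (flags T) (flags T')"
    using index_in_bij[OF dist(1,3) len] unfolding set a_def[abs_def] .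
  moreover have "bij_betw b (verts T) (verts T')"
    using index_in_bij[OF dist(2,4) c1] unfolding set b_def[abs_def] .
  ultimately have "type_iso n T T' a b" by (simp add: type_iso_def)
  then show ?thesis by blast
qed

lemma finite_codes: "finite {type_code n C | C. elliptic_curve C n d}"
proof -
  \<comment> \<open>This bound on the number of flags also dominates the number of vertices and the
    entries of all directions.\<close>
  define K where "K = 3 * (3 * d + n)"
  let ?L = "{xs. set xs \<subseteq> {..K} \<times> {..K} \<times> {- int K..int K} \<times> {- int K..int K} \<and> length xs \<le> K}"
  let ?M = "{xs. set xs \<subseteq> {..K} \<and> length xs \<le> K} :: nat list set"
  have "{type_code n C | C. elliptic_curve C n d} \<subseteq> {..K} \<times> ?L \<times> ?M"
  proof
    fix t assume "t \<in> {type_code n C | C. elliptic_curve C n d}"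
    then obtain C where t: "t = type_code n C" and "elliptic_curve C n d" by blast
    then interpret elliptic_curve C n d by simp
    let ?fs = "sorted_list_of_set (flags C)" and ?vs = "sorted_list_of_set (verts C)"
    have set: "set ?fs = flags C" "set ?vs = verts C" using finite_flags finite_verts by simp_all
    have len: "length ?fs \<le> K" "length ?vs \<le> K" using card_bounds by (simp_all add: K_def)
    have pf: "index_in ?fs F \<le> K" if "F \<in> flags C" for F
      using index_in(1)[of F ?fs] that set len by simp
    have pv: "index_in ?vs V \<le> K" if "V \<in> verts C" for V
      using index_in(1)[of V ?vs] that set len by simp
    have "(index_in ?vs (vert C F), index_in ?fs (opp C F), dir C F)
      \<in> {..K} \<times> {..K} \<times> {- int K..int K} \<times> {- int K..int K}" if F: "F \<in> flags C" for F
    proof -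
      have "dir C F \<in> {- int K..int K} \<times> {- int K..int K}"
        using dir_bound[OF F] by (auto simp: K_def mem_Times_iff)
      then show ?thesis using pv[OF vert_in[OF F]] pf[OF opp_in[OF F]] by simp
    qed
    then have "map (\<lambda>F. (index_in ?vs (vert C F), index_in ?fs (opp C F), dir C F)) ?fs \<in> ?L"
      using len by (simp add: set image_subset_iff)
    moreover have "map (\<lambda>i. index_in ?fs (mark C i)) [0..<n] \<in> ?M"
      using marked_end pf by (auto simp: end_flags_def K_def)
    ultimately show "t \<in> {..K} \<times> ?L \<times> ?M"
      unfolding t type_code_def Let_def using len by simp
  qed
  moreover have "finite ({..K} \<times> ?L \<times> ?M)"
    by (intro finite_cartesian_product finite_lists_length_le) auto
  ultimately show ?thesis by (rule finite_subset)
qed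

section \<open>The bound on \<open>j\<close> for all types at once\<close>

theorem proposition6p1:
  fixes d n :: nat and p :: "nat \<Rightarrow> real \<times> real"
  assumes "d \<ge> 1" and "n = 3 * d - 1"
  shows "\<exists>L. \<forall>l\<ge>0. l > L \<and> evj_general n d p l \<longrightarrow>
           (\<forall>C\<in>fibre n d p l. mult_evj n C \<noteq> 0 \<longrightarrow> has_contracted_bounded_edge C)"
proof -
  \<comment> \<open>\<open>K\<close> involves neither the points nor \<open>l\<close>. Non-zero
    multiplicity is part of its definition, so that the representative chosen for a code has it as
    well, without comparing multiplicities of isomorphic types.\<close>
  define K where "K = {C. elliptic_curve C n d \<and> mult_evj n C \<noteq> 0}"
  define rep where "rep c = (SOME C. C \<in> K \<and> type_code n C = c)" for c
  have rep: "rep (type_code n C) \<in> K \<and> type_code n (rep (type_code n C)) = type_code n C" if "C \<in> K" for C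
    unfolding rep_def by (rule someI_ex) (use that in auto)
  have fin: "finite (type_code n ` K)"
    by (rule finite_subset[OF _ finite_codes[of n d]]) (auto simp: K_def)
  have n: "n \<ge> 1" using assms by simp
  have "\<forall>D\<in>K. \<exists>L. \<forall>l h. compatible D l h \<and> (\<forall>e\<in>bounded_edges D. l e > 0) \<and>
    (\<forall>i<n. h (vert D (mark D i)) = p i) \<longrightarrow> j_map D l \<le> L"
  proof
    fix D assume "D \<in> K"
    then show "\<exists>L. \<forall>l h. compatible D l h \<and> (\<forall>e\<in>bounded_edges D. l e > 0) \<and>
      (\<forall>i<n. h (vert D (mark D i)) = p i) \<longrightarrow> j_map D l \<le> L"
      by (intro elliptic_curve.fixed_type_bounded[OF _ n]) (auto simp: K_def)
  qed
  from bchoice[OF this] obtain B where "\<forall>D\<in>K. \<forall>l h. compatible D l h \<and> (\<forall>e\<in>bounded_edges D. l e > 0) \<and>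
    (\<forall>i<n. h (vert D (mark D i)) = p i) \<longrightarrow> j_map D l \<le> B D" ..
  then have B: "j_map D l \<le> B D" if "D \<in> K" "compatible D l h" "\<forall>e\<in>bounded_edges D. l e > 0"
    "\<forall>i<n. h (vert D (mark D i)) = p i" for D l h
    using that by blast
  \<comment> \<open>A common upper bound for the representatives of the finitely many codes,
    meaningful also if \<open>K\<close> is empty.\<close>
  define L where "L = (\<Sum>c\<in>type_code n ` K. \<bar>B (rep c)\<bar>)"
  show ?thesis
  proof (intro exI[of _ L] allI impI ballI; rule ccontr)
    fix l C
    assume l: "l > L \<and> evj_general n d p l" and C: "C \<in> fibre n d p l" and mult: "mult_evj n C \<noteq> 0"
      and nc: "\<not> has_contracted_bounded_edge C"
    \<comment> \<open>This excludes rational curves, whose weight is zero by definition.\<close>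
    have "weight n C \<noteq> 0" using mult by (simp add: mult_evj_def)
    then have "genus C = 1" by (auto simp: weight_def split: if_splits)
    \<comment> \<open>General position enters here: \<open>6 * d - 1\<close> equals
      \<open>2 * n + 1\<close>.\<close>
    moreover have "stratum_dim C = 2 * n + 1"
      using l C assms by (auto simp: evj_general_def)
    moreover have "plane_curve n d C" using C by (auto simp: fibre_def M'_trop_def M_trop_def)
    ultimately interpret C: elliptic_curve C n d using nc assms by unfold_locales auto
    have CK: "C \<in> K" using mult C.elliptic_curve_axioms by (simp add: K_def)
    define D where "D = rep (type_code n C)"
    have D: "D \<in> K" "type_code n D = type_code n C" using rep[OF CK] by (auto simp: D_def)
    interpret D: elliptic_curve D n d using D by (simp add: K_def)
    have mf: "marked_flags n C \<subseteq> flags C" "marked_flags n D \<subseteq> flags D"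
      using C.marked_end D.marked_end by (auto simp: marked_flags_def end_flags_def)
    obtain a b where iso: "type_iso n D C a b"
      using code_eq_imp_iso[OF D.graph mf(2) C.graph mf(1) D(2)] by blast
    \<comment> \<open>Lengths and positions of \<open>C\<close> are pulled back along the
      isomorphism to a datum of the type of \<open>D\<close> through the same points, to which the
      bound for \<open>D\<close> applies.\<close>
    have "j_map D (\<lambda>e. len C (a ` e)) \<le> B D"
    proof (rule B[OF D(1) iso_compatible[OF D.graph iso C.compatible_self]])
      show "\<forall>e\<in>bounded_edges D. len C (a ` e) > 0"
      proof
        fix e assume "e \<in> bounded_edges D"
        then obtain F where F: "F \<in> bounded_flags D" "e = edge D F" by (auto simp: bounded_edges_def)
        then have Ff: "F \<in> flags D" using D.bounded_subset by blast
        then show "len C (a ` e) > 0"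
          using C.len_pos[OF C.edge_in, of "a F"] iso_bounded[OF D.graph iso Ff] F
          by (simp add: iso_edge[OF D.graph iso Ff])
      qed
      show "\<forall>i<n. (hpos C \<circ> b) (vert D (mark D i)) = p i"
      proof (intro allI impI)
        fix i assume i: "i < n"
        have "mark D i \<in> flags D" using D.marked_end[OF i] by (simp add: end_flags_def)
        then have "vert C (mark C i) = b (vert D (mark D i))"
          using type_isoD(3,6)[OF iso] i by simp
        moreover have "ev C i = p i" using C i by (simp add: fibre_def)
        ultimately show "(hpos C \<circ> b) (vert D (mark D i)) = p i" by (simp add: ev_def ev_map_def)
      qed
    qed
    then have "j_map C (len C) \<le> B D"
      using iso_j_map[OF D.graph iso, of "len C"] C.genus1 D.genus1 by simp
    also have "\<dots> \<le> \<bar>B (rep (type_code n C))\<bar>" by (simp add: D_def)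
    also have "\<dots> \<le> L" unfolding L_def by (rule member_le_sum) (use fin CK in auto)
    finally show False using l C by (simp add: fibre_def j_inv_def)
  qed
qed

end
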